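(* Let $(\Omega,\sigma)$ be minimal and let $f\in C^{0,2}(\Omega\times\mathbb{R},\mathbb{R})$ be $(\mathrm{DC})$ and $(\mathrm{Co})$ and such that there exists only one $\tau_\lambda$-minimal set for all $\lambda\in\mathbb{R}$, where $\tau_\lambda$ is the flow given by $x'=f(\omega\cdot t,x)+\lambda$. (i) If $(\Omega,\sigma)$ is uniquely ergodic (resp. finitely ergodic), then there exists at most one value (resp. a finite number of values) of the parameter $\lambda$ at which the minimal set is a nonhyperbolic copy of the base. (ii) If there exists $\lambda_0\in\mathbb{R}$ such that the Sacker and Sell spectrum of $f_x$ on the global attractor $\mathcal{A}_{\lambda_0}$ of $\tau_{\lambda_0}$ is $\{0\}$, then $\lambda_0$ is the only value of the parameter at which the minimal set is nonhyperbolic.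
   Context: $\Omega$ is a compact metric space with a continuous flow $\sigma:\mathbb{R}\times\Omega\to\Omega$, $\sigma(t,\omega)=\omega\cdot t$; minimal means every $\sigma$-orbit is dense. $(\Omega,\sigma)$ is uniquely ergodic if it has exactly one normalized invariant Borel measure, and finitely ergodic if its set of normalized ergodic Borel measures is finite. $C^{0,2}(\Omega\times\mathbb{R},\mathbb{R})$: functions $f$ such that $f,f_x,f_{xx}$ exist and are jointly continuous. $t\mapsto u_\lambda(t,\omega,x_0)$ is the maximal solution of $x'=f(\omega\cdot t,x)+\lambda$ with $u_\lambda(0,\omega,x_0)=x_0$, and $\tau_\lambda(t,\omega,x_0)=(\omega\cdot t,u_\lambda(t,\omega,x_0))$. A $\tau_\lambda$-minimal set is a nonempty compact $\tau_\lambda$-invariant subset of $\Omega\times\mathbb{R}$ containing properly no other such set. A copy of the base is the graph of a continuous $\tau_\lambda$-equilibrium, i.e., of a continuous $\beta:\Omega\to\mathbb{R}$ with $\beta(\omega\cdot t)=u_\lambda(t,\omega,\beta(\omega))$ for all $\omega,t$. A minimal set is hyperbolic attractive (resp. repulsive) if there are $\delta>0,k\ge1,\gamma>0$ such that if $(\omega,x)$ is in the set and $|y-x|<\delta$ then $|u_\lambda(t,\omega,y)-u_\lambda(t,\omega,x)|\le ke^{-\gamma|t|}|y-x|$ for all $t\ge0$ (resp. $t\le0$); if neither holds it is nonhyperbolic. $f$ is $(\mathrm{DC})$ if $f_x(\omega,\cdot)$ is concave on $\mathbb{R}$ for all $\omega$, and $(\mathrm{Co})$ if $\lim_{|x|\to\infty}f(\omega,x)/x=-\infty$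 uniformly on $\Omega$. Under (Co), $\tau_\lambda$ has a global attractor $\mathcal{A}_\lambda$: a compact $\tau_\lambda$-invariant set attracting every bounded set in the Hausdorff semidistance. For a continuous flow on a compact metric space $Y$ (written $y\cdot t$) and a continuous $a:Y\to\mathbb{R}$, $x'=a(y\cdot t)x$ has exponential dichotomy over $Y$ if there are $k\ge1,\delta>0$ such that either $\exp\int_0^ta(y\cdot s)ds\le ke^{-\delta t}$ for all $y\in Y,t\ge0$, or $\exp\int_0^ta(y\cdot s)ds\le ke^{\delta t}$ for all $y\in Y,t\le0$. The Sacker and Sell spectrum of $a$ is the set of $\lambda\in\mathbb{R}$ such that $x'=(a(y\cdot t)-\lambda)x$ has no exponential dichotomy over $Y$. The Sacker and Sell spectrum of $f_x$ on a compact $\tau_\lambda$-invariant set $\mathcal{K}$ is that of $f_x:\mathcal{K}\to\mathbb{R}$ over the flow $(\mathcal{K},\tau_\lambda)$. *)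

theory Defs
  imports "HOL-Probability.Probability"
begin

definition continuous_flow :: "(real \<Rightarrow> 'w::metric_space \<Rightarrow> 'w) \<Rightarrow> bool" where
  "continuous_flow \<sigma> \<longleftrightarrow>
     continuous_on UNIV (\<lambda>(t, \<omega>). \<sigma> t \<omega>) \<and>
     (\<forall>\<omega>. \<sigma> 0 \<omega> = \<omega>) \<and> (\<forall>s t \<omega>. \<sigma> (s + t) \<omega> = \<sigma> s (\<sigma> t \<omega>))"

definition minimal_flow :: "(real \<Rightarrow> 'w::metric_space \<Rightarrow> 'w) \<Rightarrow> bool" where
  "minimal_flow \<sigma> \<longleftrightarrow> (\<forall>\<omega>. closure (range (\<lambda>t. \<sigma> t \<omega>)) = UNIV)"

definition invariant_prob :: "(real \<Rightarrow> 'w::metric_space \<Rightarrow> 'w) \<Rightarrow> 'w measure \<Rightarrow> bool" where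
  "invariant_prob \<sigma> \<mu> \<longleftrightarrow>
     prob_space \<mu> \<and> sets \<mu> = sets borel \<and> (\<forall>t. distr \<mu> borel (\<sigma> t) = \<mu>)"

definition ergodic_prob :: "(real \<Rightarrow> 'w::metric_space \<Rightarrow> 'w) \<Rightarrow> 'w measure \<Rightarrow> bool" where
  "ergodic_prob \<sigma> \<mu> \<longleftrightarrow>
     invariant_prob \<sigma> \<mu> \<and>
     (\<forall>A \<in> sets borel. (\<forall>t. \<sigma> t -` A = A) \<longrightarrow> measure \<mu> A = 0 \<or> measure \<mu> A = 1)"

definition uniquely_ergodic :: "(real \<Rightarrow> 'w::metric_space \<Rightarrow> 'w) \<Rightarrow> bool" where
  "uniquely_ergodic \<sigma> \<longleftrightarrow> (\<exists>!\<mu>. invariant_prob \<sigma> \<mu>)"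

definition finitely_ergodic :: "(real \<Rightarrow> 'w::metric_space \<Rightarrow> 'w) \<Rightarrow> bool" where
  "finitely_ergodic \<sigma> \<longleftrightarrow> finite {\<mu>. ergodic_prob \<sigma> \<mu>}"

definition C02 :: "('w::metric_space \<Rightarrow> real \<Rightarrow> real) \<Rightarrow> bool" where
  "C02 f \<longleftrightarrow>
     (\<forall>\<omega> x. f \<omega> differentiable (at x) \<and> deriv (f \<omega>) differentiable (at x)) \<and>
     continuous_on UNIV (\<lambda>(\<omega>, x). f \<omega> x) \<and>
     continuous_on UNIV (\<lambda>(\<omega>, x). deriv (f \<omega>) x) \<and>
     continuous_on UNIV (\<lambda>(\<omega>, x). deriv (deriv (f \<omega>)) x)"

definition DC :: "('w \<Rightarrow> real \<Rightarrow> real) \<Rightarrow> bool" where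
  "DC f \<longleftrightarrow> (\<forall>\<omega>. concave_on UNIV (deriv (f \<omega>)))"

definition Co :: "('w \<Rightarrow> real \<Rightarrow> real) \<Rightarrow> bool" where
  "Co f \<longleftrightarrow> (\<forall>m. \<forall>\<^sub>F x in at_infinity. \<forall>\<omega>. f \<omega> x / x < m)"

definition shifted :: "('w \<Rightarrow> real \<Rightarrow> real) \<Rightarrow> real \<Rightarrow> 'w \<Rightarrow> real \<Rightarrow> real" where
  "shifted f l \<omega> x = f \<omega> x + l"

definition solves_on ::
  "(real \<Rightarrow> 'w \<Rightarrow> 'w) \<Rightarrow> ('w \<Rightarrow> real \<Rightarrow> real) \<Rightarrow> 'w \<Rightarrow> real \<Rightarrow> real set \<Rightarrow> (real \<Rightarrow> real) \<Rightarrow> bool" where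
  "solves_on \<sigma> g \<omega> x0 J v \<longleftrightarrow>
     open J \<and> is_interval J \<and> 0 \<in> J \<and> v 0 = x0 \<and>
     (\<forall>t\<in>J. (v has_real_derivative g (\<sigma> t \<omega>) (v t)) (at t))"

text \<open>
  For right-hand sides of class C02 the initial value problem has unique solutions, so all
  solutions agree on common intervals. The maximal solution is then obtained by gluing:
  its domain is the union of the domains of all solutions. The value \<open>sol \<sigma> g t \<omega> x0\<close> is
  meaningful only for \<open>t \<in> sol_dom \<sigma> g \<omega> x0\<close>, hence the explicit membership conditions
  below, which the informal notation leaves implicit.
\<close>

definition sol_dom :: "(real \<Rightarrow> 'w \<Rightarrow> 'w) \<Rightarrow> ('w \<Rightarrow> real \<Rightarrow> real) \<Rightarrow> 'w \<Rightarrow> real \<Rightarrow> real set" where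
  "sol_dom \<sigma> g \<omega> x0 = \<Union>{J. \<exists>v. solves_on \<sigma> g \<omega> x0 J v}"

definition sol :: "(real \<Rightarrow> 'w \<Rightarrow> 'w) \<Rightarrow> ('w \<Rightarrow> real \<Rightarrow> real) \<Rightarrow> real \<Rightarrow> 'w \<Rightarrow> real \<Rightarrow> real" where
  "sol \<sigma> g t \<omega> x0 = (THE y. \<exists>J v. solves_on \<sigma> g \<omega> x0 J v \<and> t \<in> J \<and> v t = y)"

definition skew :: "(real \<Rightarrow> 'w \<Rightarrow> 'w) \<Rightarrow> ('w \<Rightarrow> real \<Rightarrow> real) \<Rightarrow> real \<Rightarrow> 'w \<times> real \<Rightarrow> 'w \<times> real" where
  "skew \<sigma> g t = (\<lambda>(\<omega>, x). (\<sigma> t \<omega>, sol \<sigma> g t \<omega> x))"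

definition skew_invariant ::
  "(real \<Rightarrow> 'w \<Rightarrow> 'w) \<Rightarrow> ('w \<Rightarrow> real \<Rightarrow> real) \<Rightarrow> ('w \<times> real) set \<Rightarrow> bool" where
  "skew_invariant \<sigma> g K \<longleftrightarrow>
     (\<forall>(\<omega>, x)\<in>K. \<forall>t. t \<in> sol_dom \<sigma> g \<omega> x \<and> skew \<sigma> g t (\<omega>, x) \<in> K)"

definition minimal_set ::
  "(real \<Rightarrow> 'w::metric_space \<Rightarrow> 'w) \<Rightarrow> ('w \<Rightarrow> real \<Rightarrow> real) \<Rightarrow> ('w \<times> real) set \<Rightarrow> bool" where
  "minimal_set \<sigma> g M \<longleftrightarrow>
     M \<noteq> {} \<and> compact M \<and> skew_invariant \<sigma> g M \<and>
     \<not> (\<exists>K. K \<subset> M \<and> K \<noteq> {} \<and> compact K \<and> skew_invariant \<sigma> g K)"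

definition continuous_equilibrium ::
  "(real \<Rightarrow> 'w::metric_space \<Rightarrow> 'w) \<Rightarrow> ('w \<Rightarrow> real \<Rightarrow> real) \<Rightarrow> ('w \<Rightarrow> real) \<Rightarrow> bool" where
  "continuous_equilibrium \<sigma> g \<beta> \<longleftrightarrow>
     continuous_on UNIV \<beta> \<and>
     (\<forall>\<omega> t. t \<in> sol_dom \<sigma> g \<omega> (\<beta> \<omega>) \<and> \<beta> (\<sigma> t \<omega>) = sol \<sigma> g t \<omega> (\<beta> \<omega>))"

definition copy_of_base ::
  "(real \<Rightarrow> 'w::metric_space \<Rightarrow> 'w) \<Rightarrow> ('w \<Rightarrow> real \<Rightarrow> real) \<Rightarrow> ('w \<times> real) set \<Rightarrow> bool" where
  "copy_of_base \<sigma> g M \<longleftrightarrow>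
     (\<exists>\<beta>. continuous_equilibrium \<sigma> g \<beta> \<and> M = range (\<lambda>\<omega>. (\<omega>, \<beta> \<omega>)))"

definition hyperbolic_on ::
  "real set \<Rightarrow> (real \<Rightarrow> 'w \<Rightarrow> 'w) \<Rightarrow> ('w \<Rightarrow> real \<Rightarrow> real) \<Rightarrow> ('w \<times> real) set \<Rightarrow> bool" where
  "hyperbolic_on T \<sigma> g M \<longleftrightarrow>
     (\<exists>\<delta> k \<gamma>. \<delta> > 0 \<and> k \<ge> 1 \<and> \<gamma> > 0 \<and>
        (\<forall>(\<omega>, x)\<in>M. \<forall>y. \<bar>y - x\<bar> < \<delta> \<longrightarrow>
           (\<forall>t\<in>T. t \<in> sol_dom \<sigma> g \<omega> y \<and>
              \<bar>sol \<sigma> g t \<omega> y - sol \<sigma> g t \<omega> x\<bar> \<le> k * exp (- \<gamma> * \<bar>t\<bar>) * \<bar>y - x\<bar>)))"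

abbreviation "hyperbolic_attractive \<equiv> hyperbolic_on {0..}"

abbreviation "hyperbolic_repulsive \<equiv> hyperbolic_on {..0}"

definition nonhyperbolic ::
  "(real \<Rightarrow> 'w \<Rightarrow> 'w) \<Rightarrow> ('w \<Rightarrow> real \<Rightarrow> real) \<Rightarrow> ('w \<times> real) set \<Rightarrow> bool" where
  "nonhyperbolic \<sigma> g M \<longleftrightarrow> \<not> hyperbolic_attractive \<sigma> g M \<and> \<not> hyperbolic_repulsive \<sigma> g M"

text \<open>Valued in \<^typ>\<open>ennreal\<close>, so that suprema and infima need no side conditions.\<close>

definition hausdorff_semidist :: "'a::metric_space set \<Rightarrow> 'a set \<Rightarrow> ennreal" where
  "hausdorff_semidist B A = (SUP b\<in>B. INF a\<in>A. ennreal (dist b a))"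

definition global_attractor ::
  "(real \<Rightarrow> 'w::metric_space \<Rightarrow> 'w) \<Rightarrow> ('w \<Rightarrow> real \<Rightarrow> real) \<Rightarrow> ('w \<times> real) set \<Rightarrow> bool" where
  "global_attractor \<sigma> g A \<longleftrightarrow>
     compact A \<and> skew_invariant \<sigma> g A \<and>
     (\<forall>B. bounded B \<longrightarrow>
        (\<forall>(\<omega>, x)\<in>B. {0..} \<subseteq> sol_dom \<sigma> g \<omega> x) \<and>
        ((\<lambda>t. hausdorff_semidist (skew \<sigma> g t ` B) A) \<longlongrightarrow> 0) at_top)"

text \<open>
  \<open>LBINT s=0..t. _\<close> is the oriented integral, so it changes sign for \<open>t < 0\<close>.
\<close>

definition exponential_dichotomy ::
  "'y set \<Rightarrow> (real \<Rightarrow> 'y \<Rightarrow> 'y) \<Rightarrow> ('y \<Rightarrow> real) \<Rightarrow> bool" where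
  "exponential_dichotomy Y \<phi> a \<longleftrightarrow>
     (\<exists>k \<delta>. k \<ge> 1 \<and> \<delta> > 0 \<and>
        ((\<forall>y\<in>Y. \<forall>t\<ge>0. exp (LBINT s=ereal 0..ereal t. a (\<phi> s y)) \<le> k * exp (- \<delta> * t)) \<or>
         (\<forall>y\<in>Y. \<forall>t\<le>0. exp (LBINT s=ereal 0..ereal t. a (\<phi> s y)) \<le> k * exp (\<delta> * t))))"

definition sacker_sell_spectrum ::
  "'y set \<Rightarrow> (real \<Rightarrow> 'y \<Rightarrow> 'y) \<Rightarrow> ('y \<Rightarrow> real) \<Rightarrow> real set" where
  "sacker_sell_spectrum Y \<phi> a = {\<mu>. \<not> exponential_dichotomy Y \<phi> (\<lambda>y. a y - \<mu>)}"

end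

theory Submission
  imports Defs
begin

text \<open>
  Write \<open>f\<^sub>x\<close> for the derivative of \<open>f\<close> in the state variable. Everything rests on one inequality.
  Let \<open>p \<le> q\<close> be orbits over the same base point for the parameters \<open>lp < lq\<close>, and let
  \<open>d = q - p\<close>. Since \<open>f\<^sub>x\<close> is concave, its mean over the segment from \<open>p\<close> to \<open>q\<close> is at least the
  mean of its two end values (\<open>hermite_hadamard\<close>), so that
  \<open>d' / d \<ge> (f\<^sub>x(p) + f\<^sub>x(q)) / 2 + (lq - lp) / d\<close>. The left-hand side is the derivative of \<open>ln d\<close>
  and has mean zero as long as \<open>d\<close> is bounded and bounded away from zero; hence the two Lyapunov
  exponents have a negative sum.

  Part (i). Let the minimal sets at \<open>l1 < l2\<close> be the graphs of \<open>\<beta>1\<close> and \<open>\<beta>2\<close>. The graph of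
  \<open>\<beta>2\<close> is a barrier for the smaller parameter, below which some complete bounded orbit runs. The
  compact invariant set of all such orbits contains a minimal set, which must be the graph of
  \<open>\<beta>1\<close> by uniqueness; this gives \<open>\<beta>1 < \<beta>2\<close> (\<open>copies_increase\<close>). Integrating the inequality
  against an invariant measure \<open>\<mu>\<close> of the base shows that the exponents of the two copies with
  respect to \<open>\<mu>\<close> have a negative sum (\<open>exponents_of_ordered_copies\<close>). On the other hand, a copy
  that is not hyperbolic attractive has a nonnegative exponent with respect to some ergodic measure
  (\<open>nonattractive_copy_has_nonnegative_exponent\<close>): otherwise the time averages of \<open>f\<^sub>x\<close> would be
  uniformly negative. So one ergodic measure cannot serve two different parameters, and there are
  at most as many parameters with a nonhyperbolic copy as there are ergodic measures.

  The ergodic measure is found among the invariant means, that is, the invariant positive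
  normalized functionals on continuous functions. They form a compact convex set in the product
  topology; a minimal closed face of the set on which \<open>f\<^sub>x\<close> has maximal mean is a single extreme
  point, its representing measure is obtained from Caratheodory's construction, and extremality
  makes this measure ergodic.

  Part (ii). If the spectrum on the attractor at \<open>l0\<close> is \<open>{0}\<close>, then \<open>f\<^sub>x\<close> has neither exponential
  growth nor exponential decay along the orbits of the attractor, whence no nonempty compact
  invariant subset is hyperbolic (\<open>nonhyperbolic_at_zero_spectrum\<close>). For \<open>l \<noteq> l0\<close> each orbit of a compact
  \<open>\<tau>\<^sub>l\<close>-invariant set has an orbit of the attractor on the appropriate side of it, and the
  inequality turns the absence of decay on the latter into uniform decay on the former
  (\<open>attractive_off_zero_spectrum\<close>).
\<close>

section \<open>Minimal closed sets\<close>

text \<open>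
  Zorn's lemma for a property stable under intersections. It is used twice: for invariant sets of
  a flow, and for faces of a compact convex set in a function space.
\<close>

lemma minimal_closed_subset:
  fixes K :: "'a::topological_space set"
  assumes "compact K" "closed K" "K \<noteq> {}" "Q K"
    and Inter: "\<And>C. C \<noteq> {} \<Longrightarrow> (\<And>X. X \<in> C \<Longrightarrow> Q X) \<Longrightarrow> Q (\<Inter>C)"
  obtains M where "M \<subseteq> K" "closed M" "M \<noteq> {}" "Q M"
    "\<And>N. N \<subseteq> M \<Longrightarrow> closed N \<Longrightarrow> N \<noteq> {} \<Longrightarrow> Q N \<Longrightarrow> N = M"
proof -
  define F where "F = {X. X \<subseteq> K \<and> closed X \<and> X \<noteq> {} \<and> Q X}"
  have KF: "K \<in> F" using assms by (auto simp: F_def)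
  have "\<exists>M\<in>uminus ` F. \<forall>X\<in>uminus ` F. M \<subseteq> X \<longrightarrow> X = M"
  proof (rule subset_Zorn)
    fix C assume ch: "subset.chain (uminus ` F) C"
    show "\<exists>U\<in>uminus ` F. \<forall>X\<in>C. X \<subseteq> U"
    proof (cases "C = {}")
      case True
      then show ?thesis using KF by blast
    next
      case False
      define D where "D = uminus ` C"
      have DF: "D \<subseteq> F" using ch unfolding D_def subset.chain_def by auto
      have Dne: "D \<noteq> {}" using False by (auto simp: D_def)
      have lin: "X \<subseteq> Y \<or> Y \<subseteq> X" if "X \<in> D" "Y \<in> D" for X Y
        using that ch unfolding D_def subset_chain_def by blast
      have "K \<inter> \<Inter>D \<noteq> {}"
      proof (rule compact_imp_fip[OF \<open>compact K\<close>])
        show "closed T" if "T \<in> D" for T using that DF by (auto simp: F_def)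
      next
        fix F' assume fin: "finite F'" "F' \<subseteq> D"
        show "K \<inter> \<Inter>F' \<noteq> {}"
        proof (cases "F' = {}")
          case True then show ?thesis using \<open>K \<noteq> {}\<close> by simp
        next
          case False
          have "\<Inter>F' \<in> F'"
            using fin(1) False fin(2)
          proof (induction F' rule: finite_ne_induct)
            case (singleton x) then show ?case by simp
          next
            case (insert x F')
            then have "\<Inter>F' \<in> F'" "x \<in> D" by auto
            moreover have "\<Inter>F' \<in> D" using insert.prems \<open>\<Inter>F' \<in> F'\<close> by auto
            ultimately have "x \<subseteq> \<Inter>F' \<or> \<Inter>F' \<subseteq> x" using lin by blast
            then have "x \<inter> \<Inter>F' = x \<or> x \<inter> \<Inter>F' = \<Inter>F'" by blast
            then show ?case using \<open>\<Inter>F' \<in> F'\<close> by auto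
          qed
          then have "\<Inter>F' \<in> F" using fin(2) DF by blast
          then show ?thesis by (auto simp: F_def)
        qed
      qed
      then have ne: "\<Inter>D \<noteq> {}" by blast
      have "\<Inter>D \<subseteq> K" using Dne DF by (auto simp: F_def)
      moreover have "closed (\<Inter>D)" using DF by (auto simp: F_def)
      moreover have "Q (\<Inter>D)" by (rule Inter[OF Dne]) (use DF in \<open>auto simp: F_def\<close>)
      ultimately have "\<Inter>D \<in> F" using ne by (auto simp: F_def)
      then have "- \<Inter>D \<in> uminus ` F" by (rule imageI)
      moreover have "X \<subseteq> - \<Inter>D" if "X \<in> C" for X
      proof -
        have "- X \<in> D" using that by (simp add: D_def)
        then show ?thesis by blast
      qed
      ultimately show ?thesis by blast
    qed
  qed
  then obtain M where MF: "M \<in> F" and "\<forall>X\<in>uminus ` F. - M \<subseteq> X \<longrightarrow> X = - M" by (rule bexE) (erule imageE, simp)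
  then have M: "X = M" if "X \<in> F" "X \<subseteq> M" for X
    using that imageI[OF that(1), of uminus] by (metis Compl_anti_mono double_complement)
  show ?thesis
  proof (rule that[of M])
    show "M \<subseteq> K" "closed M" "M \<noteq> {}" "Q M" using MF by (auto simp: F_def)
    fix N assume "N \<subseteq> M" "closed N" "N \<noteq> {}" "Q N"
    moreover have "N \<subseteq> K" using \<open>N \<subseteq> M\<close> \<open>M \<subseteq> K\<close> by blast
    ultimately show "N = M" by (intro M) (auto simp: F_def)
  qed
qed

section \<open>The Riesz representation theorem on a compact metric space\<close>

text \<open>
  Continuous functions increasing to the indicator of an open set. The case \<open>U = UNIV\<close> is separate
  because \<open>infdist x {} = 0\<close>.
\<close>

definition bump :: "nat \<Rightarrow> 'w::metric_space set \<Rightarrow> 'w \<Rightarrow> real" where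
  "bump n U x = (if U = UNIV then 1 else min 1 (real n * infdist x (- U)))"

lemma bump_nonneg: "0 \<le> bump n U x" and bump_le_1: "bump n U x \<le> 1"
  by (auto simp: bump_def infdist_nonneg)

lemma bump_outside: "x \<notin> U \<Longrightarrow> bump n U x = 0"
  by (auto simp: bump_def infdist_zero)

lemma bump_le_indicator: "bump n U x \<le> indicator U x"
  using bump_le_1[of n U x] bump_outside[of x U n] by (auto split: split_indicator)

lemma bump_mono: "m \<le> n \<Longrightarrow> bump m U x \<le> bump n U x"
  using mult_right_mono[of "real m" "real n" "infdist x (- U)"] by (auto simp: bump_def infdist_nonneg min_def)

lemma continuous_bump: "continuous_on UNIV (bump n U)"
  unfolding bump_def by (cases "U = UNIV") (auto intro!: continuous_intros)

lemma bump_tendsto: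
  assumes "open U"
  shows "(\<lambda>n. bump n U x) \<longlonglongrightarrow> indicator U x"
proof (cases "x \<in> U \<and> U \<noteq> UNIV")
  case True
  then have "infdist x (- U) > 0"
    using assms in_closed_iff_infdist_zero[of "- U" x] infdist_nonneg[of x "-U"] by (force simp: closed_Compl)
  then obtain N where N: "real N * infdist x (- U) > 1"
    using reals_Archimedean3 by blast
  have "eventually (\<lambda>n. bump n U x = 1) sequentially"
    using eventually_ge_at_top[of N]
  proof eventually_elim
    case (elim n)
    then have "real N * infdist x (- U) \<le> real n * infdist x (- U)"
      by (intro mult_right_mono) (auto simp: infdist_nonneg)
    then show ?case using N True by (auto simp: bump_def)
  qed
  then show ?thesis using True by (simp add: tendsto_eventually)
next
  case False
  then have "bump n U x = indicator U x" for n by (auto simp: bump_def)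
  then show ?thesis by simp
qed

lemma borel_measure_eqI_continuous:
  fixes \<mu> \<nu> :: "'w::metric_space measure"
  assumes "finite_measure \<mu>" "finite_measure \<nu>" and s: "sets \<mu> = sets borel" "sets \<nu> = sets borel"
    and eq: "\<And>g::'w \<Rightarrow> real. continuous_on UNIV g \<Longrightarrow> (\<And>x. 0 \<le> g x) \<Longrightarrow> (\<And>x. g x \<le> 1) \<Longrightarrow> integral\<^sup>L \<mu> g = integral\<^sup>L \<nu> g"
  shows "\<mu> = \<nu>"
proof -
  interpret m: finite_measure \<mu> by fact
  interpret n: finite_measure \<nu> by fact
  have meas: "bump k U \<in> borel_measurable borel" for k and U :: "'w set"
    by (rule borel_measurable_continuous_onI[OF continuous_bump])
  have lim: "(\<lambda>k. integral\<^sup>L N (bump k U)) \<longlonglongrightarrow> measure N U"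
    if "finite_measure N" "sets N = sets borel" "open U" for N :: "'w measure" and U
  proof -
    interpret finite_measure N by fact
    have [measurable_cong]: "sets N = sets borel" by fact
    have sp: "space N = UNIV" using sets_eq_imp_space_eq[OF that(2)] by simp
    have [measurable]: "bump k U \<in> borel_measurable N" for k U
      using meas[of k U] by measurable
    have [measurable]: "U \<in> sets N" using that by auto
    have "(\<lambda>k. integral\<^sup>L N (bump k U)) \<longlonglongrightarrow> integral\<^sup>L N (indicator U)"
    proof (rule integral_dominated_convergence[where w="\<lambda>_. 1"])
      show "AE x in N. (\<lambda>k. bump k U x) \<longlonglongrightarrow> indicator U x"
        using bump_tendsto[OF that(3)] by auto
      show "AE x in N. norm (bump k U x) \<le> 1" for k
        using bump_nonneg[of k U] bump_le_1[of k U] by simp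
    qed auto
    then show ?thesis by (simp add: sp)
  qed
  show ?thesis
  proof (rule measure_eqI_generator_eq[where E="{U. open U}" and \<Omega>=UNIV and A="\<lambda>_. UNIV"])
    show "Int_stable {U::'w set. open U}" by (auto simp: Int_stable_def)
    fix U :: "'w set" assume "U \<in> {U. open U}"
    then have U: "open U" by simp
    have "(\<lambda>k. integral\<^sup>L \<mu> (bump k U)) = (\<lambda>k. integral\<^sup>L \<nu> (bump k U))"
      using eq[OF continuous_bump bump_nonneg bump_le_1] by auto
    then have "measure \<mu> U = measure \<nu> U"
      using lim[OF assms(1) s(1) U] lim[OF assms(2) s(2) U] LIMSEQ_unique by metis
    then show "emeasure \<mu> U = emeasure \<nu> U"
      by (simp add: m.emeasure_eq_measure n.emeasure_eq_measure)
  qed (use s in \<open>auto simp: borel_def\<close>)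
qed

text \<open>
  Only the values on continuous functions matter; fixing the value \<open>0\<close> elsewhere makes equality of
  means extensional and the set of all means compact in the product topology.
\<close>

definition positive_mean :: "(('w::metric_space \<Rightarrow> real) \<Rightarrow> real) \<Rightarrow> bool" where
  "positive_mean L \<longleftrightarrow>
     (\<forall>g h. continuous_on UNIV g \<longrightarrow> continuous_on UNIV h \<longrightarrow> L (\<lambda>x. g x + h x) = L g + L h) \<and>
     (\<forall>c g. continuous_on UNIV g \<longrightarrow> L (\<lambda>x. c * g x) = c * L g) \<and>
     (\<forall>g. continuous_on UNIV g \<longrightarrow> (\<forall>x. 0 \<le> g x) \<longrightarrow> 0 \<le> L g) \<and>
     L (\<lambda>_. 1) = 1 \<and>
     (\<forall>g. \<not> continuous_on UNIV g \<longrightarrow> L g = 0)"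

locale mean_functional =
  fixes L :: "('w::metric_space \<Rightarrow> real) \<Rightarrow> real"
  assumes compact_space: "compact (UNIV :: 'w set)"
    and mean: "positive_mean L"
begin

lemma
  assumes "continuous_on UNIV g" "continuous_on UNIV h"
  shows add: "L (\<lambda>x. g x + h x) = L g + L h"
    and mono: "(\<And>x. g x \<le> h x) \<Longrightarrow> L g \<le> L h"
    and diff: "L (\<lambda>x. h x - g x) = L h - L g"
proof -
  show "L (\<lambda>x. g x + h x) = L g + L h"
    using mean assms unfolding positive_mean_def by blast
  have "L (\<lambda>x. h x + (-1) * g x) = L h + L (\<lambda>x. (-1) * g x)"
    using mean assms continuous_on_mult_left[OF assms(1), of "-1"] unfolding positive_mean_def by blast
  also have "L (\<lambda>x. (-1) * g x) = (-1) * L g"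
    using mean assms unfolding positive_mean_def by blast
  finally show *: "L (\<lambda>x. h x - g x) = L h - L g" by simp
  assume "\<And>x. g x \<le> h x"
  then have "0 \<le> L (\<lambda>x. h x - g x)"
    using mean assms continuous_on_diff[OF assms(2,1)] unfolding positive_mean_def by simp
  then show "L g \<le> L h" using * by simp
qed

lemma scale: "continuous_on UNIV g \<Longrightarrow> L (\<lambda>x. c * g x) = c * L g"
  using mean unfolding positive_mean_def by blast

lemma const: "L (\<lambda>_. c) = c"
  using scale[of "\<lambda>_. 1" c] mean by (simp add: positive_mean_def)

lemma sum: "finite I \<Longrightarrow> (\<And>i. i \<in> I \<Longrightarrow> continuous_on UNIV (g i)) \<Longrightarrow>
    L (\<lambda>x. \<Sum>i\<in>I. g i x) = (\<Sum>i\<in>I. L (g i))"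
proof (induction I rule: finite_induct)
  case empty then show ?case using const[of 0] by simp
next
  case (insert i I)
  then show ?case by (simp add: add continuous_on_sum)
qed

text \<open>
  As in the classical construction, \<open>inner U\<close> is the supremum of \<open>L\<close> over the continuous functions
  below the indicator of an open set \<open>U\<close>, and \<open>outer\<close> approximates arbitrary sets by open ones.
\<close>

definition below :: "'w set \<Rightarrow> ('w \<Rightarrow> real) set" where
  "below U = {g. continuous_on UNIV g \<and> (\<forall>x. 0 \<le> g x \<and> g x \<le> indicator U x)}"

definition inner :: "'w set \<Rightarrow> ennreal" where
  "inner U = (SUP g\<in>below U. ennreal (L g))"

definition outer :: "'w set \<Rightarrow> ennreal" where
  "outer A = (INF U\<in>{U. open U \<and> A \<subseteq> U}. inner U)"

lemma belowD: "g \<in> below U \<Longrightarrow> continuous_on UNIV g" "g \<in> below U \<Longrightarrow> 0 \<le> g x"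
  "g \<in> below U \<Longrightarrow> g x \<le> indicator U x" "g \<in> below U \<Longrightarrow> g x \<le> 1"
  "g \<in> below U \<Longrightarrow> x \<notin> U \<Longrightarrow> g x = 0"
proof -
  assume "g \<in> below U"
  then have *: "continuous_on UNIV g" "0 \<le> g x" "g x \<le> indicator U x" by (auto simp: below_def)
  show "continuous_on UNIV g" "0 \<le> g x" "g x \<le> indicator U x" by fact+
  show "g x \<le> 1" using *(3) by (rule order_trans) (simp add: indicator_def)
  show "x \<notin> U \<Longrightarrow> g x = 0" using * by simp
qed

lemma L_nonneg: "continuous_on UNIV g \<Longrightarrow> (\<And>x. 0 \<le> g x) \<Longrightarrow> 0 \<le> L g"
  using mean by (auto simp: positive_mean_def)

lemma le_inner: "g \<in> below U \<Longrightarrow> ennreal (L g) \<le> inner U"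
  unfolding inner_def by (rule SUP_upper)

lemma inner_mono: "U \<subseteq> V \<Longrightarrow> inner U \<le> inner V"
  unfolding inner_def
proof (rule SUP_subset_mono)
  assume "U \<subseteq> V"
  then have *: "indicator U x \<le> (indicator V x :: real)" for x by (auto simp: indicator_def)
  show "below U \<subseteq> below V" unfolding below_def using order_trans[OF _ *] by blast
qed simp

lemma outer_open: "open U \<Longrightarrow> outer U = inner U"
  unfolding outer_def by (intro antisym INF_lower INF_greatest) (auto intro: inner_mono)

lemma outer_mono: "A \<subseteq> B \<Longrightarrow> outer A \<le> outer B"
  unfolding outer_def by (rule INF_superset_mono) auto

lemma inner_UNIV: "inner UNIV = 1"
proof (rule antisym)
  have "L g \<le> 1" if "g \<in> below UNIV" for g
    using mono[of g "\<lambda>_. 1"] belowD[OF that] by (simp add: const)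
  then show "inner UNIV \<le> 1" unfolding inner_def by (intro SUP_least) (simp add: ennreal_le_1)
  show "1 \<le> inner UNIV"
    using le_inner[of "\<lambda>_. 1" UNIV] by (simp add: below_def const)
qed

lemma inner_empty: "inner {} = 0"
proof -
  have "L g = 0" if "g \<in> below {}" for g
  proof -
    have "g = (\<lambda>_. 0)" using belowD(5)[OF that] by auto
    then show ?thesis by (simp add: const)
  qed
  then show ?thesis unfolding inner_def by (intro antisym SUP_least) simp_all
qed

text \<open>
  Dini's argument: partial sums of bumps increase to a function that is at least \<open>1\<close> on the
  union, so by compactness one of them already dominates a given \<open>f\<close> below the union up to \<open>e\<close>.
\<close>

lemma inner_UN_le:
  fixes U :: "nat \<Rightarrow> 'w set"
  assumes U: "\<And>i. open (U i)"
  shows "inner (\<Union>i. U i) \<le> (\<Sum>i. inner (U i))"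
  unfolding inner_def[of "\<Union>i. U i"]
proof (rule SUP_least)
  fix f assume f: "f \<in> below (\<Union>i. U i)"
  show "ennreal (L f) \<le> (\<Sum>i. inner (U i))"
  proof (rule ennreal_le_epsilon)
    fix e :: real assume e: "0 < e"
    define S where "S n x = (\<Sum>i<n. bump n (U i) x)" for n x
    have contS: "continuous_on UNIV (S n)" for n
      unfolding S_def by (intro continuous_intros continuous_on_sum continuous_bump)
    define V where "V n = {x. f x - e < S n x}" for n
    have openV: "open (V n)" for n
      unfolding V_def by (intro open_Collect_less continuous_intros belowD(1)[OF f] contS)
    have monoS: "S m x \<le> S n x" if "m \<le> n" for m n x
    proof -
      have "S m x \<le> (\<Sum>i<m. bump n (U i) x)"
        unfolding S_def by (intro sum_mono bump_mono that)
      also have "\<dots> \<le> S n x"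
        unfolding S_def using that by (intro sum_mono2) (auto simp: bump_nonneg)
      finally show ?thesis .
    qed
    have cover: "UNIV \<subseteq> \<Union>(range V)"
    proof
      fix x
      show "x \<in> \<Union>(range V)"
      proof (cases "x \<in> (\<Union>i. U i)")
        case True
        then obtain i where i: "x \<in> U i" by auto
        have "(\<lambda>n. bump n (U i) x) \<longlonglongrightarrow> 1" using bump_tendsto[OF U[of i], of x] i by simp
        moreover have "f x - e < 1" using belowD(4)[OF f, of x] e by simp
        ultimately have "eventually (\<lambda>n. f x - e < bump n (U i) x) sequentially"
          by (rule order_tendstoD)
        then obtain N where N: "\<And>n. n \<ge> N \<Longrightarrow> f x - e < bump n (U i) x" by (auto simp: eventually_sequentially)
        define n where "n = max N (Suc i)"
        have "bump n (U i) x \<le> S n x"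
          unfolding S_def by (rule member_le_sum[of i]) (auto simp: bump_nonneg n_def)
        then have "x \<in> V n" using N[of n] by (auto simp: V_def n_def)
        then show ?thesis by blast
      next
        case False
        then have "x \<in> V 0" using belowD(5)[OF f] e by (auto simp: V_def S_def)
        then show ?thesis by blast
      qed
    qed
    obtain I where I: "finite I" "UNIV \<subseteq> \<Union>(V ` I)"
      using compactE_image[OF compact_space, of UNIV V] openV cover by auto
    define N where "N = Max I"
    have fS: "f x \<le> e + S N x" for x
    proof -
      obtain n where "n \<in> I" "x \<in> V n" using I(2) by auto
      then have "f x - e < S n x" "S n x \<le> S N x"
        using monoS[of n N x] Max_ge[OF I(1)] by (auto simp: V_def N_def)
      then show ?thesis by simp
    qed
    have "L f \<le> L (\<lambda>x. e + S N x)"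
      by (intro mono belowD(1)[OF f] continuous_intros contS fS)
    also have "\<dots> = e + L (S N)" using add[OF _ contS, of "\<lambda>_. e"] by (simp add: const)
    also have "L (S N) = (\<Sum>i<N. L (bump N (U i)))"
      unfolding S_def by (rule sum) (auto intro: continuous_bump)
    finally have "ennreal (L f) \<le> ennreal (e + (\<Sum>i<N. L (bump N (U i))))" by (rule ennreal_leI)
    also have "\<dots> = ennreal e + (\<Sum>i<N. ennreal (L (bump N (U i))))"
      using e by (simp add: ennreal_plus sum_nonneg L_nonneg continuous_bump bump_nonneg sum_ennreal)
    also have "\<dots> \<le> ennreal e + (\<Sum>i<N. inner (U i))"
      by (intro add_left_mono sum_mono le_inner) (auto simp: below_def continuous_bump bump_nonneg bump_le_indicator)
    also have "\<dots> \<le> ennreal e + (\<Sum>i. inner (U i))"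
      by (intro add_left_mono sum_le_suminf) auto
    finally show "ennreal (L f) \<le> (\<Sum>i. inner (U i)) + ennreal e" by (simp add: add.commute)
  qed
qed

lemma outer_le_1: "outer A \<le> 1"
  using outer_mono[of A UNIV] by (simp add: outer_open inner_UNIV)

lemma outer_approx:
  assumes "e > 0"
  obtains U where "open U" "A \<subseteq> U" "inner U \<le> outer A + ennreal e"
proof -
  have "outer A < outer A + ennreal e"
  proof (rule ennreal_add_left_cancel_less[of "outer A" 0, THEN iffD2, unfolded add_0_right])
    have "outer A < \<top>" using outer_le_1[of A] by (rule le_less_trans) simp
    then show "outer A \<noteq> \<infinity> \<and> 0 < ennreal e" using assms by (simp add: less_top)
  qed
  then obtain U where "open U" "A \<subseteq> U" "inner U < outer A + ennreal e"
    unfolding outer_def INF_less_iff by auto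
  then show ?thesis using that[of U] by simp
qed

lemma outer_measure_space_outer: "outer_measure_space UNIV outer"
  unfolding outer_measure_space_def
proof (intro conjI)
  show "positive UNIV outer" by (simp add: positive_def outer_open inner_empty)
  show "increasing UNIV outer" by (simp add: increasing_def outer_mono)
  show "countably_subadditive UNIV outer"
    unfolding countably_subadditive_def
  proof safe
    fix A :: "nat \<Rightarrow> 'w set"
    show "outer (\<Union>i. A i) \<le> (\<Sum>i. outer (A i))"
    proof (rule ennreal_le_epsilon)
      fix e :: real assume e: "0 < e"
      have "\<exists>U. open U \<and> A i \<subseteq> U \<and> inner U \<le> outer (A i) + ennreal (e * (1/2)^Suc i)" for i
        using outer_approx[of "e * (1/2)^Suc i" "A i"] e by (metis mult_pos_pos zero_less_power zero_less_divide_1_iff zero_less_numeral)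
      then obtain U where U: "\<And>i. open (U i)" "\<And>i. A i \<subseteq> U i"
        "\<And>i. inner (U i) \<le> outer (A i) + ennreal (e * (1/2)^Suc i)" by metis
      have "outer (\<Union>i. A i) \<le> outer (\<Union>i. U i)" using U(2) by (intro outer_mono) auto
      also have "\<dots> \<le> (\<Sum>i. inner (U i))" using U(1) by (simp add: outer_open inner_UN_le open_UN)
      also have "\<dots> \<le> (\<Sum>i. outer (A i) + ennreal (e * (1/2)^Suc i))" by (intro suminf_le U(3)) auto
      also have "\<dots> = (\<Sum>i. outer (A i)) + (\<Sum>i. ennreal e * ennreal ((1/2)^Suc i))"
        using e by (subst suminf_add[symmetric]) (auto simp del: ennreal_suminf_cmult simp add: ennreal_mult[symmetric])
      also have "\<dots> = (\<Sum>i. outer (A i)) + ennreal e"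
        unfolding ennreal_suminf_cmult
        by (subst suminf_ennreal_eq[OF zero_le_power power_half_series]) auto
      finally show "outer (\<Union>i. A i) \<le> (\<Sum>i. outer (A i)) + ennreal e" .
    qed
  qed
qed

text \<open>
  Half of the measurability of \<open>U\<close>. For \<open>f\<close> below \<open>V \<inter> U\<close> the function \<open>max 0 (f - e)\<close> vanishes
  where \<open>f < e\<close>, which is an open set containing \<open>V - U\<close>; so it can be added to any function
  below that set without leaving the functions below \<open>V\<close>.
\<close>

lemma inner_split:
  assumes "open V" "open U"
  shows "inner (V \<inter> U) + outer (V - U) \<le> inner V"
proof (rule ennreal_le_epsilon)
  fix e :: real assume e: "0 < e"
  have main: "ennreal (L f) + outer (V - U) \<le> inner V + ennreal e" if f: "f \<in> below (V \<inter> U)" for f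
  proof -
    define h where "h x = max 0 (f x - e)" for x
    define W where "W = V \<inter> {x. f x < e}"
    have hc: "continuous_on UNIV h" unfolding h_def by (intro continuous_intros belowD(1)[OF f])
    have hnn: "0 \<le> L h" by (rule L_nonneg[OF hc]) (simp add: h_def)
    have W: "open W" unfolding W_def by (intro open_Int assms open_Collect_less belowD(1)[OF f] continuous_intros)
    have "V - U \<subseteq> W" using belowD(5)[OF f] e by (auto simp: W_def)
    then have "outer (V - U) \<le> inner W" using outer_mono[of "V - U" W] outer_open[OF W] by simp
    also have "ennreal (L h) + inner W \<le> inner V"
      unfolding inner_def[of W]
    proof (subst ennreal_SUP_add_right)
      show "below W \<noteq> {}" by (auto simp: below_def intro!: exI[of _ "\<lambda>_. 0"])
      show "(SUP g\<in>below W. ennreal (L h) + ennreal (L g)) \<le> inner V"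
      proof (rule SUP_least)
        fix g assume g: "g \<in> below W"
        have "(\<lambda>x. h x + g x) \<in> below V"
          unfolding below_def
        proof (intro CollectI conjI allI)
          show "continuous_on UNIV (\<lambda>x. h x + g x)" by (intro continuous_intros hc belowD(1)[OF g])
          fix x
          show "0 \<le> h x + g x" using belowD(2)[OF g, of x] by (simp add: h_def)
          show "h x + g x \<le> indicator V x"
          proof (cases "x \<in> W")
            case True
            then show ?thesis using belowD(4)[OF g, of x] by (auto simp: h_def W_def)
          next
            case False
            then have "g x = 0" by (rule belowD(5)[OF g])
            moreover have "h x \<le> indicator V x"
              using belowD(4)[OF f, of x] belowD(5)[OF f, of x] e by (cases "x \<in> V") (auto simp: h_def)
            ultimately show ?thesis by simp
          qed
        qed
        then have "ennreal (L (\<lambda>x. h x + g x)) \<le> inner V" by (rule le_inner)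
        then show "ennreal (L h) + ennreal (L g) \<le> inner V"
          by (subst ennreal_plus[symmetric]) (auto simp: add[OF hc belowD(1)[OF g]] hnn hc belowD[OF g] L_nonneg)
      qed
    qed
    finally have 1: "ennreal (L h) + outer (V - U) \<le> inner V" by (simp add: add_left_mono)
    have "L f \<le> L (\<lambda>x. e + h x)"
      by (intro mono belowD(1)[OF f] continuous_intros hc) (auto simp: h_def)
    also have "\<dots> = e + L h" using add[OF _ hc, of "\<lambda>_. e"] by (simp add: const)
    finally have "ennreal (L f) \<le> ennreal e + ennreal (L h)"
      using e hnn by (simp add: ennreal_leI flip: ennreal_plus)
    then have "ennreal (L f) + outer (V - U) \<le> ennreal e + (ennreal (L h) + outer (V - U))"
      by (simp add: add.assoc[symmetric] add_right_mono)
    also have "\<dots> \<le> ennreal e + inner V" using 1 by (intro add_left_mono)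
    finally show ?thesis by (simp add: add.commute)
  qed
  have "inner (V \<inter> U) + outer (V - U) = (SUP f\<in>below (V \<inter> U). ennreal (L f) + outer (V - U))"
    unfolding inner_def by (subst ennreal_SUP_add_left[symmetric]) (auto simp: below_def intro!: exI[of _ "\<lambda>_. 0"])
  also have "\<dots> \<le> inner V + ennreal e" by (rule SUP_least) (rule main)
  finally show "inner (V \<inter> U) + outer (V - U) \<le> inner V + ennreal e" .
qed

lemma open_in_lambda_system:
  assumes U: "open U"
  shows "U \<in> lambda_system UNIV UNIV outer"
  unfolding lambda_system_def
proof (intro CollectI conjI ballI antisym)
  fix X :: "'w set"
  have "ring_of_sets UNIV (Pow UNIV :: 'w set set)"
    using algebra_Pow[of "UNIV :: 'w set"] by (simp only: algebra_def)
  then have sub: "subadditive UNIV outer"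
    using ring_of_sets.countably_subadditive_subadditive[of UNIV "UNIV :: 'w set set" outer]
      outer_measure_space_outer by (simp add: outer_measure_space_def)
  have "outer ((U \<inter> X) \<union> ((UNIV - U) \<inter> X)) \<le> outer (U \<inter> X) + outer ((UNIV - U) \<inter> X)"
    by (rule subadditiveD[OF sub]) auto
  moreover have "(U \<inter> X) \<union> ((UNIV - U) \<inter> X) = X" by auto
  ultimately show "outer X \<le> outer (U \<inter> X) + outer ((UNIV - U) \<inter> X)" by simp
  show "outer (U \<inter> X) + outer ((UNIV - U) \<inter> X) \<le> outer X"
  proof (rule ennreal_le_epsilon)
    fix e :: real assume "0 < e"
    then obtain V where V: "open V" "X \<subseteq> V" "inner V \<le> outer X + ennreal e" by (rule outer_approx)
    have "outer (U \<inter> X) \<le> inner (V \<inter> U)"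
      using outer_mono[of "U \<inter> X" "V \<inter> U"] V(1,2) U by (simp add: outer_open open_Int) blast
    moreover have "outer ((UNIV - U) \<inter> X) \<le> outer (V - U)" using V by (intro outer_mono) auto
    ultimately have "outer (U \<inter> X) + outer ((UNIV - U) \<inter> X) \<le> inner (V \<inter> U) + outer (V - U)"
      by (rule add_mono)
    also have "\<dots> \<le> inner V" by (rule inner_split[OF V(1) U])
    also note V(3)
    finally show "outer (U \<inter> X) + outer ((UNIV - U) \<inter> X) \<le> outer X + ennreal e" .
  qed
qed simp

definition riesz :: "'w measure" where
  "riesz = measure_of UNIV (sets borel) outer"

lemma sets_riesz: "sets riesz = sets borel"
  unfolding riesz_def by (metis sets.sets_measure_of_eq space_borel)

lemma emeasure_riesz: "A \<in> sets borel \<Longrightarrow> emeasure riesz A = outer A"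
proof -
  have ms: "measure_space UNIV (lambda_system UNIV UNIV outer) outer"
    using sigma_algebra.caratheodory_lemma[OF sigma_algebra_Pow[of "UNIV :: 'w set"], of outer]
      outer_measure_space_outer by simp
  then have sa: "sigma_algebra UNIV (lambda_system UNIV UNIV outer)" by (simp add: measure_space_def)
  have sub: "sets borel \<subseteq> lambda_system UNIV UNIV outer"
    unfolding borel_def
    using sigma_algebra.sigma_sets_subset[OF sa, of "{S. open S}"] open_in_lambda_system by auto
  have ca: "countably_additive (sets (borel :: 'w measure)) outer"
    unfolding countably_additive_def
  proof (intro allI impI)
    fix B :: "nat \<Rightarrow> 'w set"
    assume B: "range B \<subseteq> sets borel" "disjoint_family B" "(\<Union>i. B i) \<in> sets borel"
    have "countably_additive (lambda_system UNIV UNIV outer) outer" using ms by (simp add: measure_space_def)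
    then show "(\<Sum>i. outer (B i)) = outer (\<Union>i. B i)"
      using B sub unfolding countably_additive_def by (meson subset_trans subsetD)
  qed
  have sb: "sigma_algebra UNIV (sets (borel :: 'w measure))"
    using sets.sigma_algebra_axioms[of "borel :: 'w measure"] by simp
  have pb: "positive (sets (borel :: 'w measure)) outer"
    by (simp add: positive_def outer_open inner_empty)
  assume "A \<in> sets borel"
  then show ?thesis
    unfolding riesz_def by (rule emeasure_measure_of_sigma[OF sb pb ca])
qed

lemma prob_space_riesz: "prob_space riesz"
proof
  have "space riesz = UNIV" using sets_eq_imp_space_eq[OF sets_riesz] by simp
  then show "emeasure riesz (space riesz) = 1"
    by (simp add: emeasure_riesz outer_open inner_UNIV)
qed

lemma L_le_measure: "open U \<Longrightarrow> g \<in> below U \<Longrightarrow> L g \<le> measure riesz U"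
proof -
  assume *: "open U" "g \<in> below U"
  interpret prob_space riesz by (rule prob_space_riesz)
  have "ennreal (L g) \<le> ennreal (measure riesz U)"
  proof -
    have "ennreal (L g) \<le> outer U" using le_inner[OF *(2)] outer_open[OF *(1)] by simp
    also have "\<dots> = emeasure riesz U" using *(1) by (simp add: emeasure_riesz)
    also have "\<dots> = ennreal (measure riesz U)" by (rule emeasure_eq_measure)
    finally show ?thesis .
  qed
  then show ?thesis by simp
qed

lemma integrable_riesz:
  assumes "continuous_on UNIV g" shows "integrable riesz (g :: 'w \<Rightarrow> real)"
proof -
  interpret prob_space riesz by (rule prob_space_riesz)
  have "bounded (range g)" using compact_continuous_image[OF assms compact_space] by (rule compact_imp_bounded)
  then obtain B where "\<And>x. \<bar>g x\<bar> \<le> B" by (auto simp: bounded_iff)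
  moreover have "g \<in> borel_measurable riesz"
    using borel_measurable_continuous_onI[OF assms] sets_riesz measurable_cong_sets by blast
  ultimately show ?thesis by (intro integrable_const_bound[where B=B]) auto
qed

text \<open>
  Layer-cake decomposition: \<open>N f\<close> is the sum of the slices \<open>F k\<close> of height one, and \<open>F k\<close> lies
  between the indicators of the level sets \<open>U (k + 1)\<close> and \<open>U k\<close>. The shift by one level costs
  an error of \<open>1 / N\<close>.
\<close>

lemma L_le_integral_unit:
  assumes f: "continuous_on UNIV f" "\<And>x. 0 \<le> f x" "\<And>x. f x \<le> 1"
  shows "L f \<le> integral\<^sup>L riesz f"
proof (rule field_le_epsilon)
  interpret prob_space riesz by (rule prob_space_riesz)
  have sp: "space riesz = UNIV" using sets_eq_imp_space_eq[OF sets_riesz] by simp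
  fix e :: real assume "0 < e"
  then obtain N where N: "0 < N" "1 / real N < e"
    by (metis nat_approx_posE zero_less_Suc)
  define F where "F k x = max 0 (min 1 (real N * f x - real k))" for k x
  define U where "U k = {x. real k < real N * f x}" for k
  have Fc: "continuous_on UNIV (F k)" for k unfolding F_def by (intro continuous_intros f)
  have Uo: "open (U k)" for k unfolding U_def by (intro open_Collect_less continuous_intros f)
  have FU: "F k \<in> below (U k)" for k
    using Fc[of k] by (auto simp: below_def F_def U_def indicator_def)
  have UF: "indicator (U (Suc k)) x \<le> F k x" for k x
    by (auto simp: F_def U_def indicator_def)
  have sumF: "(\<Sum>k<N. F k x) = real N * f x" for x
  proof -
    have "(\<Sum>k<n. F k x) = min (real n) (real N * f x)" for n
      using f(2)[of x] by (induction n) (auto simp: F_def)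
    from this[of N] show ?thesis using f(3)[of x] N by (simp add: min_def mult_left_le)
  qed
  have int: "integrable riesz (F k)" for k by (rule integrable_riesz[OF Fc])
  have mU: "measure riesz (U (Suc k)) \<le> integral\<^sup>L riesz (F k)" for k
  proof -
    have "integral\<^sup>L riesz (indicator (U (Suc k))) \<le> integral\<^sup>L riesz (F k)"
      using Uo[of "Suc k"] sets_riesz
      by (intro integral_mono int UF) (auto simp: integrable_indicator_iff emeasure_eq_measure)
    then show ?thesis by (simp add: sp)
  qed
  have "real N * L f = L (\<lambda>x. \<Sum>k<N. F k x)"
    using scale[OF f(1), of "real N"] by (simp add: sumF)
  also have "\<dots> = (\<Sum>k<N. L (F k))" by (rule sum) (auto intro: Fc)
  also have "\<dots> \<le> (\<Sum>k<N. measure riesz (U k))" by (intro sum_mono L_le_measure Uo FU)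
  also have "\<dots> \<le> (\<Sum>k<Suc N. measure riesz (U k))" by simp
  also have "\<dots> = measure riesz (U 0) + (\<Sum>k<N. measure riesz (U (Suc k)))" by (rule sum.lessThan_Suc_shift)
  also have "\<dots> \<le> 1 + (\<Sum>k<N. integral\<^sup>L riesz (F k))" by (intro add_mono sum_mono mU prob_le_1)
  also have "(\<Sum>k<N. integral\<^sup>L riesz (F k)) = real N * integral\<^sup>L riesz f"
    by (subst Bochner_Integration.integral_sum[symmetric]) (simp_all add: int sumF)
  finally have "L f \<le> 1 / real N + integral\<^sup>L riesz f" using N by (simp add: field_simps)
  then show "L f \<le> integral\<^sup>L riesz f + e" using N by simp
qed

theorem integral_riesz:
  assumes "continuous_on UNIV g"
  shows "integral\<^sup>L riesz g = L g"
proof -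
  interpret prob_space riesz by (rule prob_space_riesz)
  have unit: "L f = integral\<^sup>L riesz f"
    if f: "continuous_on UNIV f" "\<And>x. 0 \<le> f x" "\<And>x. f x \<le> 1" for f
  proof (rule antisym)
    show "L f \<le> integral\<^sup>L riesz f" by (rule L_le_integral_unit[OF f])
    \<comment> \<open>The reverse inequality is the first one for the complementary function.\<close>
    have "L (\<lambda>x. 1 - f x) \<le> integral\<^sup>L riesz (\<lambda>x. 1 - f x)"
      by (rule L_le_integral_unit) (auto intro!: continuous_intros f simp: f)
    moreover have "L (\<lambda>x. 1 - f x) = 1 - L f" using diff[OF f(1), of "\<lambda>_. 1"] by (simp add: const)
    moreover have "integral\<^sup>L riesz (\<lambda>x. 1 - f x) = 1 - integral\<^sup>L riesz f"
      using integrable_riesz[OF f(1)] prob_space by simp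
    ultimately show "integral\<^sup>L riesz f \<le> L f" by simp
  qed
  have "bounded (range g)" using compact_continuous_image[OF assms compact_space] by (rule compact_imp_bounded)
  then obtain B where B: "B > 0" "\<And>x. \<bar>g x\<bar> \<le> B" unfolding bounded_pos by auto
  define f where "f x = (g x + B) / (2 * B)" for x
  have f: "continuous_on UNIV f" "0 \<le> f x" "f x \<le> 1" for x
    using B(1) B(2)[of x] unfolding f_def by (auto intro!: continuous_intros assms simp: abs_le_iff field_simps)
  have g: "g = (\<lambda>x. 2 * B * f x - B)" using B by (auto simp: f_def)
  have "L g = 2 * B * L f - B"
    unfolding g using diff[of "\<lambda>_. B" "\<lambda>x. 2 * B * f x"] scale[OF f(1), of "2*B"]
    by (simp add: const continuous_on_mult_left f)
  moreover have "integral\<^sup>L riesz g = 2 * B * integral\<^sup>L riesz f - B"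
    unfolding g using integrable_riesz[OF f(1)] prob_space by simp
  ultimately show ?thesis using unit[OF f] by simp
qed

end

section \<open>Invariant means and ergodic measures\<close>

lemma continuous_antiderivative:
  fixes h :: "real \<Rightarrow> real"
  assumes "continuous_on UNIV h"
  obtains H where "H 0 = 0" "\<And>t. (H has_real_derivative h t) (at t)"
proof -
  have "\<And>x. isCont h x" using assms by (simp add: continuous_on_eq_continuous_at)
  then obtain F where "\<And>x. (F has_vector_derivative h x) (at x)"
    using einterval_antiderivative[of "-\<infinity>" "\<infinity>" h] by auto
  then have "\<And>x. ((\<lambda>t. F t - F 0) has_real_derivative h x) (at x)"
    by (auto simp: has_real_derivative_iff_has_vector_derivative intro!: derivative_eq_intros)
  then show ?thesis by (intro that[of "\<lambda>t. F t - F 0"]) auto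
qed

lemma derivative_bound_imp_lipschitz:
  fixes H :: "real \<Rightarrow> real"
  assumes "\<And>t. (H has_real_derivative h t) (at t)" "\<And>t. \<bar>h t\<bar> \<le> B"
  shows "\<bar>H s - H t\<bar> \<le> B * \<bar>s - t\<bar>"
  using field_differentiable_bound[of UNIV H h B s t] assms by auto

lemma integral_eq_antiderivative:
  fixes H :: "real \<Rightarrow> real"
  assumes "\<And>t. (H has_real_derivative h t) (at t)" "0 \<le> T"
  shows "integral {0..T} h = H T - H 0"
proof (rule integral_unique, rule fundamental_theorem_of_calculus[OF assms(2)])
  fix x
  have "(H has_vector_derivative h x) (at x)"
    using assms(1)[of x] by (simp add: has_real_derivative_iff_has_vector_derivative)
  then show "(H has_vector_derivative h x) (at x within {0..T})" by (rule has_vector_derivative_at_within)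
qed

lemma integral_shift_bound:
  fixes h :: "real \<Rightarrow> real"
  assumes "continuous_on UNIV h" "\<And>s. \<bar>h s\<bar> \<le> B" "0 \<le> T"
  shows "\<bar>integral {0..T} (\<lambda>s. h (s + t)) - integral {0..T} h\<bar> \<le> 2 * \<bar>t\<bar> * B"
proof -
  obtain H where H: "H 0 = 0" "\<And>t. (H has_real_derivative h t) (at t)"
    using continuous_antiderivative[OF assms(1)] by blast
  have "((\<lambda>s. H (s + t)) has_real_derivative h (s + t)) (at s)" for s
    using H(2)[of "s + t"] by (simp add: DERIV_shift)
  then have 1: "integral {0..T} (\<lambda>s. h (s + t)) = H (T + t) - H t"
    using integral_eq_antiderivative[of "\<lambda>s. H (s + t)" "\<lambda>s. h (s + t)" T] assms(3) by simp
  have 2: "integral {0..T} h = H T - H 0" using integral_eq_antiderivative[OF H(2) assms(3)] .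
  have 3: "\<bar>H (T + t) - H T\<bar> \<le> B * \<bar>t\<bar>"
    using derivative_bound_imp_lipschitz[OF H(2) assms(2), of "T + t" T] by simp
  have 4: "\<bar>H t - H 0\<bar> \<le> B * \<bar>t\<bar>"
    using derivative_bound_imp_lipschitz[OF H(2) assms(2), of t 0] by simp
  show ?thesis using 1 2 3 4 by (simp add: algebra_simps abs_le_iff)
qed

definition invariant_mean :: "(real \<Rightarrow> 'w::metric_space \<Rightarrow> 'w) \<Rightarrow> (('w \<Rightarrow> real) \<Rightarrow> real) \<Rightarrow> bool" where
  "invariant_mean \<sigma> L \<longleftrightarrow> positive_mean L \<and>
     (\<forall>g t. continuous_on UNIV g \<longrightarrow> L (\<lambda>x. g (\<sigma> t x)) = L g)"

lemma compact_space_bounded: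
  fixes g :: "'w::metric_space \<Rightarrow> real"
  assumes "compact (UNIV :: 'w set)" "continuous_on UNIV g"
  obtains B where "B > 0" "\<And>x. \<bar>g x\<bar> \<le> B"
proof -
  have "bounded (range g)" using compact_continuous_image[OF assms(2,1)] by (rule compact_imp_bounded)
  then show ?thesis using that unfolding bounded_pos by auto
qed

lemma closed_positive_means: "closed {L. positive_mean L}"
  unfolding positive_mean_def
  by (intro closed_Collect_conj closed_Collect_all closed_Collect_imp closed_Collect_eq closed_Collect_le
      open_Collect_const continuous_intros continuous_on_product_coordinates)

lemma compact_positive_means:
  assumes "compact (UNIV :: 'w::metric_space set)"
  shows "compact {L :: ('w \<Rightarrow> real) \<Rightarrow> real. positive_mean L}"
proof -
  have "\<forall>g :: 'w \<Rightarrow> real. \<exists>B. continuous_on UNIV g \<longrightarrow> (\<forall>x. \<bar>g x\<bar> \<le> B)"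
  proof (intro allI)
    fix g :: "'w \<Rightarrow> real"
    show "\<exists>B. continuous_on UNIV g \<longrightarrow> (\<forall>x. \<bar>g x\<bar> \<le> B)"
    proof (cases "continuous_on UNIV g")
      case True
      then obtain B where "\<And>x. \<bar>g x\<bar> \<le> B" using compact_space_bounded[OF assms] by blast
      then show ?thesis by blast
    qed simp
  qed
  from choice[OF this] obtain B where B: "\<And>(g :: 'w \<Rightarrow> real) x. continuous_on UNIV g \<Longrightarrow> \<bar>g x\<bar> \<le> B g" by blast
  define X where "X g = (if continuous_on UNIV g then {- B g .. B g} else {0})" for g :: "'w \<Rightarrow> real"
  have "compact (PiE UNIV X)"
    using compactin_PiE[of "\<lambda>_. euclidean" UNIV X]
    by (simp add: euclidean_product_topology X_def)
  then have "compact (PiE UNIV X \<inter> {L. positive_mean L})"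
    by (rule compact_Int_closed[OF _ closed_positive_means])
  moreover have "L \<in> PiE UNIV X" if "positive_mean L" for L
  proof -
    interpret mean_functional L by unfold_locales fact+
    have "L g \<in> X g" for g
    proof (cases "continuous_on UNIV g")
      case True
      have "L g \<le> L (\<lambda>_. B g)" using B[OF True] by (intro mono True) (auto simp: abs_le_iff)
      moreover have "L (\<lambda>_. - B g) \<le> L g" using B[OF True] by (intro mono True) (auto simp: abs_le_iff minus_le_iff)
      ultimately show ?thesis using True by (simp add: X_def const)
    next
      case False
      then show ?thesis using that by (simp add: X_def positive_mean_def)
    qed
    then show ?thesis by auto
  qed
  ultimately show ?thesis by (simp add: Int_absorb1 subset_iff)
qed

locale compact_flow =
  fixes \<sigma> :: "real \<Rightarrow> 'w::metric_space \<Rightarrow> 'w"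
  assumes compact_space: "compact (UNIV :: 'w set)"
    and flow: "continuous_flow \<sigma>"
begin

lemma flow_0 [simp]: "\<sigma> 0 \<omega> = \<omega>" and flow_add: "\<sigma> (s + t) \<omega> = \<sigma> s (\<sigma> t \<omega>)"
  using flow by (auto simp: continuous_flow_def)

lemma continuous_flow_comp:
  assumes "continuous_on S p" "continuous_on S q"
  shows "continuous_on S (\<lambda>x. \<sigma> (p x) (q x))"
proof -
  have "continuous_on UNIV (\<lambda>(t, \<omega>). \<sigma> t \<omega>)" using flow by (simp add: continuous_flow_def)
  then have "continuous_on S ((\<lambda>(t, \<omega>). \<sigma> t \<omega>) \<circ> (\<lambda>x. (p x, q x)))"
    by (intro continuous_on_compose continuous_intros assms) (rule continuous_on_subset, auto)
  then show ?thesis by (simp add: o_def)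
qed

lemma continuous_along:
  assumes "continuous_on UNIV (g :: 'w \<Rightarrow> real)" "continuous_on S p" "continuous_on S q"
  shows "continuous_on S (\<lambda>x. g (\<sigma> (p x) (q x)))"
  using continuous_on_compose2[OF assms(1) continuous_flow_comp[OF assms(2,3)]] by auto

lemma continuous_shift: "continuous_on UNIV (g :: 'w \<Rightarrow> real) \<Longrightarrow> continuous_on UNIV (\<lambda>x. g (\<sigma> t x))"
  by (rule continuous_along[OF _ continuous_on_const continuous_on_id])

lemma closed_invariant_means: "closed {L. invariant_mean \<sigma> L}"
  unfolding invariant_mean_def
  by (intro closed_Collect_conj closed_positive_means closed_Collect_all closed_Collect_imp closed_Collect_eq
      open_Collect_const continuous_on_product_coordinates)

lemma compact_invariant_means: "compact {L. invariant_mean \<sigma> L}"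
proof -
  have "compact ({L. positive_mean L} \<inter> {L. invariant_mean \<sigma> L})"
    by (rule compact_Int_closed[OF compact_positive_means[OF compact_space] closed_invariant_means])
  moreover have "{L. positive_mean L} \<inter> {L. invariant_mean \<sigma> L} = {L. invariant_mean \<sigma> L}"
    by (auto simp: invariant_mean_def)
  ultimately show ?thesis by simp
qed

definition average :: "real \<Rightarrow> 'w \<Rightarrow> ('w \<Rightarrow> real) \<Rightarrow> real" where
  "average T \<omega> g = (if continuous_on UNIV g then integral {0..T} (\<lambda>s. g (\<sigma> s \<omega>)) / T else 0)"

lemma average_eq: "continuous_on UNIV g \<Longrightarrow> average T \<omega> g = integral {0..T} (\<lambda>s. g (\<sigma> s \<omega>)) / T"
  by (simp add: average_def)

lemma integrable_along: "continuous_on UNIV (g :: 'w \<Rightarrow> real) \<Longrightarrow> (\<lambda>s. g (\<sigma> s \<omega>)) integrable_on {a..b}"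
  by (intro integrable_continuous_interval continuous_along continuous_intros)

lemma positive_mean_average:
  assumes "T > 0"
  shows "positive_mean (average T \<omega>)"
  unfolding positive_mean_def
proof (intro conjI allI impI)
  fix g h :: "'w \<Rightarrow> real" assume g: "continuous_on UNIV g" "continuous_on UNIV h"
  then show "average T \<omega> (\<lambda>x. g x + h x) = average T \<omega> g + average T \<omega> h"
    using continuous_on_add[OF g] by (simp add: average_eq Henstock_Kurzweil_Integration.integral_add integrable_along add_divide_distrib)
next
  fix g :: "'w \<Rightarrow> real" and c assume g: "continuous_on UNIV g"
  then show "average T \<omega> (\<lambda>x. c * g x) = c * average T \<omega> g"
    using continuous_on_mult_left[OF g, of c] by (simp add: average_eq)
next
  fix g :: "'w \<Rightarrow> real" assume g: "continuous_on UNIV g" "\<forall>x. 0 \<le> g x"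
  then show "0 \<le> average T \<omega> g"
    using assms by (simp add: average_eq Henstock_Kurzweil_Integration.integral_nonneg integrable_along)
next
  show "average T \<omega> (\<lambda>_. 1) = 1" using assms by (simp add: average_eq)
next
  fix g :: "'w \<Rightarrow> real" assume "\<not> continuous_on UNIV g"
  then show "average T \<omega> g = 0" by (simp add: average_def)
qed

text \<open>
  Shifting the window of integration changes the integral only near the two ends of \<open>[0, T]\<close>.
\<close>

lemma average_almost_invariant:
  assumes "T > 0" "continuous_on UNIV g" "\<And>x. \<bar>g x\<bar> \<le> B"
  shows "\<bar>average T \<omega> (\<lambda>x. g (\<sigma> t x)) - average T \<omega> g\<bar> \<le> 2 * \<bar>t\<bar> * B / T"
proof -
  have c: "continuous_on UNIV (\<lambda>x. g (\<sigma> t x))" by (rule continuous_shift[OF assms(2)])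
  have "\<bar>integral {0..T} (\<lambda>s. g (\<sigma> (s + t) \<omega>)) - integral {0..T} (\<lambda>s. g (\<sigma> s \<omega>))\<bar> \<le> 2 * \<bar>t\<bar> * B"
    using assms(1) by (intro integral_shift_bound[of "\<lambda>s. g (\<sigma> s \<omega>)"] continuous_along assms continuous_intros) auto
  then show ?thesis
    using assms(1) by (simp add: average_eq c assms(2) flow_add[symmetric] add.commute
        diff_divide_distrib[symmetric] abs_divide divide_right_mono)
qed

text \<open>
  Krylov--Bogoliubov: the averages over \<open>[0, n]\<close> along the given orbits are almost invariant and
  almost nonnegative at \<open>a\<close>, and compactness of the set of means produces an exact solution. The
  bound \<open>- 1\<close> disappears after division by the length of the interval.
\<close>

lemma exists_invariant_mean_nonneg:
  assumes a: "continuous_on UNIV a"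
    and orbits: "\<And>n::nat. \<exists>\<omega>. - 1 \<le> integral {0..real n} (\<lambda>s. a (\<sigma> s \<omega>))"
  obtains L where "invariant_mean \<sigma> L" "0 \<le> L a"
proof -
  define S where "S n = {L. (\<forall>g t B. continuous_on UNIV g \<and> (\<forall>x. \<bar>g x\<bar> \<le> B) \<longrightarrow>
      \<bar>L (\<lambda>x. g (\<sigma> t x)) - L g\<bar> \<le> 2 * \<bar>t\<bar> * B / real (Suc n)) \<and> - 1 / real (Suc n) \<le> L a}" for n
  have "{L. positive_mean L} \<inter> (\<Inter>n\<in>UNIV. S n) \<noteq> {}"
  proof (rule compact_imp_fip_image[OF compact_positive_means[OF compact_space]])
    fix n
    show "closed (S n)"
      unfolding S_def
      by (intro closed_Collect_conj closed_Collect_all closed_Collect_imp closed_Collect_le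
          open_Collect_const continuous_intros continuous_on_product_coordinates)
  next
    fix I :: "nat set" assume I: "finite I"
    define N where "N = Max (insert 0 I)"
    obtain \<omega> where w: "- 1 \<le> integral {0..real (Suc N)} (\<lambda>s. a (\<sigma> s \<omega>))" using orbits[of "Suc N"] by auto
    have "average (real (Suc N)) \<omega> \<in> S n" if "n \<in> I" for n
    proof -
      have nN: "n \<le> N" using I that by (simp add: N_def)
      have "\<bar>average (Suc N) \<omega> (\<lambda>x. g (\<sigma> t x)) - average (Suc N) \<omega> g\<bar> \<le> 2 * \<bar>t\<bar> * B / real (Suc n)"
        if g: "continuous_on UNIV g" "\<forall>x. \<bar>g x\<bar> \<le> B" for g t B
      proof -
        have "0 \<le> B" using g(2) abs_ge_zero order_trans by metis
        have "\<bar>average (Suc N) \<omega> (\<lambda>x. g (\<sigma> t x)) - average (Suc N) \<omega> g\<bar> \<le> 2 * \<bar>t\<bar> * B / real (Suc N)"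
          using g by (intro average_almost_invariant) auto
        also have "\<dots> \<le> 2 * \<bar>t\<bar> * B / real (Suc n)"
          using nN \<open>0 \<le> B\<close> by (intro divide_left_mono) auto
        finally show ?thesis .
      qed
      moreover have "- 1 / real (Suc n) \<le> average (Suc N) \<omega> a"
      proof -
        have "- 1 / real (Suc n) \<le> - 1 / real (Suc N)" using nN by (simp add: frac_le)
        also have "\<dots> \<le> average (Suc N) \<omega> a"
          using divide_right_mono[OF w, of "real (Suc N)"] by (simp add: average_eq[OF a])
        finally show ?thesis .
      qed
      ultimately show ?thesis unfolding S_def by blast
    qed
    moreover have "positive_mean (average (real (Suc N)) \<omega>)" by (rule positive_mean_average) simp
    ultimately show "{L. positive_mean L} \<inter> (\<Inter>n\<in>I. S n) \<noteq> {}" by blast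
  qed
  then obtain L where L: "positive_mean L" "\<And>n. L \<in> S n" by auto
  \<comment> \<open>Membership in every \<open>S n\<close> forces equality in the limit.\<close>
  have zero: "x \<le> 0" if "\<And>n::nat. x \<le> c / real (Suc n)" for x c :: real
  proof (rule LIMSEQ_le_const)
    show "(\<lambda>n. c * inverse (real (Suc n))) \<longlonglongrightarrow> 0"
      using tendsto_mult_left[OF LIMSEQ_inverse_real_of_nat, of c] by simp
    show "\<exists>N. \<forall>n\<ge>N. x \<le> c * inverse (real (Suc n))" using that by (simp add: divide_inverse)
  qed
  have LS: "- 1 / real (Suc n) \<le> L a"
    "continuous_on UNIV g \<Longrightarrow> (\<And>x. \<bar>g x\<bar> \<le> B) \<Longrightarrow> \<bar>L (\<lambda>x. g (\<sigma> t x)) - L g\<bar> \<le> 2 * \<bar>t\<bar> * B / real (Suc n)"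
    for n g t B using L(2)[of n] unfolding S_def by blast+
  have "- L a \<le> 1 / real (Suc n)" for n using LS(1)[of n] by linarith
  then have "0 \<le> L a" using zero[of "- L a" 1] by simp
  moreover have "L (\<lambda>x. g (\<sigma> t x)) = L g" if g: "continuous_on UNIV g" for g t
  proof -
    obtain B where "\<And>x. \<bar>g x\<bar> \<le> B" using compact_space_bounded[OF compact_space g] by blast
    then have "\<bar>L (\<lambda>x. g (\<sigma> t x)) - L g\<bar> \<le> 0"
      using zero[OF LS(2)[OF g]] by blast
    then show ?thesis by simp
  qed
  ultimately show ?thesis using that[of L] L(1) by (simp add: invariant_mean_def)
qed

definition extreme_mean :: "(('w \<Rightarrow> real) \<Rightarrow> real) \<Rightarrow> bool" where
  "extreme_mean L \<longleftrightarrow> invariant_mean \<sigma> L \<and>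
     (\<forall>L1 L2 p. invariant_mean \<sigma> L1 \<longrightarrow> invariant_mean \<sigma> L2 \<longrightarrow> 0 < p \<longrightarrow> p < 1 \<longrightarrow>
        L = (\<lambda>g. p * L1 g + (1 - p) * L2 g) \<longrightarrow> L1 = L)"

definition face :: "(('w \<Rightarrow> real) \<Rightarrow> real) set \<Rightarrow> bool" where
  "face F \<longleftrightarrow> F \<subseteq> {L. invariant_mean \<sigma> L} \<and>
     (\<forall>L1 L2 p. invariant_mean \<sigma> L1 \<longrightarrow> invariant_mean \<sigma> L2 \<longrightarrow> 0 < p \<longrightarrow> p < 1 \<longrightarrow>
        (\<lambda>g. p * L1 g + (1 - p) * L2 g) \<in> F \<longrightarrow> L1 \<in> F \<and> L2 \<in> F)"

lemma faceD:
  assumes "face F" "invariant_mean \<sigma> L1" "invariant_mean \<sigma> L2" "0 < p" "p < 1"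
    "(\<lambda>g. p * L1 g + (1 - p) * L2 g) \<in> F"
  shows "L1 \<in> F" "L2 \<in> F"
  using assms(1)[unfolded face_def, THEN conjunct2, rule_format, OF assms(2-6)] by simp_all

text \<open>
  The points of a face at which an evaluation is maximal form a face again: a proper convex
  combination attains the maximum only if both of its members do.
\<close>

lemma maximal_subface:
  assumes F: "face F" "closed F" "F \<noteq> {}"
  shows "\<exists>s. (\<forall>L\<in>F. L g \<le> s) \<and> face {L \<in> F. L g = s} \<and> closed {L \<in> F. L g = s} \<and> {L \<in> F. L g = s} \<noteq> {}"
proof -
  have "F \<subseteq> {L. invariant_mean \<sigma> L}" using F by (simp add: face_def)
  then have "{L. invariant_mean \<sigma> L} \<inter> F = F" by blast
  then have cF: "compact F" using compact_Int_closed[OF compact_invariant_means F(2)] by simp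
  then obtain M where M: "M \<in> F" "\<And>L. L \<in> F \<Longrightarrow> L g \<le> M g"
    using continuous_attains_sup[OF cF F(3), of "\<lambda>L. L g"]
      continuous_on_subset[OF continuous_on_product_coordinates subset_UNIV, of F g] by blast
  show ?thesis
  proof (intro exI[of _ "M g"] conjI)
    show "\<forall>L\<in>F. L g \<le> M g" using M by blast
    show "closed {L \<in> F. L g = M g}"
      using F(2) by (intro closed_Collect_conj closed_Collect_eq continuous_on_product_coordinates continuous_intros) simp
    show "{L \<in> F. L g = M g} \<noteq> {}" using M by blast
    show "face {L \<in> F. L g = M g}"
      unfolding face_def
    proof (intro conjI allI impI)
      show "{L \<in> F. L g = M g} \<subseteq> {L. invariant_mean \<sigma> L}" using F(1) by (auto simp: face_def)
      fix L1 L2 and p :: real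
      assume *: "invariant_mean \<sigma> L1" "invariant_mean \<sigma> L2" "0 < p" "p < 1"
        "(\<lambda>g. p * L1 g + (1 - p) * L2 g) \<in> {L \<in> F. L g = M g}"
      have "(\<lambda>g. p * L1 g + (1 - p) * L2 g) \<in> F" using *(5) by simp
      note L = faceD[OF F(1) *(1-4) this]
      have eq: "p * L1 g + (1 - p) * L2 g = M g" using * by simp
      have le: "L1 g \<le> M g" "L2 g \<le> M g" using M(2) L by blast+
      have le': "p * L1 g \<le> p * M g" "(1 - p) * L2 g \<le> (1 - p) * M g" using le * by (auto intro: mult_left_mono)
      have "p * L1 g = p * M g" "(1 - p) * L2 g = (1 - p) * M g"
        using eq le' unfolding left_diff_distrib mult_1 by linarith+
      then have "L1 g = M g" "L2 g = M g" using * by auto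
      then show "L1 \<in> {L \<in> F. L g = M g}" "L2 \<in> {L \<in> F. L g = M g}" using L by auto
    qed
  qed
qed

text \<open>
  The Krein--Milman argument, started at the face on which \<open>L a\<close> is maximal so that the sign of
  \<open>L a\<close> is kept. A minimal closed face is a single point, since otherwise maximizing an evaluation
  that separates two of its points would give a smaller face.
\<close>

lemma exists_extreme_mean:
  assumes L0: "invariant_mean \<sigma> L0" "0 \<le> L0 a"
  obtains L where "extreme_mean L" "0 \<le> L a"
proof -
  have f0: "face {L. invariant_mean \<sigma> L}" by (auto simp: face_def)
  have ne: "{L. invariant_mean \<sigma> L} \<noteq> {}" using L0(1) by blast
  obtain s where s: "\<forall>L\<in>{L. invariant_mean \<sigma> L}. L a \<le> s"
      "face {L \<in> {L. invariant_mean \<sigma> L}. L a = s}" "closed {L \<in> {L. invariant_mean \<sigma> L}. L a = s}"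
      "{L \<in> {L. invariant_mean \<sigma> L}. L a = s} \<noteq> {}"
    using maximal_subface[OF f0 closed_invariant_means ne, of a] by (elim exE conjE)
  define K where "K = {L \<in> {L. invariant_mean \<sigma> L}. L a = s}"
  have s0: "0 \<le> s" using s(1) L0 by force
  have K: "compact K"
    using compact_Int_closed[OF compact_invariant_means s(3)] unfolding K_def by (simp add: Int_def conj_assoc)
  obtain M where M: "M \<subseteq> K" "closed M" "M \<noteq> {}" "face M"
    "\<And>N. N \<subseteq> M \<Longrightarrow> closed N \<Longrightarrow> N \<noteq> {} \<Longrightarrow> face N \<Longrightarrow> N = M"
  proof (rule minimal_closed_subset[OF K, of face])
    show "closed K" "K \<noteq> {}" "face K" using s unfolding K_def by auto
    show "face (\<Inter>C)" if "C \<noteq> {}" "\<And>X. X \<in> C \<Longrightarrow> face X" for C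
      unfolding face_def
    proof (intro conjI allI impI)
      show "\<Inter>C \<subseteq> {L. invariant_mean \<sigma> L}" using that by (auto simp: face_def)
      fix L1 L2 and p :: real
      assume *: "invariant_mean \<sigma> L1" "invariant_mean \<sigma> L2" "0 < p" "p < 1"
        "(\<lambda>g. p * L1 g + (1 - p) * L2 g) \<in> \<Inter>C"
      have "L1 \<in> X \<and> L2 \<in> X" if "X \<in> C" for X
      proof -
        have "(\<lambda>g. p * L1 g + (1 - p) * L2 g) \<in> X" using *(5) that by simp
        from faceD[OF _ *(1-4) this] show ?thesis using that \<open>\<And>X. X \<in> C \<Longrightarrow> face X\<close> by simp
      qed
      then show "L1 \<in> \<Inter>C" "L2 \<in> \<Inter>C" by blast+
    qed
  qed blast
  obtain L where L: "L \<in> M" using M(3) by blast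
  have single: "L' = L" if "L' \<in> M" for L'
  proof
    fix g
    obtain s where s: "face {L \<in> M. L g = s}" "closed {L \<in> M. L g = s}" "{L \<in> M. L g = s} \<noteq> {}"
      using maximal_subface[OF M(4,2,3), of g] by (elim exE conjE)
    have "{L \<in> M. L g = s} = M" by (rule M(5)[OF _ s(2,3,1)]) simp
    then show "L' g = L g" using L that by (metis (mono_tags, lifting) mem_Collect_eq)
  qed
  show ?thesis
  proof (rule that[of L])
    show "0 \<le> L a" using L M(1) s0 by (auto simp: K_def)
    show "extreme_mean L"
      unfolding extreme_mean_def
    proof (intro conjI allI impI)
      show "invariant_mean \<sigma> L" using L M(1) by (auto simp: K_def)
      fix L1 L2 and p :: real
      assume *: "invariant_mean \<sigma> L1" "invariant_mean \<sigma> L2" "0 < p" "p < 1"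
        "L = (\<lambda>g. p * L1 g + (1 - p) * L2 g)"
      then have "L1 \<in> M" using faceD(1)[OF M(4) *(1-4)] L by simp
      then show "L1 = L" by (rule single)
    qed
  qed
qed

lemma flow_measurable: "\<sigma> t \<in> borel_measurable borel"
  by (intro borel_measurable_continuous_onI continuous_flow_comp continuous_intros)

lemma integral_invariant:
  assumes "invariant_prob \<sigma> \<mu>" "g \<in> borel_measurable borel"
  shows "integral\<^sup>L \<mu> (\<lambda>x. g (\<sigma> t x)) = integral\<^sup>L \<mu> (g :: 'w \<Rightarrow> real)"
proof -
  have s: "sets \<mu> = sets borel" and d: "distr \<mu> borel (\<sigma> t) = \<mu>" using assms by (auto simp: invariant_prob_def)
  have "\<sigma> t \<in> measurable \<mu> borel" using flow_measurable[of t] measurable_cong_sets[OF s refl] by blast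
  then have "integral\<^sup>L (distr \<mu> borel (\<sigma> t)) g = integral\<^sup>L \<mu> (\<lambda>x. g (\<sigma> t x))"
    by (rule integral_distr) fact
  then show ?thesis using d by simp
qed

lemma integrable_continuous_mean:
  assumes "invariant_prob \<sigma> \<mu>" "continuous_on UNIV g"
  shows "integrable \<mu> (g :: 'w \<Rightarrow> real)"
proof -
  interpret prob_space \<mu> using assms by (simp add: invariant_prob_def)
  have s: "sets \<mu> = sets borel" using assms by (simp add: invariant_prob_def)
  obtain B where "\<And>x. \<bar>g x\<bar> \<le> B" using compact_space_bounded[OF compact_space assms(2)] by blast
  moreover have "g \<in> borel_measurable \<mu>"
    using borel_measurable_continuous_onI[OF assms(2)] measurable_cong_sets[OF s refl] by blast
  ultimately show ?thesis by (intro integrable_const_bound[where B=B]) auto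
qed

text \<open>
  Conditioning on an invariant set of positive measure; these are the means that witness
  non-extremality of a non-ergodic measure.
\<close>

definition restricted_mean :: "'w measure \<Rightarrow> 'w set \<Rightarrow> ('w \<Rightarrow> real) \<Rightarrow> real" where
  "restricted_mean \<mu> A g =
     (if continuous_on UNIV g then (LINT x|\<mu>. indicator A x * g x) / measure \<mu> A else 0)"

lemma invariant_restricted_mean:
  assumes \<mu>: "invariant_prob \<sigma> \<mu>" and A: "A \<in> sets borel" "\<And>t. \<sigma> t -` A = A" "measure \<mu> A > 0"
  shows "invariant_mean \<sigma> (restricted_mean \<mu> A)"
  unfolding invariant_mean_def positive_mean_def
proof (intro conjI allI impI)
  interpret prob_space \<mu> using \<mu> by (simp add: invariant_prob_def)
  have s: "sets \<mu> = sets borel" using \<mu> by (simp add: invariant_prob_def)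
  have sp: "space \<mu> = UNIV" using sets_eq_imp_space_eq[OF s] by simp
  have int: "integrable \<mu> (\<lambda>x. indicator A x * g x)" if "continuous_on UNIV g" for g :: "'w \<Rightarrow> real"
    using integrable_real_mult_indicator[OF _ integrable_continuous_mean[OF \<mu> that], of A] A(1) s
    by (simp add: mult.commute)
  {
    fix g h :: "'w \<Rightarrow> real" assume g: "continuous_on UNIV g" "continuous_on UNIV h"
    then show "restricted_mean \<mu> A (\<lambda>x. g x + h x) = restricted_mean \<mu> A g + restricted_mean \<mu> A h"
      using continuous_on_add[OF g] int[OF g(1)] int[OF g(2)]
      by (simp add: restricted_mean_def distrib_left add_divide_distrib)
  next
    fix g :: "'w \<Rightarrow> real" and c assume g: "continuous_on UNIV g"
    then show "restricted_mean \<mu> A (\<lambda>x. c * g x) = c * restricted_mean \<mu> A g"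
      using continuous_on_mult_left[OF g, of c] by (simp add: restricted_mean_def mult.left_commute[of _ c])
  next
    fix g :: "'w \<Rightarrow> real" assume "continuous_on UNIV g" "\<forall>x. 0 \<le> g x"
    then show "0 \<le> restricted_mean \<mu> A g"
      by (simp add: restricted_mean_def integral_nonneg_AE)
  next
    show "restricted_mean \<mu> A (\<lambda>_. 1) = 1" using A(3) by (simp add: restricted_mean_def sp)
  next
    fix g :: "'w \<Rightarrow> real" assume "\<not> continuous_on UNIV g"
    then show "restricted_mean \<mu> A g = 0" by (simp add: restricted_mean_def)
  next
    fix g :: "'w \<Rightarrow> real" and t assume g: "continuous_on UNIV g"
    have c: "continuous_on UNIV (\<lambda>x. g (\<sigma> t x))" by (rule continuous_shift[OF g])
    have ind: "(indicator A (\<sigma> t x) :: real) = indicator A x" for x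
      using A(2)[of t] by (auto simp: indicator_def)
    have "(LINT x|\<mu>. indicator A x * g (\<sigma> t x)) = (LINT x|\<mu>. (\<lambda>y. indicator A y * g y) (\<sigma> t x))"
      by (simp add: ind)
    also have "\<dots> = (LINT x|\<mu>. indicator A x * g x)"
      using A(1) by (intro integral_invariant[OF \<mu>] borel_measurable_times
          borel_measurable_indicator borel_measurable_continuous_onI[OF g])
    finally show "restricted_mean \<mu> A (\<lambda>x. g (\<sigma> t x)) = restricted_mean \<mu> A g"
      using c g by (simp add: restricted_mean_def)
  }
qed

text \<open>
  If \<open>A\<close> is invariant with \<open>0 < p < 1\<close> for \<open>p = measure \<mu> A\<close>, then the mean is a convex combination
  of its restrictions to \<open>A\<close> and to the complement. Extremality identifies it with the first one,
  so \<open>indicator A \<cdot> \<mu> = p \<mu>\<close>; evaluating at \<open>A\<close> gives \<open>p = p\<^sup>2\<close>.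
\<close>

lemma ergodic_if_extreme:
  assumes L: "extreme_mean L"
  obtains \<mu> where "ergodic_prob \<sigma> \<mu>" "\<And>g. continuous_on UNIV g \<Longrightarrow> integral\<^sup>L \<mu> g = L g"
proof -
  have inv: "invariant_mean \<sigma> L" using L by (simp add: extreme_mean_def)
  interpret mean_functional L
    using inv compact_space by unfold_locales (auto simp: invariant_mean_def)
  interpret prob_space riesz by (rule prob_space_riesz)
  have sp: "space riesz = UNIV" using sets_eq_imp_space_eq[OF sets_riesz] by simp
  have meas: "g \<in> borel_measurable riesz" if "g \<in> borel_measurable borel" for g :: "'w \<Rightarrow> real"
    using that measurable_cong_sets[OF sets_riesz refl] by blast
  have ip: "invariant_prob \<sigma> riesz"
    unfolding invariant_prob_def
  proof (intro conjI allI prob_space_riesz sets_riesz)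
    fix t
    have mt: "\<sigma> t \<in> measurable riesz borel" using flow_measurable[of t] measurable_cong_sets[OF sets_riesz refl] by blast
    show "distr riesz borel (\<sigma> t) = riesz"
    proof (rule borel_measure_eqI_continuous)
      show "finite_measure (distr riesz borel (\<sigma> t))"
        using prob_space_distr[OF mt] by (rule prob_space.finite_measure)
      show "finite_measure riesz" by (rule finite_measure_axioms)
      fix g :: "'w \<Rightarrow> real" assume g: "continuous_on UNIV g"
      have c: "continuous_on UNIV (\<lambda>x. g (\<sigma> t x))" by (rule continuous_shift[OF g])
      have "integral\<^sup>L (distr riesz borel (\<sigma> t)) g = integral\<^sup>L riesz (\<lambda>x. g (\<sigma> t x))"
        by (rule integral_distr[OF mt borel_measurable_continuous_onI[OF g]])
      also have "\<dots> = L (\<lambda>x. g (\<sigma> t x))" by (rule integral_riesz[OF c])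
      also have "\<dots> = integral\<^sup>L riesz g" using inv g by (simp add: invariant_mean_def integral_riesz)
      finally show "integral\<^sup>L (distr riesz borel (\<sigma> t)) g = integral\<^sup>L riesz g" .
    qed (auto simp: sets_riesz)
  qed
  have "measure riesz A = 0 \<or> measure riesz A = 1"
    if A: "A \<in> sets borel" "\<And>t. \<sigma> t -` A = A" for A
  proof (rule ccontr)
    assume "\<not> ?thesis"
    then have p: "0 < measure riesz A" "measure riesz A < 1"
      using prob_le_1[of A] measure_nonneg[of riesz A] by linarith+
    define p where "p = measure riesz A"
    have Ar: "A \<in> sets riesz" using A by (simp add: sets_riesz)
    have pc: "measure riesz (- A) = 1 - p"
      using prob_compl[OF Ar] by (simp add: sp p_def Compl_eq_Diff_UNIV)
    define L1 where "L1 = restricted_mean riesz A"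
    define L2 where "L2 = restricted_mean riesz (- A)"
    have i1: "invariant_mean \<sigma> L1"
      unfolding L1_def by (rule invariant_restricted_mean[OF ip A p(1)])
    have i2: "invariant_mean \<sigma> L2"
      unfolding L2_def using A pc p(2)
      by (intro invariant_restricted_mean[OF ip]) (auto simp: p_def)
    have "L g = p * L1 g + (1 - p) * L2 g" for g
    proof (cases "continuous_on UNIV g")
      case True
      have ii: "integrable riesz (\<lambda>x. indicator B x * g x)" if "B \<in> sets riesz" for B
        using integrable_real_mult_indicator[OF that integrable_riesz[OF True]] by (simp add: mult.commute)
      have "L g = integral\<^sup>L riesz (\<lambda>x. indicator A x * g x + indicator (- A) x * g x)"
        by (subst integral_riesz[OF True, symmetric], rule Bochner_Integration.integral_cong) (simp_all add: indicator_def)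
      also have "\<dots> = (LINT x|riesz. indicator A x * g x) + (LINT x|riesz. indicator (- A) x * g x)"
        using Ar sets.compl_sets[OF Ar] by (intro Bochner_Integration.integral_add ii) (simp_all add: sp Compl_eq_Diff_UNIV)
      also have "\<dots> = p * L1 g + (1 - p) * L2 g"
        using True pc p by (simp add: L1_def L2_def restricted_mean_def p_def)
      finally show ?thesis .
    next
      case False
      then show ?thesis using inv by (simp add: L1_def L2_def restricted_mean_def invariant_mean_def positive_mean_def)
    qed
    then have Leq: "L = (\<lambda>g. p * L1 g + (1 - p) * L2 g)" by (rule ext)
    have "0 < p" "p < 1" using p by (simp_all add: p_def)
    then have "L1 = L"
      by (rule L[unfolded extreme_mean_def, THEN conjunct2, rule_format, OF i1 i2 _ _ Leq])
    then have L1g: "restricted_mean riesz A g = L g" for g by (simp add: L1_def)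
    have eqL: "(LINT x|riesz. indicator A x * g x) = p * L g" if "continuous_on UNIV g" for g
      using L1g[of g] that p by (simp add: restricted_mean_def p_def field_simps)
    have mA [measurable]: "(indicator A :: 'w \<Rightarrow> real) \<in> borel_measurable riesz" using Ar by simp
    have dA: "emeasure (density riesz (\<lambda>x. ennreal (indicator A x))) B = emeasure riesz (A \<inter> B)"
      if B: "B \<in> sets riesz" for B
    proof -
      have "(\<lambda>x. ennreal (indicator A x) * indicator B x) = (indicator (A \<inter> B) :: 'w \<Rightarrow> ennreal)"
        by (auto simp: indicator_def)
      then show ?thesis using Ar B by (simp only: emeasure_density[OF measurable_compose[OF mA measurable_ennreal] B] nn_integral_indicator sets.Int)
    qed
    have UNIV_r: "UNIV \<in> sets riesz" by (simp add: sets_riesz)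
    have "density riesz (\<lambda>x. ennreal (indicator A x)) = density riesz (\<lambda>_. ennreal p)"
    proof (rule borel_measure_eqI_continuous)
      show "finite_measure (density riesz (\<lambda>x. ennreal (indicator A x)))"
        using dA[OF UNIV_r] emeasure_finite[of A] by (intro finite_measureI) (simp add: sp)
      show "finite_measure (density riesz (\<lambda>_. ennreal p))"
        by (intro finite_measureI) (simp add: emeasure_density ennreal_mult_eq_top_iff emeasure_finite)
      fix g :: "'w \<Rightarrow> real" assume g: "continuous_on UNIV g"
      have mg: "g \<in> borel_measurable riesz" by (rule meas[OF borel_measurable_continuous_onI[OF g]])
      have "integral\<^sup>L (density riesz (\<lambda>x. ennreal (indicator A x))) g = (LINT x|riesz. indicator A x * g x)"
        using integral_density[OF mg mA] by simp
      also have "\<dots> = p * L g" by (rule eqL[OF g])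
      also have "\<dots> = integral\<^sup>L (density riesz (\<lambda>_. ennreal p)) g"
        using integral_density[OF mg, of "\<lambda>_. p"] p by (simp add: p_def integral_riesz[OF g])
      finally show "integral\<^sup>L (density riesz (\<lambda>x. ennreal (indicator A x))) g = integral\<^sup>L (density riesz (\<lambda>_. ennreal p)) g" .
    qed (auto simp: sets_riesz)
    then have "emeasure (density riesz (\<lambda>x. ennreal (indicator A x))) A = emeasure (density riesz (\<lambda>_. ennreal p)) A"
      by simp
    moreover have "emeasure (density riesz (\<lambda>x. ennreal (indicator A x))) A = ennreal p"
      using dA[OF Ar] by (simp add: emeasure_eq_measure p_def)
    moreover have "emeasure (density riesz (\<lambda>_. ennreal p)) A = ennreal (p * p)"
      using Ar p by (simp add: emeasure_density_const emeasure_eq_measure p_def ennreal_mult)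
    ultimately have "p = p * p" using p by (simp add: p_def)
    then show False using p by (simp add: p_def)
  qed
  then have "ergodic_prob \<sigma> riesz" using ip by (auto simp: ergodic_prob_def)
  then show ?thesis using that[of riesz] integral_riesz by blast
qed

theorem exists_ergodic_nonneg_integral:
  assumes a: "continuous_on UNIV (a :: 'w \<Rightarrow> real)"
    and orbits: "\<And>n::nat. \<exists>\<omega>. - 1 \<le> integral {0..real n} (\<lambda>s. a (\<sigma> s \<omega>))"
  obtains \<mu> where "ergodic_prob \<sigma> \<mu>" "0 \<le> integral\<^sup>L \<mu> a"
proof -
  obtain L0 where "invariant_mean \<sigma> L0" "0 \<le> L0 a" by (rule exists_invariant_mean_nonneg[OF a orbits])
  then obtain L where L: "extreme_mean L" "0 \<le> L a" by (rule exists_extreme_mean)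
  obtain \<mu> where "ergodic_prob \<sigma> \<mu>" "\<And>g. continuous_on UNIV g \<Longrightarrow> integral\<^sup>L \<mu> g = L g"
    by (rule ergodic_if_extreme[OF L(1)]) blast
  then show ?thesis using that L(2) a by metis
qed

end

section \<open>Differential inequalities and global solutions\<close>

text \<open>
  The estimate is made for \<open>w\<^sup>2\<close>, which is differentiable where \<open>\<bar>w\<bar>\<close> is not; the summand \<open>1\<close> in the
  exponent absorbs the mixed term \<open>2 e \<bar>w\<bar> \<le> e\<^sup>2 + w\<^sup>2\<close>.
\<close>

lemma gronwall_forward:
  fixes w :: "real \<Rightarrow> real"
  assumes "0 \<le> t" and K: "0 \<le> K"
    and d: "\<And>s. 0 \<le> s \<Longrightarrow> s \<le> t \<Longrightarrow> (w has_real_derivative w' s) (at s)"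
    and b: "\<And>s. 0 \<le> s \<Longrightarrow> s \<le> t \<Longrightarrow> \<bar>w' s\<bar> \<le> K * \<bar>w s\<bar> + e"
  shows "(w t)\<^sup>2 \<le> exp ((2 * K + 1) * t) * ((w 0)\<^sup>2 + e\<^sup>2 * t)"
proof -
  define c where "c = 2 * K + 1"
  define z where "z s = (w s)\<^sup>2 * exp (- c * s) - e\<^sup>2 * s" for s
  have "z t \<le> z 0"
  proof (rule DERIV_nonpos_imp_nonincreasing[OF \<open>0 \<le> t\<close>])
    fix s assume s: "0 \<le> s" "s \<le> t"
    have "(z has_real_derivative (2 * w s * w' s - c * (w s)\<^sup>2) * exp (- c * s) - e\<^sup>2) (at s)"
      unfolding z_def by (auto intro!: derivative_eq_intros d s simp: algebra_simps power2_eq_square)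
    moreover have "(2 * w s * w' s - c * (w s)\<^sup>2) * exp (- c * s) - e\<^sup>2 \<le> 0"
    proof -
      have "w s * w' s \<le> \<bar>w s\<bar> * \<bar>w' s\<bar>" by (simp add: abs_mult[symmetric])
      also have "\<dots> \<le> \<bar>w s\<bar> * (K * \<bar>w s\<bar> + e)" by (intro mult_left_mono b s) simp
      also have "\<dots> = K * (w s)\<^sup>2 + e * \<bar>w s\<bar>" by (simp add: algebra_simps power2_eq_square)
      finally have "2 * (w s * w' s) \<le> 2 * K * (w s)\<^sup>2 + 2 * (e * \<bar>w s\<bar>)" by simp
      moreover have "2 * (e * \<bar>w s\<bar>) \<le> e\<^sup>2 + (w s)\<^sup>2"
        using sum_squares_bound[of e "\<bar>w s\<bar>"] by simp
      ultimately have 1: "2 * w s * w' s - c * (w s)\<^sup>2 \<le> e\<^sup>2" by (simp add: c_def algebra_simps)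
      have "0 \<le> c * s" using s K by (simp add: c_def)
      then have "exp (- c * s) \<le> 1" by simp
      then have "e\<^sup>2 * exp (- c * s) \<le> e\<^sup>2" by (simp add: mult_left_le)
      moreover have "(2 * w s * w' s - c * (w s)\<^sup>2) * exp (- c * s) \<le> e\<^sup>2 * exp (- c * s)"
        using 1 by (intro mult_right_mono) auto
      ultimately show ?thesis by linarith
    qed
    ultimately show "\<exists>y. (z has_real_derivative y) (at s) \<and> y \<le> 0" by blast
  qed
  then have "(w t)\<^sup>2 * exp (- c * t) \<le> (w 0)\<^sup>2 + e\<^sup>2 * t" by (simp add: z_def)
  then have "exp (c * t) * ((w t)\<^sup>2 * exp (- c * t)) \<le> exp (c * t) * ((w 0)\<^sup>2 + e\<^sup>2 * t)" by (rule mult_left_mono) simp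
  moreover have "exp (c * t) * ((w t)\<^sup>2 * exp (- c * t)) = (w t)\<^sup>2"
    using exp_minus_inverse[of "c * t"] by (simp add: mult.left_commute)
  ultimately have "(w t)\<^sup>2 \<le> exp (c * t) * ((w 0)\<^sup>2 + e\<^sup>2 * t)" by linarith
  then show ?thesis unfolding c_def .
qed

lemma DERIV_reflect:
  assumes "(w has_real_derivative D) (at (- s))"
  shows "((\<lambda>s. w (- s)) has_real_derivative - D) (at s)"
  using DERIV_chain2[of w D uminus s "- 1"] assms DERIV_minus[OF DERIV_ident] by auto

lemma gronwall:
  fixes w :: "real \<Rightarrow> real"
  assumes K: "0 \<le> K"
    and d: "\<And>s. s \<in> closed_segment 0 t \<Longrightarrow> (w has_real_derivative w' s) (at s)"
    and b: "\<And>s. s \<in> closed_segment 0 t \<Longrightarrow> \<bar>w' s\<bar> \<le> K * \<bar>w s\<bar> + e"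
  shows "(w t)\<^sup>2 \<le> exp ((2 * K + 1) * \<bar>t\<bar>) * ((w 0)\<^sup>2 + e\<^sup>2 * \<bar>t\<bar>)"
proof (cases "0 \<le> t")
  case True
  then show ?thesis
    using gronwall_forward[OF True K, of w w' e] d b by (simp add: closed_segment_eq_real_ivl)
next
  case False
  have "(w (- (- t)))\<^sup>2 \<le> exp ((2 * K + 1) * (- t)) * ((w (- 0))\<^sup>2 + e\<^sup>2 * (- t))"
  proof (rule gronwall_forward[where w="\<lambda>s. w (- s)" and w'="\<lambda>s. - w' (- s)"])
    fix s assume s: "0 \<le> s" "s \<le> - t"
    then have "- s \<in> closed_segment 0 t" using False by (simp add: closed_segment_eq_real_ivl)
    then show "((\<lambda>s. w (- s)) has_real_derivative - w' (- s)) (at s)" "\<bar>- w' (- s)\<bar> \<le> K * \<bar>w (- s)\<bar> + e"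
      using DERIV_reflect[OF d] b by auto
  qed (use False K in auto)
  then show ?thesis using False by simp
qed

text \<open>
  At the last time at which \<open>z\<close> is nonnegative it vanishes, and then it would have to increase.
\<close>

lemma barrier:
  fixes z :: "real \<Rightarrow> real"
  assumes "a \<le> b" and d: "\<And>s. a \<le> s \<Longrightarrow> s \<le> b \<Longrightarrow> (z has_real_derivative z' s) (at s)"
    and "0 \<le> z a" and pos: "\<And>s. a \<le> s \<Longrightarrow> s \<le> b \<Longrightarrow> z s = 0 \<Longrightarrow> 0 < z' s"
  shows "0 \<le> z b"
proof (rule ccontr)
  assume "\<not> 0 \<le> z b"
  then have neg: "z b < 0" by simp
  have cont: "continuous_on {a..b} z"
    using d by (auto intro!: continuous_at_imp_continuous_on DERIV_isCont)
  define S where "S = {s \<in> {a..b}. 0 \<le> z s}"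
  have "closed ({a..b} \<inter> z -` {0..})"
    by (rule continuous_closed_preimage[OF cont]) auto
  moreover have "S = {a..b} \<inter> z -` {0..}" by (auto simp: S_def)
  ultimately have "closed S" by simp
  have ne: "S \<noteq> {}" "bdd_above S" using assms(1,3) by (auto simp: S_def intro!: bdd_aboveI[of _ b])
  define c where "c = Sup S"
  have "c \<in> S" unfolding c_def by (rule closed_contains_Sup) fact+
  then have c: "a \<le> c" "c < b" "0 \<le> z c" using neg by (auto simp: S_def) (metis less_eq_real_def not_less)
  have after: "z s < 0" if "c < s" "s \<le> b" for s
    using cSup_upper[OF _ ne(2), of s] that c(1) by (fastforce simp: S_def c_def)
  have "z c = 0"
  proof (rule ccontr)
    assume "z c \<noteq> 0"
    then have "0 < z c" using c by simp
    obtain s where "c \<le> s" "s \<le> b" "z s = 0"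
      using IVT2'[of z b 0 c] neg c continuous_on_subset[OF cont, of "{c..b}"] by auto
    then show False using after[of s] \<open>0 < z c\<close> by (cases "c = s") auto
  qed
  then have "0 < z' c" using pos c by simp
  then obtain h where h: "0 < h" "\<And>k. 0 < k \<Longrightarrow> k < h \<Longrightarrow> z c < z (c + k)"
    using DERIV_pos_inc_right[OF d[of c]] c by auto
  define k where "k = min (h / 2) (b - c)"
  have "0 < k" "k < h" "c + k \<le> b" using h c by (auto simp: k_def min_def)
  then show False using h(2)[of k] after[of "c + k"] \<open>z c = 0\<close> by simp
qed

text \<open>
  The factor \<open>1 / 2\<close> gained by integrating against \<open>exp (2 K \<bar>s\<bar>)\<close> is the contraction constant in
  the fixed point argument below.
\<close>

lemma exp_growth_antiderivative:
  fixes H :: "real \<Rightarrow> real"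
  assumes "0 < K" "0 \<le> D" "H 0 = 0"
    and d: "\<And>s. (H has_real_derivative h s) (at s)"
    and b: "\<And>s. \<bar>h s\<bar> \<le> K * D * exp (2 * K * \<bar>s\<bar>)"
  shows "\<bar>H t\<bar> \<le> D / 2 * exp (2 * K * \<bar>t\<bar>)"
proof -
  have fwd: "G t \<le> D / 2 * exp (2 * K * t)"
    if "0 \<le> t" "G 0 = 0" "\<And>s. (G has_real_derivative g s) (at s)"
      "\<And>s. 0 \<le> s \<Longrightarrow> g s \<le> K * D * exp (2 * K * s)" for G g :: "real \<Rightarrow> real" and t
  proof -
    have "D / 2 * exp (2 * K * 0) - G 0 \<le> D / 2 * exp (2 * K * t) - G t"
    proof (rule DERIV_nonneg_imp_nondecreasing[OF that(1)])
      fix s assume s: "0 \<le> s" "s \<le> t"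
      have "((\<lambda>s. D / 2 * exp (2 * K * s) - G s) has_real_derivative K * D * exp (2 * K * s) - g s) (at s)"
        by (auto intro!: derivative_eq_intros that(3))
      then show "\<exists>y. ((\<lambda>s. D / 2 * exp (2 * K * s) - G s) has_real_derivative y) (at s) \<and> 0 \<le> y"
        using that(4)[OF s(1)] by (intro exI conjI) auto
    qed
    then show ?thesis using that(2) assms(2) by simp
  qed
  have b': "h s \<le> K * D * exp (2 * K * \<bar>s\<bar>)" "- h s \<le> K * D * exp (2 * K * \<bar>s\<bar>)" for s
    using b[of s] by linarith+
  have dm: "((\<lambda>s. - H s) has_real_derivative - h s) (at s)" for s by (rule DERIV_minus[OF d])
  have dr: "((\<lambda>s. H (- s)) has_real_derivative - h (- s)) (at s)" for s by (rule DERIV_reflect[OF d])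
  have drm: "((\<lambda>s. - H (- s)) has_real_derivative h (- s)) (at s)" for s using DERIV_minus[OF dr[of s]] by simp
  show ?thesis
  proof (cases "0 \<le> t")
    case True
    have "H t \<le> D / 2 * exp (2 * K * t)"
    proof (rule fwd[OF True assms(3) d])
      show "h s \<le> K * D * exp (2 * K * s)" if "0 \<le> s" for s using b'(1)[of s] that by simp
    qed
    moreover have "- H t \<le> D / 2 * exp (2 * K * t)"
    proof (rule fwd[OF True _ dm])
      show "- h s \<le> K * D * exp (2 * K * s)" if "0 \<le> s" for s using b'(2)[of s] that by simp
    qed (simp add: assms)
    ultimately show ?thesis using True by (simp add: abs_le_iff)
  next
    case False
    then have t: "0 \<le> - t" by simp
    have "H (- (- t)) \<le> D / 2 * exp (2 * K * (- t))"
    proof (rule fwd[OF t _ dr])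
      show "- h (- s) \<le> K * D * exp (2 * K * s)" if "0 \<le> s" for s using b'(2)[of "- s"] that by simp
    qed (simp add: assms)
    moreover have "- H (- (- t)) \<le> D / 2 * exp (2 * K * (- t))"
    proof (rule fwd[OF t _ drm])
      show "h (- s) \<le> K * D * exp (2 * K * s)" if "0 \<le> s" for s using b'(1)[of "- s"] that by simp
    qed (simp add: assms)
    ultimately show ?thesis using False by (simp add: abs_le_iff)
  qed
qed

text \<open>
  Picard's theorem on the whole line in one step: after multiplication by \<open>exp (- 2 K \<bar>t\<bar>)\<close> the
  integral operator acts on bounded continuous functions and is a contraction.
\<close>

lemma global_solution:
  fixes g :: "real \<Rightarrow> real \<Rightarrow> real"
  assumes g: "continuous_on UNIV (\<lambda>(t, x). g t x)" and bnd: "\<And>t x. \<bar>g t x\<bar> \<le> G"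
    and lip: "\<And>t x y. \<bar>g t x - g t y\<bar> \<le> K * \<bar>x - y\<bar>" and K: "0 < K"
  obtains v where "v 0 = x0" "\<And>t. (v has_real_derivative g t (v t)) (at t)"
proof -
  define E where "E t = exp (2 * K * \<bar>t\<bar>)" for t :: real
  have E: "0 < E t" "continuous_on UNIV E" for t unfolding E_def by (auto intro!: continuous_intros)
  have gc: "continuous_on UNIV (\<lambda>s. g s (v s))" if "continuous_on UNIV v" for v
    using continuous_on_compose2[OF g continuous_on_Pair[OF continuous_on_id that]] by simp
  define I where "I v = (SOME H. H 0 = 0 \<and> (\<forall>t. (H has_real_derivative g t (v t)) (at t)))" for v
  have I: "I v 0 = 0 \<and> (\<forall>t. (I v has_real_derivative g t (v t)) (at t))" if "continuous_on UNIV v" for v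
  proof -
    obtain H where "H 0 = 0" "\<And>t. (H has_real_derivative g t (v t)) (at t)"
      using continuous_antiderivative[OF gc[OF \<open>continuous_on UNIV v\<close>]] by metis
    then have "\<exists>H. H 0 = 0 \<and> (\<forall>t. (H has_real_derivative g t (v t)) (at t))" by blast
    then show ?thesis unfolding I_def by (rule someI_ex)
  qed
  define V where "V y t = E t * apply_bcontfun y t" for y :: "real \<Rightarrow>\<^sub>C real" and t
  have Vc: "continuous_on UNIV (V y)" for y unfolding V_def by (intro continuous_intros E) auto
  define P where "P y t = (x0 + I (V y) t) / E t" for y t
  have Pb: "P y \<in> bcontfun" for y
  proof -
    have "continuous_on UNIV (I (V y))"
      using I[OF Vc[of y]] by (auto intro!: continuous_at_imp_continuous_on DERIV_isCont)
    then have "continuous_on UNIV (P y)"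
      unfolding P_def using E by (intro continuous_intros) (auto simp: less_imp_neq[symmetric])
    moreover have "\<bar>P y t\<bar> \<le> \<bar>x0\<bar> + G / (2 * K)" for t
    proof -
      have G0: "0 \<le> G" using bnd[of 0 0] by linarith
      have "\<bar>I (V y) t\<bar> \<le> G * \<bar>t\<bar>"
        using derivative_bound_imp_lipschitz[of "I (V y)" "\<lambda>s. g s (V y s)" G t 0] I[OF Vc[of y]] bnd by simp
      also have "\<dots> \<le> G / (2 * K) * E t"
      proof -
        have "2 * K * \<bar>t\<bar> \<le> E t" unfolding E_def using exp_ge_add_one_self[of "2 * K * \<bar>t\<bar>"] by linarith
        then have "G / (2 * K) * (2 * K * \<bar>t\<bar>) \<le> G / (2 * K) * E t" using K G0 by (intro mult_left_mono) auto
        then show ?thesis using K by simp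
      qed
      finally have 1: "\<bar>I (V y) t\<bar> \<le> G / (2 * K) * E t" .
      have "1 \<le> E t" unfolding E_def using K by simp
      then have "\<bar>x0\<bar> \<le> \<bar>x0\<bar> * E t" by (simp add: mult_le_cancel_left1)
      then have "\<bar>x0 + I (V y) t\<bar> \<le> (\<bar>x0\<bar> + G / (2 * K)) * E t"
        using 1 abs_triangle_ineq[of x0 "I (V y) t"] by (simp add: distrib_right)
      then show ?thesis using E(1)[of t] by (simp add: P_def abs_divide divide_le_eq)
    qed
    ultimately show ?thesis
      by (intro bcontfun_normI[of _ "\<bar>x0\<bar> + G / (2 * K)"]) auto
  qed
  define Q where "Q y = Bcontfun (P y)" for y
  have Q: "apply_bcontfun (Q y) = P y" for y unfolding Q_def by (rule Bcontfun_inverse[OF Pb])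
  have "dist (Q y1) (Q y2) \<le> 1 / 2 * dist y1 y2" for y1 y2
  proof (rule dist_bound)
    fix t
    define D where "D = dist y1 y2"
    have "\<bar>I (V y1) t - I (V y2) t\<bar> \<le> D / 2 * exp (2 * K * \<bar>t\<bar>)"
    proof (rule exp_growth_antiderivative[OF K, where H="\<lambda>t. I (V y1) t - I (V y2) t" and h="\<lambda>s. g s (V y1 s) - g s (V y2 s)"])
      show "((\<lambda>t. I (V y1) t - I (V y2) t) has_real_derivative g s (V y1 s) - g s (V y2 s)) (at s)" for s
        using I[OF Vc[of y1]] I[OF Vc[of y2]] by (intro DERIV_diff) auto
      fix s
      have "\<bar>g s (V y1 s) - g s (V y2 s)\<bar> \<le> K * \<bar>V y1 s - V y2 s\<bar>" by (rule lip)
      also have "\<bar>V y1 s - V y2 s\<bar> = E s * dist (y1 s) (y2 s)"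
        using E(1)[of s] by (simp add: V_def right_diff_distrib[symmetric] abs_mult dist_real_def)
      also have "\<dots> \<le> E s * D" using E(1)[of s] unfolding D_def by (intro mult_left_mono dist_bounded) auto
      finally show "\<bar>g s (V y1 s) - g s (V y2 s)\<bar> \<le> K * D * exp (2 * K * \<bar>s\<bar>)"
        using K by (simp add: E_def mult_left_mono mult.commute mult.left_commute)
    qed (use I[OF Vc[of y1]] I[OF Vc[of y2]] in \<open>auto simp: D_def\<close>)
    then have "\<bar>I (V y1) t - I (V y2) t\<bar> / E t \<le> D / 2" using E(1)[of t] by (simp add: E_def divide_le_eq)
    then show "dist (Q y1 t) (Q y2 t) \<le> 1 / 2 * dist y1 y2"
      using E(1)[of t] by (simp add: Q P_def dist_real_def D_def diff_divide_distrib[symmetric] abs_divide)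
  qed
  then obtain y where y: "Q y = y" using banach_fix_type[of "1/2" Q] by auto
  define v where "v = V y"
  have v: "v t = x0 + I v t" for t
  proof -
    have "apply_bcontfun y t = P y t" using Q[of y] y by simp
    then show ?thesis using E(1)[of t] by (simp add: v_def V_def[of y t] P_def)
  qed
  have Iv: "I v 0 = 0" "(I v has_real_derivative g t (v t)) (at t)" for t using I[OF Vc[of y]] by (auto simp: v_def)
  have "v = (\<lambda>t. x0 + I v t)" using v by auto
  then have "(v has_real_derivative g t (v t)) (at t)" for t
    using DERIV_add[OF DERIV_const Iv(2), of x0 t] by simp
  moreover have "v 0 = x0" using v[of 0] Iv by simp
  ultimately show ?thesis using that by blast
qed

text \<open>
  Two-sided in time: \<open>q < p\<close> is permitted. Forward it bounds the growth of a perturbation by the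
  linearized equation, backward it recovers the linearized growth from that of perturbations.
\<close>

lemma linear_growth:
  fixes z V :: "real \<Rightarrow> real"
  assumes z: "\<And>s. s \<in> closed_segment p q \<Longrightarrow> (z has_real_derivative r s) (at s)"
    and V: "\<And>s. s \<in> closed_segment p q \<Longrightarrow> (V has_real_derivative a s) (at s)"
    and rate: "\<And>s. s \<in> closed_segment p q \<Longrightarrow> \<bar>z s * r s - a s * (z s)\<^sup>2\<bar> \<le> c * (z s)\<^sup>2"
  shows "\<bar>z q\<bar> \<le> exp (V q - V p + c * \<bar>q - p\<bar>) * \<bar>z p\<bar>"
proof -
  define h where "h = q - p"
  define m where "m x = p + x * h" for x
  define E where "E x = (z (m x))\<^sup>2 * exp (- 2 * (V (m x) - V p + c * \<bar>h\<bar> * x))" for x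
  have "E 1 \<le> E 0"
  proof (rule DERIV_nonpos_imp_nonincreasing[of 0 1 E])
    fix x :: real assume x: "0 \<le> x" "x \<le> 1"
    have "m x = (1 - x) *\<^sub>R p + x *\<^sub>R q" by (simp add: m_def h_def algebra_simps)
    then have seg: "m x \<in> closed_segment p q" using x unfolding closed_segment_def by blast
    have md: "(m has_real_derivative h) (at x)" unfolding m_def by (auto intro!: derivative_eq_intros)
    note zd = DERIV_chain2[OF z[OF seg] md] and Vd = DERIV_chain2[OF V[OF seg] md]
    define g where "g = h * (z (m x) * r (m x) - a (m x) * (z (m x))\<^sup>2) - c * \<bar>h\<bar> * (z (m x))\<^sup>2"
    have "(E has_real_derivative 2 * g * exp (- 2 * (V (m x) - V p + c * \<bar>h\<bar> * x))) (at x)"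
      unfolding E_def by (rule derivative_eq_intros zd Vd refl | simp add: g_def algebra_simps power2_eq_square)+
    moreover have "g \<le> 0"
    proof -
      have "h * (z (m x) * r (m x) - a (m x) * (z (m x))\<^sup>2) \<le> \<bar>h\<bar> * \<bar>z (m x) * r (m x) - a (m x) * (z (m x))\<^sup>2\<bar>"
        unfolding abs_mult[symmetric] by (rule abs_ge_self)
      also have "\<dots> \<le> \<bar>h\<bar> * (c * (z (m x))\<^sup>2)" by (intro mult_left_mono rate seg) simp
      finally show ?thesis by (simp add: g_def mult_ac)
    qed
    ultimately show "\<exists>y. (E has_real_derivative y) (at x) \<and> y \<le> 0"
      by (intro exI[of _ "2 * g * exp (- 2 * (V (m x) - V p + c * \<bar>h\<bar> * x))"] conjI) (auto simp: mult_le_0_iff)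
  qed simp
  moreover define X where "X = V q - V p + c * \<bar>h\<bar>"
  ultimately have "(z q)\<^sup>2 * exp (- 2 * X) \<le> (z p)\<^sup>2" by (simp add: E_def m_def h_def)
  then have "(z q)\<^sup>2 * exp (- 2 * X) * exp (2 * X) \<le> (z p)\<^sup>2 * exp (2 * X)"
    by (rule mult_right_mono) simp
  moreover have "(z q)\<^sup>2 * exp (- 2 * X) * exp (2 * X) = (z q)\<^sup>2"
    by (simp only: mult.assoc exp_add[symmetric]) simp
  moreover have "exp (2 * X) = (exp X)\<^sup>2" by (rule exp_double)
  ultimately have "(z q)\<^sup>2 \<le> (z p)\<^sup>2 * (exp X)\<^sup>2" by metis
  then have "(z q)\<^sup>2 \<le> (exp X * z p)\<^sup>2" by (simp only: power_mult_distrib mult.commute)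
  then have "\<bar>z q\<bar> \<le> \<bar>exp X * z p\<bar>" by (simp add: abs_le_square_iff)
  then show ?thesis by (simp add: X_def h_def abs_mult)
qed

section \<open>The skew-product flow of a coercive scalar equation\<close>

text \<open>
  Retraction onto \<open>[-R, R]\<close>; composing the vector field with it makes it bounded and globally
  Lipschitz without changing it on the strip of interest.
\<close>

definition clamp_abs :: "real \<Rightarrow> real \<Rightarrow> real" where
  "clamp_abs R x = max (- R) (min R x)"

lemma clamp_abs_bound: "0 \<le> R \<Longrightarrow> \<bar>clamp_abs R x\<bar> \<le> R"
  and clamp_abs_id: "\<bar>x\<bar> \<le> R \<Longrightarrow> clamp_abs R x = x"
  and clamp_abs_lipschitz: "\<bar>clamp_abs R x - clamp_abs R y\<bar> \<le> \<bar>x - y\<bar>"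
  by (auto simp: clamp_abs_def min_def max_def)

lemma continuous_clamp_abs: "continuous_on S p \<Longrightarrow> continuous_on S (\<lambda>x. clamp_abs R (p x))"
  unfolding clamp_abs_def by (intro continuous_intros)

locale skew_family = compact_flow \<sigma> for \<sigma> :: "real \<Rightarrow> 'w::metric_space \<Rightarrow> 'w" +
  fixes f :: "'w \<Rightarrow> real \<Rightarrow> real"
  assumes C02: "C02 f" and Co: "Co f"
begin

lemma f_deriv: "(f \<omega> has_real_derivative deriv (f \<omega>) x) (at x)"
  using C02 unfolding C02_def by (simp add: DERIV_deriv_iff_real_differentiable)

lemma f_continuous: "continuous_on S p \<Longrightarrow> continuous_on S q \<Longrightarrow> continuous_on S (\<lambda>x. f (p x) (q x))"
proof -
  assume *: "continuous_on S p" "continuous_on S q"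
  have c: "continuous_on UNIV (\<lambda>(\<omega>, x). f \<omega> x)" using C02 by (simp add: C02_def)
  show ?thesis using continuous_on_compose2[OF c continuous_on_Pair[OF *]] by simp
qed

lemma fx_continuous: "continuous_on S p \<Longrightarrow> continuous_on S q \<Longrightarrow> continuous_on S (\<lambda>x. deriv (f (p x)) (q x))"
proof -
  assume *: "continuous_on S p" "continuous_on S q"
  have c: "continuous_on UNIV (\<lambda>(\<omega>, x). deriv (f \<omega>) x)" using C02 by (simp add: C02_def)
  show ?thesis using continuous_on_compose2[OF c continuous_on_Pair[OF *]] by simp
qed

lemma compact_strip: "compact (UNIV \<times> {- R..R :: real} :: ('w \<times> real) set)"
  by (intro compact_Times compact_space compact_Icc)

lemma f_bounded:
  obtains G where "\<And>\<omega> x. \<bar>x\<bar> \<le> R \<Longrightarrow> \<bar>f \<omega> x\<bar> \<le> G"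
proof -
  have "compact ((\<lambda>p. f (fst p) (snd p)) ` (UNIV \<times> {- R..R}))"
    by (intro compact_continuous_image compact_strip f_continuous continuous_on_fst continuous_on_snd continuous_on_id)
  then obtain G where "\<forall>y\<in>(\<lambda>p. f (fst p) (snd p)) ` (UNIV \<times> {- R..R}). norm y \<le> G"
    using compact_imp_bounded bounded_iff by metis
  then show ?thesis using that[of G] by (force simp: abs_le_iff)
qed

lemma fx_bounded:
  obtains K where "0 < K" "\<And>\<omega> x. \<bar>x\<bar> \<le> R \<Longrightarrow> \<bar>deriv (f \<omega>) x\<bar> \<le> K"
proof -
  have "compact ((\<lambda>p. deriv (f (fst p)) (snd p)) ` (UNIV \<times> {- R..R}))"
    by (intro compact_continuous_image compact_strip fx_continuous continuous_on_fst continuous_on_snd continuous_on_id)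
  then obtain K where "0 < K" "\<forall>y\<in>(\<lambda>p. deriv (f (fst p)) (snd p)) ` (UNIV \<times> {- R..R}). norm y \<le> K"
    using compact_imp_bounded bounded_pos by metis
  then show ?thesis using that[of K] by (force simp: abs_le_iff)
qed

lemma f_lipschitz:
  obtains K where "0 < K" "\<And>\<omega> x y. \<bar>x\<bar> \<le> R \<Longrightarrow> \<bar>y\<bar> \<le> R \<Longrightarrow> \<bar>f \<omega> x - f \<omega> y\<bar> \<le> K * \<bar>x - y\<bar>"
proof -
  obtain K where K: "0 < K" "\<And>\<omega> x. \<bar>x\<bar> \<le> R \<Longrightarrow> \<bar>deriv (f \<omega>) x\<bar> \<le> K" 
    using fx_bounded[of R] by blast
  have "\<bar>f \<omega> x - f \<omega> y\<bar> \<le> K * \<bar>x - y\<bar>" if "\<bar>x\<bar> \<le> R" "\<bar>y\<bar> \<le> R" for \<omega> x y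
  proof -
    have "norm (f \<omega> x - f \<omega> y) \<le> K * norm (x - y)"
    proof (rule field_differentiable_bound[of "{- R..R}"])
      show "(f \<omega> has_field_derivative deriv (f \<omega>) z) (at z within {- R..R})" for z
        by (rule has_field_derivative_at_within[OF f_deriv])
      show "norm (deriv (f \<omega>) z) \<le> K" if "z \<in> {- R..R}" for z using K(2)[of z] that by (simp add: abs_le_iff)
    qed (use that in auto)
    then show ?thesis by simp
  qed
  then show ?thesis using that K(1) by blast
qed

text \<open>
  Coercivity yields bounds \<open>B\<close> such that the vector field points inwards at both ends of
  \<open>[-B, B]\<close>, uniformly over the base.
\<close>

definition traps :: "real \<Rightarrow> real \<Rightarrow> bool" where
  "traps l B \<longleftrightarrow> 0 < B \<and> (\<forall>\<omega>. f \<omega> B + l < 0 \<and> 0 < f \<omega> (- B) + l)"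

lemma exists_trap:
  obtains B where "traps l B" "B0 \<le> B"
proof -
  have "\<forall>\<^sub>F x in at_infinity. \<forall>\<omega>. f \<omega> x / x < - (\<bar>l\<bar> + 1)" using Co by (simp add: Co_def)
  then obtain b where b: "\<And>x \<omega>. b \<le> \<bar>x\<bar> \<Longrightarrow> f \<omega> x / x < - (\<bar>l\<bar> + 1)"
    by (auto simp: eventually_at_infinity)
  define B where "B = max (max b 1) B0"
  have B: "b \<le> B" "1 \<le> B" "B0 \<le> B" by (auto simp: B_def)
  have ge: "\<bar>l\<bar> + 1 \<le> (\<bar>l\<bar> + 1) * B" using B(2) by (simp add: mult_le_cancel_left1)
  have "f \<omega> B + l < 0 \<and> 0 < f \<omega> (- B) + l" for \<omega>
  proof
    have "f \<omega> B / B < - (\<bar>l\<bar> + 1)" using b[of B \<omega>] B by simp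
    then have "f \<omega> B < - (\<bar>l\<bar> + 1) * B" using B by (simp add: divide_less_eq)
    moreover have "- (\<bar>l\<bar> + 1) * B = - ((\<bar>l\<bar> + 1) * B)" by (rule mult_minus_left)
    ultimately show "f \<omega> B + l < 0" using ge by linarith
    have "f \<omega> (- B) / (- B) < - (\<bar>l\<bar> + 1)" using b[of "- B" \<omega>] B by simp
    then have "f \<omega> (- B) > (\<bar>l\<bar> + 1) * B" using B by (simp add: field_simps)
    then show "0 < f \<omega> (- B) + l" using ge by linarith
  qed
  then show ?thesis using that[of B] B by (simp add: traps_def)
qed

definition trajectory :: "real \<Rightarrow> 'w \<Rightarrow> real set \<Rightarrow> (real \<Rightarrow> real) \<Rightarrow> bool" where
  "trajectory l \<omega> T v \<longleftrightarrow> (\<forall>t\<in>T. (v has_real_derivative f (\<sigma> t \<omega>) (v t) + l) (at t))"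

lemma trajectoryD: "trajectory l \<omega> T v \<Longrightarrow> t \<in> T \<Longrightarrow> (v has_real_derivative f (\<sigma> t \<omega>) (v t) + l) (at t)"
  by (simp add: trajectory_def)

lemma trajectory_subset: "trajectory l \<omega> T v \<Longrightarrow> S \<subseteq> T \<Longrightarrow> trajectory l \<omega> S v"
  by (auto simp: trajectory_def)

lemma trajectory_continuous: "trajectory l \<omega> T v \<Longrightarrow> continuous_on T v"
  unfolding trajectory_def by (auto intro!: continuous_at_imp_continuous_on DERIV_isCont)

lemma trajectory_shift:
  assumes "trajectory l \<omega> T v"
  shows "trajectory l (\<sigma> s \<omega>) ((\<lambda>t. t - s) ` T) (\<lambda>t. v (t + s))"
  unfolding trajectory_def
proof safe
  fix t assume t: "t \<in> T"
  have "(v has_real_derivative f (\<sigma> (t - s + s) \<omega>) (v (t - s + s)) + l) (at (t - s + s))"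
    using trajectoryD[OF assms t] by simp
  then show "((\<lambda>t. v (t + s)) has_real_derivative f (\<sigma> (t - s) (\<sigma> s \<omega>)) (v (t - s + s)) + l) (at (t - s))"
    unfolding DERIV_shift flow_add .
qed

lemma trajectory_unique:
  assumes v: "trajectory l \<omega> T v" and w: "trajectory l \<omega> T w" and "v 0 = w 0"
    and T: "closed_segment 0 t \<subseteq> T"
  shows "v t = w t"
proof -
  have vw: "trajectory l \<omega> (closed_segment 0 t) v" "trajectory l \<omega> (closed_segment 0 t) w"
    using v w T by (simp_all add: trajectory_subset)
  have "compact (v ` closed_segment 0 t)" "compact (w ` closed_segment 0 t)"
    using vw by (auto intro!: compact_continuous_image trajectory_continuous)
  then have "bounded (v ` closed_segment 0 t \<union> w ` closed_segment 0 t)"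
    by (auto intro: compact_imp_bounded)
  then obtain R where R: "\<And>s. s \<in> closed_segment 0 t \<Longrightarrow> \<bar>v s\<bar> \<le> R \<and> \<bar>w s\<bar> \<le> R"
    unfolding bounded_iff by (metis UnI1 UnI2 imageI real_norm_def)
  obtain K where K: "0 < K" "\<And>\<omega> x y. \<bar>x\<bar> \<le> R \<Longrightarrow> \<bar>y\<bar> \<le> R \<Longrightarrow> \<bar>f \<omega> x - f \<omega> y\<bar> \<le> K * \<bar>x - y\<bar>"
    using f_lipschitz[of R] by blast
  have "(v t - w t)\<^sup>2 \<le> exp ((2 * K + 1) * \<bar>t\<bar>) * ((v 0 - w 0)\<^sup>2 + 0\<^sup>2 * \<bar>t\<bar>)"
  proof (rule gronwall[where w="\<lambda>s. v s - w s" and w'="\<lambda>s. (f (\<sigma> s \<omega>) (v s) + l) - (f (\<sigma> s \<omega>) (w s) + l)"])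
    fix s assume s: "s \<in> closed_segment 0 t"
    show "((\<lambda>s. v s - w s) has_real_derivative (f (\<sigma> s \<omega>) (v s) + l) - (f (\<sigma> s \<omega>) (w s) + l)) (at s)"
      by (intro DERIV_diff trajectoryD[OF vw(1) s] trajectoryD[OF vw(2) s])
    show "\<bar>(f (\<sigma> s \<omega>) (v s) + l) - (f (\<sigma> s \<omega>) (w s) + l)\<bar> \<le> K * \<bar>v s - w s\<bar> + 0"
      using K(2) R[OF s] by simp
  qed (use K in simp)
  then show ?thesis using assms(3) by simp
qed

lemma solves_on_iff:
  "solves_on \<sigma> (shifted f l) \<omega> x0 J v \<longleftrightarrow>
     open J \<and> is_interval J \<and> 0 \<in> J \<and> v 0 = x0 \<and> trajectory l \<omega> J v"
  by (simp add: solves_on_def trajectory_def shifted_def)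

text \<open>
  Uniqueness makes the description in the definition of \<open>sol\<close> single-valued.
\<close>

lemma sol_eq:
  assumes v: "solves_on \<sigma> (shifted f l) \<omega> x0 J v" and t: "t \<in> J"
  shows "t \<in> sol_dom \<sigma> (shifted f l) \<omega> x0" "sol \<sigma> (shifted f l) t \<omega> x0 = v t"
proof -
  show "t \<in> sol_dom \<sigma> (shifted f l) \<omega> x0" using assms by (auto simp: sol_dom_def)
  show "sol \<sigma> (shifted f l) t \<omega> x0 = v t"
    unfolding sol_def
  proof (rule the_equality)
    show "\<exists>J va. solves_on \<sigma> (shifted f l) \<omega> x0 J va \<and> t \<in> J \<and> va t = v t" using assms by blast
    fix y assume "\<exists>J va. solves_on \<sigma> (shifted f l) \<omega> x0 J va \<and> t \<in> J \<and> va t = y"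
    then obtain I u where u: "solves_on \<sigma> (shifted f l) \<omega> x0 I u" "t \<in> I" "u t = y" by blast
    have "closed_segment 0 t \<subseteq> J"
      using v t by (intro closed_segment_subset) (simp_all add: solves_on_iff is_interval_convex_1)
    moreover have "closed_segment 0 t \<subseteq> I"
      using u by (intro closed_segment_subset) (simp_all add: solves_on_iff is_interval_convex_1)
    ultimately have "closed_segment 0 t \<subseteq> J \<inter> I" by simp
    moreover have "trajectory l \<omega> (J \<inter> I) u" "trajectory l \<omega> (J \<inter> I) v" "u 0 = v 0"
      using v u(1) by (simp_all add: solves_on_iff trajectory_def)
    ultimately have "u t = v t" by (intro trajectory_unique[of l \<omega> "J \<inter> I" u v t])
    then show "y = v t" using u by simp
  qed
qed

lemma complete_trajectory_sol:
  assumes "trajectory l \<omega> UNIV v"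
  shows "t \<in> sol_dom \<sigma> (shifted f l) \<omega> (v 0)" "sol \<sigma> (shifted f l) t \<omega> (v 0) = v t"
  using sol_eq[of l \<omega> "v 0" UNIV v t] assms by (auto simp: solves_on_iff)

lemma sol_derivative:
  assumes "t \<in> sol_dom \<sigma> (shifted f l) \<omega> x"
  shows "((\<lambda>t. sol \<sigma> (shifted f l) t \<omega> x) has_real_derivative f (\<sigma> t \<omega>) (sol \<sigma> (shifted f l) t \<omega> x) + l) (at t)"
proof -
  obtain J v where J: "solves_on \<sigma> (shifted f l) \<omega> x J v" "t \<in> J"
    using assms by (auto simp: sol_dom_def)
  have d: "(v has_real_derivative f (\<sigma> t \<omega>) (v t) + l) (at t)" using J by (auto simp: solves_on_iff trajectory_def)
  have eq: "sol \<sigma> (shifted f l) s \<omega> x = v s" if "s \<in> J" for s using sol_eq(2)[OF J(1) that] .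
  have "open J" using J(1) by (simp add: solves_on_iff)
  then have "((\<lambda>t. sol \<sigma> (shifted f l) t \<omega> x) has_real_derivative f (\<sigma> t \<omega>) (v t) + l) (at t)"
    using has_field_derivative_transform_within_open[OF d _ J(2)] eq by simp
  then show ?thesis using eq[OF J(2)] by simp
qed

lemma sol_0:
  assumes "0 \<in> sol_dom \<sigma> (shifted f l) \<omega> x"
  shows "sol \<sigma> (shifted f l) 0 \<omega> x = x"
proof -
  obtain J v where J: "solves_on \<sigma> (shifted f l) \<omega> x J v" "0 \<in> J"
    using assms by (auto simp: sol_dom_def)
  then show ?thesis using sol_eq(2)[OF J] by (simp add: solves_on_iff)
qed

lemma sol_trajectory:
  assumes "\<And>t. t \<in> sol_dom \<sigma> (shifted f l) \<omega> x"
  shows "trajectory l \<omega> UNIV (\<lambda>t. sol \<sigma> (shifted f l) t \<omega> x)" "sol \<sigma> (shifted f l) 0 \<omega> x = x"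
  using sol_derivative[OF assms] sol_0[OF assms] by (auto simp: trajectory_def)

lemma invariant_trajectory:
  assumes K: "skew_invariant \<sigma> (shifted f l) K" and x: "(\<omega>, x) \<in> K"
  obtains v where "v 0 = x" "trajectory l \<omega> UNIV v" "\<And>t. (\<sigma> t \<omega>, v t) \<in> K"
    "\<And>t. sol \<sigma> (shifted f l) t \<omega> x = v t"
proof -
  have *: "t \<in> sol_dom \<sigma> (shifted f l) \<omega> x" "(\<sigma> t \<omega>, sol \<sigma> (shifted f l) t \<omega> x) \<in> K" for t
    using K x by (auto simp: skew_invariant_def skew_def)
  show ?thesis
    by (rule that[of "\<lambda>t. sol \<sigma> (shifted f l) t \<omega> x"])
      (simp_all only: sol_trajectory[OF *(1)] *(2))
qed

lemma skew_invariantI: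
  assumes "\<And>\<omega> x. (\<omega>, x) \<in> K \<Longrightarrow> \<exists>v. v 0 = x \<and> trajectory l \<omega> UNIV v \<and> (\<forall>t. (\<sigma> t \<omega>, v t) \<in> K)"
  shows "skew_invariant \<sigma> (shifted f l) K"
  unfolding skew_invariant_def
proof safe
  fix \<omega> x t assume "(\<omega>, x) \<in> K"
  then obtain v where v: "v 0 = x" "trajectory l \<omega> UNIV v" "\<And>t. (\<sigma> t \<omega>, v t) \<in> K" using assms by blast
  show "t \<in> sol_dom \<sigma> (shifted f l) \<omega> x" "skew \<sigma> (shifted f l) t (\<omega>, x) \<in> K"
    using complete_trajectory_sol[OF v(2), of t] v by (auto simp: skew_def)
qed

lemma truncated_solution:
  assumes "0 \<le> R"
  obtains v where "v 0 = x0" "\<And>t. (v has_real_derivative f (\<sigma> t \<omega>) (clamp_abs R (v t)) + l) (at t)"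
proof -
  obtain G where G: "\<And>\<omega> x. \<bar>x\<bar> \<le> R \<Longrightarrow> \<bar>f \<omega> x\<bar> \<le> G" 
    using f_bounded[of R] by blast
  obtain K where K: "0 < K" "\<And>\<omega> x y. \<bar>x\<bar> \<le> R \<Longrightarrow> \<bar>y\<bar> \<le> R \<Longrightarrow> \<bar>f \<omega> x - f \<omega> y\<bar> \<le> K * \<bar>x - y\<bar>"
    using f_lipschitz[of R] by blast
  have "continuous_on UNIV (\<lambda>p. f (\<sigma> (fst p) \<omega>) (clamp_abs R (snd p)) + l)"
    by (intro continuous_on_add continuous_on_const f_continuous continuous_flow_comp continuous_clamp_abs
        continuous_on_fst continuous_on_snd continuous_on_id)
  then have c: "continuous_on UNIV (\<lambda>(t, x). f (\<sigma> t \<omega>) (clamp_abs R x) + l)" by (simp add: case_prod_unfold)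
  have b: "\<bar>f (\<sigma> t \<omega>) (clamp_abs R x) + l\<bar> \<le> G + \<bar>l\<bar>" for t x
    using G[OF clamp_abs_bound[OF assms], of "\<sigma> t \<omega>" x] by linarith
  have lip: "\<bar>(f (\<sigma> t \<omega>) (clamp_abs R x) + l) - (f (\<sigma> t \<omega>) (clamp_abs R y) + l)\<bar> \<le> K * \<bar>x - y\<bar>" for t x y
  proof -
    have "\<bar>f (\<sigma> t \<omega>) (clamp_abs R x) - f (\<sigma> t \<omega>) (clamp_abs R y)\<bar> \<le> K * \<bar>clamp_abs R x - clamp_abs R y\<bar>"
      by (intro K clamp_abs_bound assms)
    also have "\<dots> \<le> K * \<bar>x - y\<bar>" using K(1) by (intro mult_left_mono clamp_abs_lipschitz) simp
    finally show ?thesis by simp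
  qed
  obtain v where "v 0 = x0" "\<And>t. (v has_real_derivative f (\<sigma> t \<omega>) (clamp_abs R (v t)) + l) (at t)"
    using global_solution[OF c b lip K(1), of x0] by metis
  then show ?thesis by (rule that)
qed

text \<open>
  The strict bound leaves room at time \<open>0\<close> for the small negative times that an open interval
  of definition must contain.
\<close>

lemma truncated_solves_on:
  assumes v: "\<And>t. (v has_real_derivative f (\<sigma> t \<omega>) (clamp_abs R (v t)) + l) (at t)"
    and b: "\<And>t. 0 \<le> t \<Longrightarrow> \<bar>v t\<bar> < R"
  obtains \<eta> where "0 < \<eta>" "solves_on \<sigma> (shifted f l) \<omega> (v 0) {- \<eta><..} v"
proof -
  have "isCont v 0" using v by (blast intro: DERIV_isCont)
  moreover have "0 < R - \<bar>v 0\<bar>" using b[of 0] by simp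
  ultimately obtain \<eta> where \<eta>: "0 < \<eta>" "\<forall>t. dist t 0 < \<eta> \<longrightarrow> dist (v t) (v 0) < R - \<bar>v 0\<bar>"
    unfolding continuous_at_eps_delta by blast
  have "\<bar>v t\<bar> \<le> R" if "- \<eta> < t" for t
  proof (cases "0 \<le> t")
    case True then show ?thesis using b[of t] by simp
  next
    case False
    then have "\<bar>v t - v 0\<bar> < R - \<bar>v 0\<bar>" using \<eta>(2)[rule_format, of t] that by (simp add: dist_real_def)
    then show ?thesis by linarith
  qed
  then have "clamp_abs R (v t) = v t" if "- \<eta> < t" for t using that by (intro clamp_abs_id) simp
  then have "trajectory l \<omega> {- \<eta><..} v"
    unfolding trajectory_def using v by (metis greaterThan_iff)
  then show ?thesis using that[of \<eta>] \<eta>(1) by (simp add: solves_on_iff is_interval_convex_1)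
qed

lemma forward_solution:
  assumes B: "traps l B" and x0: "\<bar>x0\<bar> \<le> B"
  obtains v where "v 0 = x0" "trajectory l \<omega> {0..} v" "\<And>t. 0 \<le> t \<Longrightarrow> \<bar>v t\<bar> \<le> B"
proof -
  have B0: "0 < B" and neg: "\<And>\<omega>. f \<omega> B + l < 0" and pos: "\<And>\<omega>. 0 < f \<omega> (- B) + l"
    using B by (auto simp: traps_def)
  obtain v where v: "v 0 = x0" "\<And>t. (v has_real_derivative f (\<sigma> t \<omega>) (clamp_abs B (v t)) + l) (at t)"
    using truncated_solution[of B x0 \<omega> l] B0 by auto
  have up: "0 \<le> B - v t" if t: "0 \<le> t" for t
  proof (rule barrier[OF t, where z="\<lambda>t. B - v t" and z'="\<lambda>t. 0 - (f (\<sigma> t \<omega>) (clamp_abs B (v t)) + l)"])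
    show "((\<lambda>t. B - v t) has_real_derivative 0 - (f (\<sigma> s \<omega>) (clamp_abs B (v s)) + l)) (at s)" for s
      by (intro DERIV_diff DERIV_const v)
    show "0 \<le> B - v 0" using x0 v by simp
    show "0 < 0 - (f (\<sigma> s \<omega>) (clamp_abs B (v s)) + l)" if "B - v s = 0" for s
      using that neg[of "\<sigma> s \<omega>"] B0 by (simp add: clamp_abs_id)
  qed
  have low: "0 \<le> B + v t" if t: "0 \<le> t" for t
  proof (rule barrier[OF t, where z="\<lambda>t. B + v t" and z'="\<lambda>t. 0 + (f (\<sigma> t \<omega>) (clamp_abs B (v t)) + l)"])
    show "((\<lambda>t. B + v t) has_real_derivative 0 + (f (\<sigma> s \<omega>) (clamp_abs B (v s)) + l)) (at s)" for s
      by (intro DERIV_add DERIV_const v)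
    show "0 \<le> B + v 0" using x0 v by simp
    show "0 < 0 + (f (\<sigma> s \<omega>) (clamp_abs B (v s)) + l)" if "B + v s = 0" for s
    proof -
      have "v s = - B" using that by simp
      then show ?thesis using pos[of "\<sigma> s \<omega>"] B0 by (simp add: clamp_abs_id)
    qed
  qed
  have b: "\<bar>v t\<bar> \<le> B" if "0 \<le> t" for t using up[OF that] low[OF that] by linarith
  have "trajectory l \<omega> {0..} v"
    unfolding trajectory_def
  proof
    fix t :: real assume "t \<in> {0..}"
    then show "(v has_real_derivative f (\<sigma> t \<omega>) (v t) + l) (at t)"
      using v(2)[of t] b[of t] by (simp add: clamp_abs_id)
  qed
  then show ?thesis using that v(1) b by blast
qed

text \<open>
  Continuous dependence, in a form that also produces complete orbits: the limit candidate is the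
  global solution of the truncated equation through \<open>(\<omega>, y)\<close>, and Gronwall's inequality shows
  that the given trajectories converge to it. Hence it respects the bound \<open>B\<close>, and is never
  truncated.
\<close>

lemma trajectory_limit:
  assumes r: "filterlim r at_top sequentially" and w: "p \<longlonglongrightarrow> \<omega>"
    and v: "\<And>n. trajectory l (p n) {- r n..r n} (v n)" "\<And>n t. \<bar>t\<bar> \<le> r n \<Longrightarrow> \<bar>v n t\<bar> \<le> B"
    and y: "(\<lambda>n. v n 0) \<longlonglongrightarrow> y" and B: "0 \<le> B"
  shows "\<exists>u. u 0 = y \<and> trajectory l \<omega> UNIV u \<and> (\<forall>t. (\<lambda>n. v n t) \<longlonglongrightarrow> u t) \<and> (\<forall>t. \<bar>u t\<bar> \<le> B)"
proof -
  obtain u where u: "u 0 = y" "\<And>t. (u has_real_derivative f (\<sigma> t \<omega>) (clamp_abs B (u t)) + l) (at t)"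
    using truncated_solution[OF B, of y \<omega> l] by auto
  obtain K where K: "0 < K" "\<And>\<omega> x y. \<bar>x\<bar> \<le> B \<Longrightarrow> \<bar>y\<bar> \<le> B \<Longrightarrow> \<bar>f \<omega> x - f \<omega> y\<bar> \<le> K * \<bar>x - y\<bar>"
    using f_lipschitz[of B] by blast
  have close: "eventually (\<lambda>n. \<forall>s x. \<bar>s\<bar> \<le> T \<longrightarrow> \<bar>x\<bar> \<le> B \<longrightarrow> \<bar>f (\<sigma> s (p n)) x - f (\<sigma> s \<omega>) x\<bar> < e) sequentially"
    if e: "0 < e" for T e
  proof -
    let ?S = "{- T..T} \<times> (UNIV :: 'w set) \<times> {- B..B}"
    let ?F = "\<lambda>q. f (\<sigma> (fst q) (fst (snd q))) (snd (snd q))"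
    have "compact ?S" by (intro compact_Times compact_Icc compact_space)
    moreover have "continuous_on ?S ?F"
      by (intro f_continuous continuous_flow_comp continuous_on_fst continuous_on_snd continuous_on_id)
    ultimately have "uniformly_continuous_on ?S ?F" by (rule compact_uniformly_continuous[rotated])
    then obtain d where d: "0 < d" "\<forall>q\<in>?S. \<forall>q'\<in>?S. dist q' q < d \<longrightarrow> dist (?F q') (?F q) < e"
      using e unfolding uniformly_continuous_on_def by metis
    have "eventually (\<lambda>n. dist (p n) \<omega> < d) sequentially" using w d(1) by (rule tendstoD)
    then show ?thesis
    proof eventually_elim
      case (elim n)
      have "\<bar>f (\<sigma> s (p n)) x - f (\<sigma> s \<omega>) x\<bar> < e" if "\<bar>s\<bar> \<le> T" "\<bar>x\<bar> \<le> B" for s x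
        using d(2)[rule_format, of "(s, \<omega>, x)" "(s, p n, x)"] elim that
        by (simp add: dist_Pair_Pair dist_real_def abs_le_iff)
      then show ?case by blast
    qed
  qed
  have lim: "(\<lambda>n. v n t) \<longlonglongrightarrow> u t" for t
  proof -
    define C where "C = exp ((2 * K + 1) * \<bar>t\<bar>)"
    have C: "0 < C" by (simp add: C_def)
    have "(\<lambda>n. (v n t - u t)\<^sup>2) \<longlonglongrightarrow> 0"
    proof (rule tendstoI)
      fix \<epsilon> :: real assume \<epsilon>: "0 < \<epsilon>"
      define e where "e = sqrt (\<epsilon> / (2 * C * (\<bar>t\<bar> + 1)))"
      have e: "0 < e" and e2: "e\<^sup>2 = \<epsilon> / (2 * C * (\<bar>t\<bar> + 1))" using \<epsilon> C by (auto simp: e_def)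
      have "(\<lambda>n. C * (v n 0 - u 0)\<^sup>2) \<longlonglongrightarrow> C * (y - u 0)\<^sup>2" by (intro tendsto_intros y)
      then have "eventually (\<lambda>n. C * (v n 0 - u 0)\<^sup>2 < \<epsilon> / 2) sequentially"
        using \<epsilon> u(1) by (intro order_tendstoD(2)) auto
      moreover have "eventually (\<lambda>n. \<bar>t\<bar> \<le> r n) sequentially"
        using r by (simp add: filterlim_at_top)
      moreover note close[OF e, of "\<bar>t\<bar>"]
      ultimately show "eventually (\<lambda>n. dist ((v n t - u t)\<^sup>2) 0 < \<epsilon>) sequentially"
      proof eventually_elim
        case (elim n)
        have "(v n t - u t)\<^sup>2 \<le> C * ((v n 0 - u 0)\<^sup>2 + e\<^sup>2 * \<bar>t\<bar>)"
          unfolding C_def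
        proof (rule gronwall[where w="\<lambda>s. v n s - u s" and w'="\<lambda>s. (f (\<sigma> s (p n)) (v n s) + l) - (f (\<sigma> s \<omega>) (clamp_abs B (u s)) + l)"])
          fix s assume "s \<in> closed_segment 0 t"
          then have s: "\<bar>s\<bar> \<le> \<bar>t\<bar>" by (auto simp: closed_segment_eq_real_ivl split: if_splits)
          then have sr: "s \<in> {- r n..r n}" "\<bar>v n s\<bar> \<le> B" using elim(2) v(2)[of s n] by auto
          show "((\<lambda>s. v n s - u s) has_real_derivative (f (\<sigma> s (p n)) (v n s) + l) - (f (\<sigma> s \<omega>) (clamp_abs B (u s)) + l)) (at s)"
            by (intro DERIV_diff u trajectoryD[OF v(1) sr(1)])
          have "\<bar>f (\<sigma> s (p n)) (v n s) - f (\<sigma> s \<omega>) (v n s)\<bar> < e" using elim(3) s sr by blast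
          moreover have "\<bar>f (\<sigma> s \<omega>) (v n s) - f (\<sigma> s \<omega>) (clamp_abs B (u s))\<bar> \<le> K * \<bar>v n s - clamp_abs B (u s)\<bar>"
            by (intro K sr clamp_abs_bound B)
          moreover have "K * \<bar>v n s - clamp_abs B (u s)\<bar> \<le> K * \<bar>v n s - u s\<bar>"
            using clamp_abs_lipschitz[of B "v n s" "u s"] clamp_abs_id[OF sr(2)] K(1) by (intro mult_left_mono) auto
          ultimately show "\<bar>(f (\<sigma> s (p n)) (v n s) + l) - (f (\<sigma> s \<omega>) (clamp_abs B (u s)) + l)\<bar> \<le> K * \<bar>v n s - u s\<bar> + e"
            by linarith
        qed (use K in simp)
        also have "\<dots> = C * (v n 0 - u 0)\<^sup>2 + C * e\<^sup>2 * \<bar>t\<bar>" by (simp add: distrib_left mult.assoc)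
        also have "C * e\<^sup>2 * \<bar>t\<bar> \<le> \<epsilon> / 2"
        proof -
          have "C * e\<^sup>2 = \<epsilon> / 2 / (\<bar>t\<bar> + 1)" using C by (simp add: e2)
          then have "C * e\<^sup>2 * \<bar>t\<bar> \<le> \<epsilon> / 2 / (\<bar>t\<bar> + 1) * (\<bar>t\<bar> + 1)" using \<epsilon> by (simp add: mult_left_mono divide_right_mono)
          also have "\<dots> = \<epsilon> / 2" by (subst times_divide_eq_left, rule nonzero_mult_div_cancel_right) linarith
          finally show ?thesis .
        qed
        finally show ?case using elim(1) by (simp add: dist_real_def)
      qed
    qed
    then have "(\<lambda>n. sqrt ((v n t - u t)\<^sup>2)) \<longlonglongrightarrow> sqrt 0" by (rule tendsto_real_sqrt)
    then have "(\<lambda>n. v n t - u t) \<longlonglongrightarrow> 0" by (simp add: tendsto_rabs_zero_iff)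
    then show ?thesis by (simp add: LIM_zero_iff)
  qed
  have ub: "\<bar>u t\<bar> \<le> B" for t
  proof (rule LIMSEQ_le_const2[OF tendsto_rabs[OF lim]])
    have "eventually (\<lambda>n. \<bar>t\<bar> \<le> r n) sequentially" using r by (simp add: filterlim_at_top)
    then have "eventually (\<lambda>n. \<bar>v n t\<bar> \<le> B) sequentially" by eventually_elim (rule v(2))
    then show "\<exists>N. \<forall>n\<ge>N. \<bar>v n t\<bar> \<le> B" by (simp only: eventually_sequentially)
  qed
  have "trajectory l \<omega> UNIV u"
    using u(2) ub by (simp add: trajectory_def clamp_abs_id)
  then show ?thesis using u(1) lim ub by blast
qed

text \<open>
  A complete orbit \<open>u\<close> for \<open>l'\<close> is a barrier for the parameter \<open>l\<close>: where a trajectory for \<open>l\<close> meets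
  \<open>u\<close>, it leaves it to the side determined by the sign of \<open>l' - l\<close>. The solutions started on \<open>u\<close> at
  the times \<open>- n\<close> therefore stay on that side, and a subsequence converges to a complete orbit.
  The product \<open>(l' - l) * (u t - v t)\<close> treats both sides at once.
\<close>

lemma exists_ordered_trajectory:
  assumes u: "trajectory l' \<omega> UNIV u" "\<And>t. \<bar>u t\<bar> \<le> B" and B: "traps l B" and "l \<noteq> l'"
  obtains v where "trajectory l \<omega> UNIV v" "\<And>t. \<bar>v t\<bar> \<le> B" "\<And>t. 0 \<le> (l' - l) * (u t - v t)"
proof -
  have "\<exists>w. w 0 = u (- real n) \<and> trajectory l (\<sigma> (- real n) \<omega>) {0..} w \<and> (\<forall>t\<ge>0. \<bar>w t\<bar> \<le> B)" for n
    by (rule forward_solution[OF B u(2), of "- real n" "\<sigma> (- real n) \<omega>"]) blast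
  then obtain w where w: "\<And>n. w n 0 = u (- real n)" "\<And>n. trajectory l (\<sigma> (- real n) \<omega>) {0..} (w n)"
    "\<And>n t. 0 \<le> t \<Longrightarrow> \<bar>w n t\<bar> \<le> B" by metis
  define v where "v n t = w n (t + real n)" for n t
  have v: "trajectory l \<omega> {- real n..} (v n)" for n
  proof -
    have "trajectory l (\<sigma> (real n) (\<sigma> (- real n) \<omega>)) ((\<lambda>t. t - real n) ` {0..}) (v n)"
      unfolding v_def by (rule trajectory_shift[OF w(2)])
    moreover have "\<sigma> (real n) (\<sigma> (- real n) \<omega>) = \<omega>" by (simp flip: flow_add)
    moreover have "{- real n..} \<subseteq> (\<lambda>t. t - real n) ` {0..}"
    proof
      fix t assume "t \<in> {- real n..}"
      then show "t \<in> (\<lambda>t. t - real n) ` {0..}" by (intro image_eqI[of _ _ "t + real n"]) auto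
    qed
    ultimately show ?thesis using trajectory_subset by metis
  qed
  have vb: "\<bar>v n t\<bar> \<le> B" if "- real n \<le> t" for n t using w(3)[of "t + real n" n] that by (simp add: v_def)
  have ord: "0 \<le> (l' - l) * (u t - v n t)" if t: "- real n \<le> t" for n t
  proof (rule barrier[OF t, where z="\<lambda>t. (l' - l) * (u t - v n t)" and z'="\<lambda>t. (l' - l) * ((f (\<sigma> t \<omega>) (u t) + l') - (f (\<sigma> t \<omega>) (v n t) + l))"])
    show "0 \<le> (l' - l) * (u (- real n) - v n (- real n))" by (simp add: v_def w(1))
    fix s assume s: "- real n \<le> s" "s \<le> t"
    show "((\<lambda>t. (l' - l) * (u t - v n t)) has_real_derivative (l' - l) * ((f (\<sigma> s \<omega>) (u s) + l') - (f (\<sigma> s \<omega>) (v n s) + l))) (at s)"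
      using s by (intro DERIV_cmult DERIV_diff trajectoryD[OF u(1)] trajectoryD[OF v]) auto
    assume "(l' - l) * (u s - v n s) = 0"
    then have "u s = v n s" using \<open>l \<noteq> l'\<close> by simp
    then show "0 < (l' - l) * ((f (\<sigma> s \<omega>) (u s) + l') - (f (\<sigma> s \<omega>) (v n s) + l))"
      using \<open>l \<noteq> l'\<close> by (simp add: zero_less_mult_iff linorder_neq_iff)
  qed
  have "bounded (range (\<lambda>n. v n 0))" using vb[of _ 0] by (auto simp: bounded_iff)
  then obtain y \<rho> where y: "strict_mono \<rho>" "((\<lambda>n. v n 0) \<circ> \<rho>) \<longlonglongrightarrow> y"
    using bounded_imp_convergent_subsequence[of "\<lambda>n. v n 0"] by auto
  have r: "filterlim (\<lambda>n. real (\<rho> n)) at_top sequentially"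
    using filterlim_compose[OF filterlim_real_sequentially filterlim_subseq[OF y(1)]] .
  have 1: "trajectory l \<omega> {- real (\<rho> n)..real (\<rho> n)} (v (\<rho> n))" for n
    by (rule trajectory_subset[OF v]) auto
  have 2: "\<bar>v (\<rho> n) t\<bar> \<le> B" if "\<bar>t\<bar> \<le> real (\<rho> n)" for n t using vb[of "\<rho> n" t] that by linarith
  have 3: "(\<lambda>n. v (\<rho> n) 0) \<longlonglongrightarrow> y" using y(2) by (simp add: o_def)
  have B0: "0 \<le> B" using B by (simp add: traps_def)
  obtain q where q: "q 0 = y" "trajectory l \<omega> UNIV q" "\<And>t. (\<lambda>n. v (\<rho> n) t) \<longlonglongrightarrow> q t" "\<And>t. \<bar>q t\<bar> \<le> B"
    using trajectory_limit[OF r tendsto_const 1 2 3 B0] by auto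
  have "0 \<le> (l' - l) * (u t - q t)" for t
  proof (rule LIMSEQ_le_const)
    show "(\<lambda>n. (l' - l) * (u t - v (\<rho> n) t)) \<longlonglongrightarrow> (l' - l) * (u t - q t)" by (intro tendsto_intros q)
    have "eventually (\<lambda>n. - t \<le> real (\<rho> n)) sequentially" using r by (simp add: filterlim_at_top)
    then obtain N where "\<And>n. N \<le> n \<Longrightarrow> - t \<le> real (\<rho> n)" by (auto simp: eventually_sequentially)
    then show "\<exists>N. \<forall>n\<ge>N. 0 \<le> (l' - l) * (u t - v (\<rho> n) t)"
      by (intro exI[of _ N] allI impI ord) (metis minus_le_iff)
  qed
  then show ?thesis using that q by blast
qed

end

lemma minimal_set_exists:
  fixes K :: "('w::metric_space \<times> real) set"
  assumes K: "compact K" "K \<noteq> {}" "skew_invariant \<sigma> g K"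
  obtains M where "M \<subseteq> K" "minimal_set \<sigma> g M"
proof -
  have inter: "skew_invariant \<sigma> g (\<Inter>C)" if "C \<noteq> {}" "\<And>X. X \<in> C \<Longrightarrow> skew_invariant \<sigma> g X" for C
    using that unfolding skew_invariant_def by fastforce
  obtain M where M: "M \<subseteq> K" "closed M" "M \<noteq> {}" "skew_invariant \<sigma> g M"
    "\<And>N. N \<subseteq> M \<Longrightarrow> closed N \<Longrightarrow> N \<noteq> {} \<Longrightarrow> skew_invariant \<sigma> g N \<Longrightarrow> N = M"
    using minimal_closed_subset[OF K(1) compact_imp_closed[OF K(1)] K(2), of "skew_invariant \<sigma> g", OF K(3) inter]
    by metis
  have "compact M" using compact_Int_closed[OF K(1) M(2)] M(1) by (simp add: Int_absorb1)
  moreover have "\<not> (\<exists>N. N \<subset> M \<and> N \<noteq> {} \<and> compact N \<and> skew_invariant \<sigma> g N)"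
    using M(5) compact_imp_closed by blast
  ultimately show ?thesis using that[OF M(1)] M by (simp add: minimal_set_def)
qed

section \<open>d-concavity and ordered pairs of orbits\<close>

locale dconcave_family = skew_family \<sigma> f
  for \<sigma> :: "real \<Rightarrow> 'w::metric_space \<Rightarrow> 'w" and f :: "'w \<Rightarrow> real \<Rightarrow> real" +
  assumes DC: "DC f"
begin

text \<open>
  A complete orbit in \<open>M\<close> together with the logarithm \<open>V\<close> of the fundamental solution of its
  variational equation. Carrying the primitive \<open>V\<close> along replaces oriented integrals by
  differences of values of \<open>V\<close>.
\<close>

definition orbit_in :: "real \<Rightarrow> ('w \<times> real) set \<Rightarrow> 'w \<Rightarrow> (real \<Rightarrow> real) \<Rightarrow> (real \<Rightarrow> real) \<Rightarrow> bool" where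
  "orbit_in l M \<omega> v V \<longleftrightarrow> trajectory l \<omega> UNIV v \<and> (\<forall>t. (\<sigma> t \<omega>, v t) \<in> M) \<and>
     V 0 = 0 \<and> (\<forall>t. (V has_real_derivative deriv (f (\<sigma> t \<omega>)) (v t)) (at t))"

text \<open>
  The trapezoidal half of the Hermite--Hadamard inequality for the concave function \<open>f\<^sub>x\<close>:
  \<open>G\<close> compares the primitive of \<open>f\<^sub>x\<close> along the segment with that of the chord.
\<close>

lemma hermite_hadamard:
  assumes "x < y"
  shows "(y - x) * ((deriv (f \<omega>) x + deriv (f \<omega>) y) / 2) \<le> f \<omega> y - f \<omega> x"
proof -
  define h where "h = y - x"
  define a where "a = deriv (f \<omega>) x"
  define b where "b = deriv (f \<omega>) y"
  define G where "G s = f \<omega> (x + s * h) - h * ((s - s\<^sup>2 / 2) * a + s\<^sup>2 / 2 * b)" for s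
  have h: "0 < h" using assms by (simp add: h_def)
  have "G 0 \<le> G 1"
  proof (rule DERIV_nonneg_imp_nondecreasing[of 0 1 G])
    fix s :: real assume s: "0 \<le> s" "s \<le> 1"
    have "((\<lambda>s. f \<omega> (x + s * h)) has_real_derivative deriv (f \<omega>) (x + s * h) * h) (at s)"
      by (rule DERIV_chain2[OF f_deriv]) (auto intro!: derivative_eq_intros)
    then have "(G has_real_derivative h * (deriv (f \<omega>) (x + s * h) - ((1 - s) * a + s * b))) (at s)"
      unfolding G_def by (auto intro!: derivative_eq_intros simp: algebra_simps)
    moreover have "(1 - s) * a + s * b \<le> deriv (f \<omega>) (x + s * h)"
    proof -
      have "concave_on UNIV (deriv (f \<omega>))" using DC by (simp add: DC_def)
      then have "(1 - s) * deriv (f \<omega>) x + s * deriv (f \<omega>) y \<le> deriv (f \<omega>) ((1 - s) * x + s * y)"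
        using s unfolding concave_on_iff by simp
      moreover have "(1 - s) * x + s * y = x + s * h" by (simp add: h_def algebra_simps)
      ultimately show ?thesis by (simp add: a_def b_def)
    qed
    ultimately show "\<exists>D. (G has_real_derivative D) (at s) \<and> 0 \<le> D"
      using h by (intro exI conjI) auto
  qed simp
  then have "f \<omega> x \<le> f \<omega> y - h * (a / 2 + b / 2)" by (simp add: G_def h_def)
  then show ?thesis by (simp add: h_def a_def b_def add_divide_distrib)
qed

text \<open>
  The key estimate. The gap \<open>d = q - p\<close> stays between two positive constants: it is bounded since
  the orbits are, and \<open>d' \<ge> e - K d\<close> on the whole line with \<open>e = lq - lp\<close> keeps it above \<open>e / K\<close>.
  By the trapezoidal inequality \<open>d' / d\<close> exceeds the mean of \<open>f\<^sub>x\<close> along the two orbits by at least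
  \<open>e / (2 B)\<close>, while the integral of \<open>d' / d\<close> is a difference of values of \<open>ln d\<close> and hence bounded.
  So \<open>f\<^sub>x\<close> cannot have nonnegative mean along both orbits.
\<close>

lemma ordered_pair_decay:
  assumes lt: "lp < lq" and B: "0 < B"
  shows "\<exists>C c. 0 < c \<and> (\<forall>\<omega> p q P Q t. orbit_in lp (UNIV \<times> {- B..B}) \<omega> p P \<longrightarrow>
      orbit_in lq (UNIV \<times> {- B..B}) \<omega> q Q \<longrightarrow> (\<forall>t. p t \<le> q t) \<longrightarrow> 0 \<le> t \<longrightarrow> P t + Q t \<le> C - c * t)"
proof -
  define e where "e = lq - lp"
  have e: "0 < e" using lt by (simp add: e_def)
  obtain K where K: "0 < K" "\<And>\<omega> x y. \<bar>x\<bar> \<le> B \<Longrightarrow> \<bar>y\<bar> \<le> B \<Longrightarrow> \<bar>f \<omega> x - f \<omega> y\<bar> \<le> K * \<bar>x - y\<bar>"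
    using f_lipschitz[of B] by blast
  define C where "C = 2 * (ln (2 * B) - ln (e / K))"
  have "P t + Q t \<le> C - e / B * t"
    if op: "orbit_in lp (UNIV \<times> {- B..B}) \<omega> p P" and oq: "orbit_in lq (UNIV \<times> {- B..B}) \<omega> q Q"
      and pq: "\<And>t. p t \<le> q t" and t: "0 \<le> t" for \<omega> p q P Q t
  proof -
    have p: "trajectory lp \<omega> UNIV p" and q: "trajectory lq \<omega> UNIV q"
      and pB: "\<And>t. \<bar>p t\<bar> \<le> B" and qB: "\<And>t. \<bar>q t\<bar> \<le> B"
      and P: "P 0 = 0" "\<And>t. (P has_real_derivative deriv (f (\<sigma> t \<omega>)) (p t)) (at t)"
      and Q: "Q 0 = 0" "\<And>t. (Q has_real_derivative deriv (f (\<sigma> t \<omega>)) (q t)) (at t)"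
      using op oq by (auto simp: orbit_in_def abs_le_iff minus_le_iff)
    define d where "d t = q t - p t" for t
    define d' where "d' t = f (\<sigma> t \<omega>) (q t) - f (\<sigma> t \<omega>) (p t) + e" for t
    have dd: "(d has_real_derivative d' t) (at t)" for t
      using DERIV_diff[OF trajectoryD[OF q UNIV_I] trajectoryD[OF p UNIV_I], of t]
      unfolding d_def d'_def e_def by (simp add: algebra_simps)
    have d0: "0 \<le> d t" for t using pq by (simp add: d_def)
    have dK: "e - K * d t \<le> d' t" for t
      using K(2)[OF qB pB, of "\<sigma> t \<omega>" t t] d0[of t] unfolding d'_def d_def by (simp add: abs_le_iff)
    have lower: "e / K \<le> d t" for t
    proof -
      define z where "z s = (d s - e / K) * exp (K * s)" for s
      have zmono: "z s \<le> z t" if "s \<le> t" for s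
      proof (rule DERIV_nonneg_imp_nondecreasing[OF that])
        fix r
        have "(z has_real_derivative (d' r + K * d r - e) * exp (K * r)) (at r)"
          unfolding z_def using K(1) by (auto intro!: derivative_eq_intros dd simp: field_simps)
        moreover have "0 \<le> (d' r + K * d r - e) * exp (K * r)" using dK[of r] by (intro mult_nonneg_nonneg) auto
        ultimately show "\<exists>y. (z has_real_derivative y) (at r) \<and> 0 \<le> y" by blast
      qed
      \<comment> \<open>The gap is nonnegative at time \<open>t - n\<close>; this is integrated up to time \<open>t\<close>.\<close>
      have "- (e / K) * exp (- K) ^ n \<le> d t - e / K" for n :: nat
      proof -
        have "- (e / K) * exp (K * (t - real n)) \<le> z (t - real n)"
          unfolding z_def using d0[of "t - real n"] by (intro mult_right_mono) auto
        also have "\<dots> \<le> z t" by (rule zmono) simp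
        finally have "- (e / K) * exp (K * (t - real n)) / exp (K * t) \<le> z t / exp (K * t)"
          by (intro divide_right_mono) auto
        moreover have "exp (K * (t - real n)) = exp (K * t) * exp (- K) ^ n"
          by (simp add: exp_of_nat_mult[symmetric] exp_add[symmetric] algebra_simps)
        ultimately show ?thesis by (simp add: z_def)
      qed
      moreover have "(\<lambda>n. - (e / K) * exp (- K) ^ n) \<longlonglongrightarrow> - (e / K) * 0"
        using K(1) by (intro tendsto_mult_left LIMSEQ_power_zero) simp
      ultimately have "- (e / K) * 0 \<le> d t - e / K" by (intro LIMSEQ_le_const2) auto
      then show ?thesis by simp
    qed
    have dpos: "0 < d t" for t using lower[of t] e K(1) by (smt (verit) divide_pos_pos)
    have upper: "d t \<le> 2 * B" for t using pB[of t] qB[of t] by (simp add: d_def abs_le_iff)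
    have rate: "(deriv (f (\<sigma> t \<omega>)) (p t) + deriv (f (\<sigma> t \<omega>)) (q t)) / 2 + e / (2 * B) \<le> d' t / d t" for t
    proof -
      have "d t * ((deriv (f (\<sigma> t \<omega>)) (p t) + deriv (f (\<sigma> t \<omega>)) (q t)) / 2) \<le> f (\<sigma> t \<omega>) (q t) - f (\<sigma> t \<omega>) (p t)"
        using hermite_hadamard[of "p t" "q t" "\<sigma> t \<omega>"] dpos[of t] by (simp add: d_def)
      moreover have "d t * (e / (2 * B)) \<le> e"
        using mult_right_mono[OF upper[of t], of "e / (2 * B)"] B e by simp
      ultimately have "d t * ((deriv (f (\<sigma> t \<omega>)) (p t) + deriv (f (\<sigma> t \<omega>)) (q t)) / 2 + e / (2 * B)) \<le> d' t"
        unfolding d'_def distrib_left[of "d t" "_ / 2" "e / _"] by linarith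
      then show ?thesis using dpos[of t] by (simp add: le_divide_eq mult.commute)
    qed
    define Z where "Z t = ln (d t) - (P t + Q t) / 2 - e / (2 * B) * t" for t
    have "Z 0 \<le> Z t"
    proof (rule DERIV_nonneg_imp_nondecreasing[OF t])
      fix s
      have "((\<lambda>s. ln (d s)) has_real_derivative d' s / d s) (at s)"
        using DERIV_chain2[OF DERIV_ln_divide[OF dpos[of s]] dd[of s]] by simp
      then have "(Z has_real_derivative d' s / d s - (deriv (f (\<sigma> s \<omega>)) (p s) + deriv (f (\<sigma> s \<omega>)) (q s)) / 2 - e / (2 * B)) (at s)"
        unfolding Z_def
        by (intro DERIV_diff DERIV_cdivide DERIV_add P(2) Q(2) DERIV_cmult_Id)
      then show "\<exists>y. (Z has_real_derivative y) (at s) \<and> 0 \<le> y"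
        using rate[of s] by (intro exI conjI) auto
    qed
    moreover have "ln (e / K) \<le> ln (d 0)" using lower[of 0] e K(1) dpos[of 0] by simp
    moreover have "ln (d t) \<le> ln (2 * B)" using upper[of t] dpos[of t] B by simp
    moreover have "Z 0 = ln (d 0)" by (simp add: Z_def P(1) Q(1))
    moreover obtain h where "h = e / (2 * B) * t" by simp
    then have "Z t = ln (d t) - (P t + Q t) / 2 - h" "e / B * t = 2 * h" by (simp_all add: Z_def)
    ultimately show ?thesis unfolding C_def by argo
  qed
  then show ?thesis using e B by (metis divide_pos_pos)
qed

lemma trajectory_antiderivative:
  assumes "trajectory l \<omega> UNIV v"
  obtains V where "V 0 = 0" "\<And>t. (V has_real_derivative deriv (f (\<sigma> t \<omega>)) (v t)) (at t)"
proof -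
  have "continuous_on UNIV (\<lambda>t. deriv (f (\<sigma> t \<omega>)) (v t))"
    by (intro fx_continuous continuous_flow_comp trajectory_continuous[OF assms] continuous_on_id continuous_on_const)
  then show ?thesis by (rule continuous_antiderivative) (rule that)
qed

section \<open>Linearized decay and hyperbolicity\<close>

lemma difference_rate:
  assumes "\<And>x. \<bar>x - u\<bar> \<le> \<bar>w - u\<bar> \<Longrightarrow> \<bar>deriv (f \<omega>) x - deriv (f \<omega>) u\<bar> \<le> c"
  shows "\<bar>(w - u) * (f \<omega> w - f \<omega> u) - deriv (f \<omega>) u * (w - u)\<^sup>2\<bar> \<le> c * (w - u)\<^sup>2"
proof -
  obtain x where x: "\<bar>x - u\<bar> \<le> \<bar>w - u\<bar>" "f \<omega> w - f \<omega> u = (w - u) * deriv (f \<omega>) x"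
  proof (cases w u rule: linorder_cases)
    case less
    obtain x where "w < x" "x < u" "f \<omega> u - f \<omega> w = (u - w) * deriv (f \<omega>) x"
      using MVT2[OF less, of "f \<omega>" "deriv (f \<omega>)"] f_deriv by blast
    then show ?thesis using that[of x] by (simp add: algebra_simps)
  next
    case equal
    then show ?thesis using that[of u] by simp
  next
    case greater
    obtain x where "u < x" "x < w" "f \<omega> w - f \<omega> u = (w - u) * deriv (f \<omega>) x"
      using MVT2[OF greater, of "f \<omega>" "deriv (f \<omega>)"] f_deriv by blast
    then show ?thesis using that[of x] by simp
  qed
  have "(w - u) * (f \<omega> w - f \<omega> u) - deriv (f \<omega>) u * (w - u)\<^sup>2 = (deriv (f \<omega>) x - deriv (f \<omega>) u) * (w - u)\<^sup>2"
    unfolding x(2) by (simp add: power2_eq_square algebra_simps)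
  also have "\<bar>\<dots>\<bar> \<le> c * (w - u)\<^sup>2"
    unfolding abs_mult using assms[OF x(1)] by (simp add: mult_right_mono)
  finally show ?thesis .
qed

lemma fx_modulus:
  assumes "0 < c"
  obtains \<rho> where "0 < \<rho>" "\<rho> \<le> 1"
    "\<And>\<omega> x y. \<bar>x\<bar> \<le> B \<Longrightarrow> \<bar>y - x\<bar> \<le> \<rho> \<Longrightarrow> \<bar>deriv (f \<omega>) y - deriv (f \<omega>) x\<bar> \<le> c"
proof -
  have "uniformly_continuous_on (UNIV \<times> {- (B + 1)..B + 1}) (\<lambda>q. deriv (f (fst q)) (snd q))"
    by (intro compact_uniformly_continuous compact_strip fx_continuous continuous_on_fst continuous_on_snd continuous_on_id)
  then obtain d where d: "0 < d" "\<forall>q\<in>UNIV \<times> {- (B + 1)..B + 1}. \<forall>q'\<in>UNIV \<times> {- (B + 1)..B + 1}.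
      dist q' q < d \<longrightarrow> dist (deriv (f (fst q')) (snd q')) (deriv (f (fst q)) (snd q)) < c"
    using assms unfolding uniformly_continuous_on_def by metis
  define \<rho> where "\<rho> = min (d / 2) 1"
  have \<rho>: "0 < \<rho>" "\<rho> \<le> 1" "\<rho> < d" using d(1) by (auto simp: \<rho>_def min_def)
  have "\<bar>deriv (f \<omega>) y - deriv (f \<omega>) x\<bar> \<le> c" if "\<bar>x\<bar> \<le> B" "\<bar>y - x\<bar> \<le> \<rho>" for \<omega> x y
  proof -
    have "dist (deriv (f \<omega>) y) (deriv (f \<omega>) x) < c"
      using d(2)[rule_format, of "(\<omega>, x)" "(\<omega>, y)"] that \<rho> by (simp add: dist_Pair_Pair dist_real_def abs_le_iff)
    then show ?thesis unfolding dist_real_def by linarith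
  qed
  then show ?thesis using that \<rho> by blast
qed

text \<open>
  First approximation: as long as a perturbation stays within the radius \<open>\<rho>\<close> on which \<open>f\<^sub>x\<close> varies by
  at most \<open>c / 2\<close>, it decays at rate \<open>c / 2\<close>, and starting within \<open>\<delta> = \<rho> / (2 k)\<close> it never reaches
  that radius. Truncation beyond the neighbourhood provides global existence in advance.
\<close>

lemma attractive_if_decay:
  assumes M: "skew_invariant \<sigma> (shifted f l) M" and MB: "M \<subseteq> UNIV \<times> {- B..B}" and c: "0 < c"
    and decay: "\<And>\<omega> v V t. orbit_in l M \<omega> v V \<Longrightarrow> 0 \<le> t \<Longrightarrow> V t \<le> C - c * t"
  shows "hyperbolic_attractive \<sigma> (shifted f l) M"
proof -
  have c2: "0 < c / 2" using c by simp
  obtain \<rho> where \<rho>: "0 < \<rho>" "\<rho> \<le> 1"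
    and near: "\<And>\<omega> x y. \<bar>x\<bar> \<le> B \<Longrightarrow> \<bar>y - x\<bar> \<le> \<rho> \<Longrightarrow> \<bar>deriv (f \<omega>) y - deriv (f \<omega>) x\<bar> \<le> c / 2"
    using fx_modulus[OF c2, of B] by blast
  define k where "k = exp (max C 0)"
  have k: "1 \<le> k" by (simp add: k_def)
  define \<delta> where "\<delta> = \<rho> / (2 * k)"
  have \<delta>: "0 < \<delta>" "k * \<delta> = \<rho> / 2" using \<rho> k by (auto simp: \<delta>_def)
  have main: "t \<in> sol_dom \<sigma> (shifted f l) \<omega> y \<and>
      \<bar>sol \<sigma> (shifted f l) t \<omega> y - sol \<sigma> (shifted f l) t \<omega> x\<bar> \<le> k * exp (- (c / 2) * \<bar>t\<bar>) * \<bar>y - x\<bar>"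
    if x: "(\<omega>, x) \<in> M" and y: "\<bar>y - x\<bar> < \<delta>" and t: "0 \<le> t" for \<omega> x y t
  proof -
    obtain u where u: "u 0 = x" "trajectory l \<omega> UNIV u" "\<And>t. (\<sigma> t \<omega>, u t) \<in> M"
      "\<And>t. sol \<sigma> (shifted f l) t \<omega> x = u t"
      using invariant_trajectory[OF M x] by blast
    obtain V where V: "V 0 = 0" "\<And>t. (V has_real_derivative deriv (f (\<sigma> t \<omega>)) (u t)) (at t)"
      using trajectory_antiderivative[OF u(2)] by blast
    have uB: "\<bar>u t\<bar> \<le> B" for t using u(3)[of t] MB by (auto simp: abs_le_iff)
    have B0: "0 \<le> B" using uB[of 0] by linarith
    obtain w where w: "w 0 = y" "\<And>t. (w has_real_derivative f (\<sigma> t \<omega>) (clamp_abs (B + 2) (w t)) + l) (at t)"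
      using truncated_solution[of "B + 2" y \<omega> l] B0 by auto
    have est: "\<bar>w s - u s\<bar> \<le> k * exp (- (c / 2) * s) * \<bar>y - x\<bar>"
      if s: "0 \<le> s" and close: "\<And>r. 0 \<le> r \<Longrightarrow> r \<le> s \<Longrightarrow> \<bar>w r - u r\<bar> \<le> \<rho>" for s
    proof -
      have "\<bar>w s - u s\<bar> \<le> exp (V s - V 0 + c / 2 * \<bar>s - 0\<bar>) * \<bar>w 0 - u 0\<bar>"
      proof (rule linear_growth[where z="\<lambda>s. w s - u s" and V=V])
        fix r assume "r \<in> closed_segment 0 s"
        then have r: "0 \<le> r" "r \<le> s" using s by (simp_all add: closed_segment_eq_real_ivl)
        have "\<bar>w r\<bar> \<le> B + 2" using close[OF r] uB[of r] \<rho>(2) by linarith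
        then have "(w has_real_derivative f (\<sigma> r \<omega>) (w r) + l) (at r)" using w(2)[of r] by (simp add: clamp_abs_id)
        from DERIV_diff[OF this trajectoryD[OF u(2) UNIV_I]]
        show "((\<lambda>s. w s - u s) has_real_derivative f (\<sigma> r \<omega>) (w r) - f (\<sigma> r \<omega>) (u r)) (at r)" by simp
        show "(V has_real_derivative deriv (f (\<sigma> r \<omega>)) (u r)) (at r)" by (rule V(2))
        show "\<bar>(w r - u r) * (f (\<sigma> r \<omega>) (w r) - f (\<sigma> r \<omega>) (u r)) - deriv (f (\<sigma> r \<omega>)) (u r) * (w r - u r)\<^sup>2\<bar>
            \<le> c / 2 * (w r - u r)\<^sup>2"
          by (rule difference_rate, rule near[OF uB]) (use close[OF r] in linarith)
      qed
      then have "\<bar>w s - u s\<bar> \<le> exp (V s + c / 2 * s) * \<bar>w 0 - u 0\<bar>" using s V(1) by simp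
      also have "\<dots> \<le> exp (max C 0 - c / 2 * s) * \<bar>w 0 - u 0\<bar>"
      proof (rule mult_right_mono)
        have "V s \<le> C - c * s" using u(2,3) V by (intro decay[OF _ s, of \<omega> u V]) (simp add: orbit_in_def)
        moreover have "c / 2 * s = c * s - c / 2 * s" by (simp add: field_simps)
        moreover have "C \<le> max C 0" by simp
        ultimately have "V s + c / 2 * s \<le> max C 0 - c / 2 * s" by linarith
        then show "exp (V s + c / 2 * s) \<le> exp (max C 0 - c / 2 * s)" by simp
      qed simp
      also have "\<dots> = k * exp (- (c / 2) * s) * \<bar>y - x\<bar>"
        by (simp add: k_def w(1) u(1) exp_add[symmetric])
      finally show ?thesis .
    qed
    have est0: "\<bar>w s - u s\<bar> < \<rho>" if s: "0 \<le> s" and close: "\<And>r. 0 \<le> r \<Longrightarrow> r \<le> s \<Longrightarrow> \<bar>w r - u r\<bar> \<le> \<rho>" for s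
    proof -
      have "exp (- (c / 2) * s) \<le> 1" using c s by simp
      then have "k * exp (- (c / 2) * s) * \<bar>y - x\<bar> \<le> k * 1 * \<delta>" using k y by (intro mult_mono) auto
      then show ?thesis using est[OF s close] \<delta>(2) \<rho>(1) by simp
    qed
    have wuc: "continuous_on S (\<lambda>s. \<bar>w s - u s\<bar>)" for S
    proof -
      have "continuous_on UNIV w" using w(2) by (auto intro!: continuous_at_imp_continuous_on DERIV_isCont)
      then have "continuous_on UNIV (\<lambda>s. \<bar>w s - u s\<bar>)"
        by (intro continuous_on_rabs continuous_on_diff trajectory_continuous[OF u(2)])
      then show ?thesis by (rule continuous_on_subset) simp
    qed
    have close: "\<bar>w s - u s\<bar> < \<rho>" if s: "0 \<le> s" for s
    proof (rule ccontr)
      assume far: "\<not> ?thesis"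
      have start: "\<bar>w 0 - u 0\<bar> < \<rho>"
      proof -
        have "1 * \<delta> \<le> k * \<delta>" using k \<delta>(1) by (intro mult_right_mono) auto
        then have "\<delta> \<le> \<rho> / 2" using \<delta>(2) by simp
        then show ?thesis using y w u \<rho>(1) by simp
      qed
      define S where "S = {0..s} \<inter> (\<lambda>s. \<bar>w s - u s\<bar>) -` {\<rho>..}"
      have S: "closed S" unfolding S_def by (rule continuous_closed_preimage[OF wuc]) auto
      have ne: "S \<noteq> {}" "bdd_below S" using far s by (auto simp: S_def intro!: bdd_belowI[of _ 0])
      define r where "r = Inf S"
      have rS: "r \<in> S" unfolding r_def by (rule closed_contains_Inf[OF ne S])
      then have r: "0 \<le> r" "\<rho> \<le> \<bar>w r - u r\<bar>" by (auto simp: S_def)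
      have before: "\<bar>w q - u q\<bar> < \<rho>" if "0 \<le> q" "q < r" for q
      proof (rule ccontr)
        assume "\<not> ?thesis"
        then have "q \<in> S" using that rS by (auto simp: S_def)
        then show False using cInf_lower[OF _ ne(2), of q] that by (simp add: r_def)
      qed
      obtain q where q: "0 \<le> q" "q \<le> r" "\<bar>w q - u q\<bar> = \<rho>"
        using IVT'[of "\<lambda>s. \<bar>w s - u s\<bar>" 0 \<rho> r] start r wuc by auto
      then have "q = r" using before[of q] by (cases "q < r") auto
      then have "\<bar>w p - u p\<bar> \<le> \<rho>" if "0 \<le> p" "p \<le> r" for p
        using before[of p] that q by (cases "p = r") auto
      then show False using est0[OF r(1)] r(2) by simp
    qed
    have wb: "\<bar>w s\<bar> < B + 2" if "0 \<le> s" for s using close[OF that] uB[of s] \<rho>(2) by linarith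
    obtain \<eta> where \<eta>: "0 < \<eta>" "solves_on \<sigma> (shifted f l) \<omega> (w 0) {- \<eta><..} w"
      using truncated_solves_on[OF w(2) wb] by blast
    have "t \<in> {- \<eta><..}" using t \<eta>(1) by simp
    note sol = sol_eq[OF \<eta>(2) this]
    have "\<bar>w t - u t\<bar> \<le> k * exp (- (c / 2) * t) * \<bar>y - x\<bar>"
      by (rule est[OF t]) (use close in \<open>auto intro: less_imp_le\<close>)
    then show ?thesis using sol t by (simp add: w(1) u(4))
  qed
  show ?thesis
    unfolding hyperbolic_on_def
  proof (rule exI[of _ \<delta>], rule exI[of _ k], rule exI[of _ "c / 2"], intro conjI)
    show "0 < \<delta>" by fact
    show "1 \<le> k" by fact
    show "0 < c / 2" by fact
    show "\<forall>(\<omega>, x)\<in>M. \<forall>y. \<bar>y - x\<bar> < \<delta> \<longrightarrow> (\<forall>t\<in>{0..}. t \<in> sol_dom \<sigma> (shifted f l) \<omega> y \<and>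
        \<bar>sol \<sigma> (shifted f l) t \<omega> y - sol \<sigma> (shifted f l) t \<omega> x\<bar> \<le> k * exp (- (c / 2) * \<bar>t\<bar>) * \<bar>y - x\<bar>)"
    proof (rule ballI)
      fix p assume "p \<in> M"
      then obtain \<omega> x where p: "p = (\<omega>, x)" "(\<omega>, x) \<in> M" by (cases p) simp
      show "case p of (\<omega>, x) \<Rightarrow> \<forall>y. \<bar>y - x\<bar> < \<delta> \<longrightarrow> (\<forall>t\<in>{0..}. t \<in> sol_dom \<sigma> (shifted f l) \<omega> y \<and>
        \<bar>sol \<sigma> (shifted f l) t \<omega> y - sol \<sigma> (shifted f l) t \<omega> x\<bar> \<le> k * exp (- (c / 2) * \<bar>t\<bar>) * \<bar>y - x\<bar>)"
        unfolding p(1) prod.case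
        by (intro allI impI ballI) (rule main[OF p(2)], simp_all)
    qed
  qed
qed


lemma compact_in_strip:
  assumes "compact (M :: ('w \<times> real) set)"
  obtains B where "0 < B" "M \<subseteq> UNIV \<times> {- B..B}"
proof -
  have "bounded (snd ` M)"
    using assms by (intro compact_imp_bounded compact_continuous_image continuous_on_snd continuous_on_id)
  then obtain B where B: "0 < B" "\<forall>x\<in>snd ` M. norm x \<le> B" unfolding bounded_pos by blast
  have "M \<subseteq> UNIV \<times> {- B..B}"
  proof
    fix p assume "p \<in> M"
    then have "\<bar>snd p\<bar> \<le> B" using B(2) by simp
    then show "p \<in> UNIV \<times> {- B..B}" by (simp add: mem_Times_iff abs_le_iff)
  qed
  then show ?thesis using that B(1) by blast
qed

lemma orbit_in_exists:
  assumes "skew_invariant \<sigma> (shifted f l) M" "(\<omega>, x) \<in> M"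
  obtains v V where "orbit_in l M \<omega> v V" "v 0 = x" "\<And>t. sol \<sigma> (shifted f l) t \<omega> x = v t"
proof -
  obtain v where v: "v 0 = x" "trajectory l \<omega> UNIV v" "\<And>t. (\<sigma> t \<omega>, v t) \<in> M"
    "\<And>t. sol \<sigma> (shifted f l) t \<omega> x = v t"
    using invariant_trajectory[OF assms] by blast
  obtain V where "V 0 = 0" "\<And>t. (V has_real_derivative deriv (f (\<sigma> t \<omega>)) (v t)) (at t)"
    using trajectory_antiderivative[OF v(2)] by blast
  then show ?thesis using that[of v V] v by (simp add: orbit_in_def)
qed

lemma orbit_in_shift:
  assumes "orbit_in l M \<omega> v V"
  shows "orbit_in l M (\<sigma> s \<omega>) (\<lambda>t. v (t + s)) (\<lambda>t. V (t + s) - V s)"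
  unfolding orbit_in_def
proof (intro conjI allI)
  have v: "trajectory l \<omega> UNIV v" using assms by (simp add: orbit_in_def)
  show "trajectory l (\<sigma> s \<omega>) UNIV (\<lambda>t. v (t + s))"
    using trajectory_shift[OF v, of s] by (simp add: surj_diff_right)
  fix t
  have "(\<sigma> (t + s) \<omega>, v (t + s)) \<in> M" using assms by (simp add: orbit_in_def)
  then show "(\<sigma> t (\<sigma> s \<omega>), v (t + s)) \<in> M" by (simp add: flow_add)
  have "(V has_real_derivative deriv (f (\<sigma> (t + s) \<omega>)) (v (t + s))) (at (t + s))"
    using assms unfolding orbit_in_def by blast
  then have "((\<lambda>t. V (t + s)) has_real_derivative deriv (f (\<sigma> (t + s) \<omega>)) (v (t + s))) (at t)"
    by (simp add: DERIV_shift)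
  from DERIV_diff[OF this DERIV_const]
  show "((\<lambda>t. V (t + s) - V s) has_real_derivative deriv (f (\<sigma> t (\<sigma> s \<omega>))) (v (t + s))) (at t)"
    by (simp add: flow_add)
qed simp

text \<open>
  Hyperbolicity forces linearized decay. Fix \<open>t\<close> and compare the orbit with one starting at a small
  distance \<open>h\<close>: hyperbolicity bounds the distance at time \<open>t\<close>, and running the linearized
  estimate back to time \<open>0\<close> bounds \<open>h\<close> by that distance, up to an error \<open>c \<bar>t\<bar>\<close> in the exponent that
  vanishes with \<open>h\<close>.
\<close>

lemma hyperbolic_imp_rate:
  assumes hyp: "hyperbolic_on T \<sigma> (shifted f l) M" and M: "M \<subseteq> UNIV \<times> {- B..B}"
    and T: "0 \<in> T" "\<And>t. t \<in> T \<Longrightarrow> closed_segment 0 t \<subseteq> T"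
  shows "\<exists>C \<gamma>. 0 < \<gamma> \<and> (\<forall>\<omega> v V t. orbit_in l M \<omega> v V \<longrightarrow> t \<in> T \<longrightarrow> V t \<le> C - \<gamma> * \<bar>t\<bar>)"
proof -
  obtain \<delta> k \<gamma> where "0 < \<delta>" "1 \<le> k" "0 < \<gamma>" and
    hyp0: "\<forall>(\<omega>, x)\<in>M. \<forall>y. \<bar>y - x\<bar> < \<delta> \<longrightarrow> (\<forall>t\<in>T. t \<in> sol_dom \<sigma> (shifted f l) \<omega> y \<and>
      \<bar>sol \<sigma> (shifted f l) t \<omega> y - sol \<sigma> (shifted f l) t \<omega> x\<bar> \<le> k * exp (- \<gamma> * \<bar>t\<bar>) * \<bar>y - x\<bar>)"
    using hyp unfolding hyperbolic_on_def by blast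
  have hyp: "t \<in> sol_dom \<sigma> (shifted f l) \<omega> y"
      "\<bar>sol \<sigma> (shifted f l) t \<omega> y - sol \<sigma> (shifted f l) t \<omega> x\<bar> \<le> k * exp (- \<gamma> * \<bar>t\<bar>) * \<bar>y - x\<bar>"
    if "(\<omega>, x) \<in> M" "\<bar>y - x\<bar> < \<delta>" "t \<in> T" for \<omega> x y t
    using bspec[OF hyp0 that(1)] that(2,3) by auto
  have "V t \<le> ln k - \<gamma> * \<bar>t\<bar>" if orb: "orbit_in l M \<omega> v V" and t: "t \<in> T" for \<omega> v V t
  proof (rule field_le_epsilon)
    fix \<epsilon> :: real assume \<epsilon>: "0 < \<epsilon>"
    define c where "c = \<epsilon> / (\<bar>t\<bar> + 1)"
    have c: "0 < c" using \<epsilon> by (simp add: c_def)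
    have ct: "c * \<bar>t\<bar> \<le> \<epsilon>"
    proof -
      have "c * \<bar>t\<bar> \<le> c * (\<bar>t\<bar> + 1)" using c by simp
      also have "\<dots> = \<epsilon>" using nonzero_eq_divide_eq[of "\<bar>t\<bar> + 1" c \<epsilon>] by (simp add: c_def)
      finally show ?thesis .
    qed
    obtain \<rho> where \<rho>: "0 < \<rho>" "\<rho> \<le> 1"
      and near: "\<And>\<omega> x y. \<bar>x\<bar> \<le> B \<Longrightarrow> \<bar>y - x\<bar> \<le> \<rho> \<Longrightarrow> \<bar>deriv (f \<omega>) y - deriv (f \<omega>) x\<bar> \<le> c"
      using fx_modulus[OF c, of B] by blast
    have tr: "trajectory l \<omega> UNIV v" and inM: "\<And>t. (\<sigma> t \<omega>, v t) \<in> M" and V0: "V 0 = 0"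
      and V: "\<And>t. (V has_real_derivative deriv (f (\<sigma> t \<omega>)) (v t)) (at t)"
      using orb by (auto simp: orbit_in_def)
    have vB: "\<bar>v s\<bar> \<le> B" for s using inM[of s] M by (auto simp: abs_le_iff)
    have start: "(\<omega>, v 0) \<in> M" using inM[of 0] by simp
    define h where "h = min (\<delta> / 2) (\<rho> / k)"
    have h: "0 < h" "h < \<delta>" "k * h \<le> \<rho>"
      using \<open>0 < \<delta>\<close> \<open>1 \<le> k\<close> \<rho> by (auto simp: h_def min_def field_simps)
    define w where "w s = sol \<sigma> (shifted f l) s \<omega> (v 0 + h)" for s
    have dom: "s \<in> sol_dom \<sigma> (shifted f l) \<omega> (v 0 + h)" if "s \<in> T" for s
      using hyp(1)[OF start _ that, of "v 0 + h"] h by simp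
    have wv: "\<bar>w s - v s\<bar> \<le> k * exp (- \<gamma> * \<bar>s\<bar>) * h" if "s \<in> T" for s
      using hyp(2)[OF start _ that, of "v 0 + h"] h complete_trajectory_sol(2)[OF tr, of s] by (simp add: w_def)
    have w0: "w 0 = v 0 + h" unfolding w_def by (rule sol_0[OF dom[OF T(1)]])
    have "\<bar>w 0 - v 0\<bar> \<le> exp (V 0 - V t + c * \<bar>0 - t\<bar>) * \<bar>w t - v t\<bar>"
    proof (rule linear_growth[where z="\<lambda>s. w s - v s" and V=V])
      fix s assume "s \<in> closed_segment t 0"
      then have s: "s \<in> T" using T(2)[OF t] by (auto simp: closed_segment_commute)
      from DERIV_diff[OF sol_derivative[OF dom[OF s]] trajectoryD[OF tr UNIV_I]]
      show "((\<lambda>s. w s - v s) has_real_derivative f (\<sigma> s \<omega>) (w s) - f (\<sigma> s \<omega>) (v s)) (at s)"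
        by (simp add: w_def)
      show "(V has_real_derivative deriv (f (\<sigma> s \<omega>)) (v s)) (at s)" by (rule V)
      have "k * exp (- \<gamma> * \<bar>s\<bar>) * h \<le> k * 1 * h"
        using \<open>1 \<le> k\<close> \<open>0 < \<gamma>\<close> h(1) by (intro mult_right_mono mult_left_mono) auto
      then have close: "\<bar>w s - v s\<bar> \<le> \<rho>" using wv[OF s] h(3) by linarith
      show "\<bar>(w s - v s) * (f (\<sigma> s \<omega>) (w s) - f (\<sigma> s \<omega>) (v s)) - deriv (f (\<sigma> s \<omega>)) (v s) * (w s - v s)\<^sup>2\<bar>
          \<le> c * (w s - v s)\<^sup>2"
        by (rule difference_rate, rule near[OF vB]) (use close in linarith)
    qed
    also have "\<dots> \<le> exp (V 0 - V t + c * \<bar>0 - t\<bar>) * (k * exp (- \<gamma> * \<bar>t\<bar>) * h)"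
      by (intro mult_left_mono wv t) simp
    finally have "h * 1 \<le> h * (exp (c * \<bar>t\<bar> - V t) * (k * exp (- \<gamma> * \<bar>t\<bar>)))"
      using h(1) by (simp add: w0 V0 mult_ac)
    then have "1 \<le> exp (c * \<bar>t\<bar> - V t) * (k * exp (- \<gamma> * \<bar>t\<bar>))" using h(1) by (simp only: mult_le_cancel_left_pos)
    also have "k = exp (ln k)" using \<open>1 \<le> k\<close> by simp
    finally have "exp 0 \<le> exp (c * \<bar>t\<bar> - V t + (ln k - \<gamma> * \<bar>t\<bar>))"
      by (simp add: exp_add[symmetric] add.assoc)
    then have "0 \<le> c * \<bar>t\<bar> - V t + (ln k - \<gamma> * \<bar>t\<bar>)" by (simp only: exp_le_cancel_iff)
    then show "V t \<le> ln k - \<gamma> * \<bar>t\<bar> + \<epsilon>" using ct by linarith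
  qed
  then show ?thesis using \<open>0 < \<gamma>\<close> by blast
qed

lemma dichotomy_integrand:
  assumes "orbit_in l A \<omega> v V"
  shows "(LBINT s=ereal 0..ereal t. (case skew \<sigma> (shifted f l) s (\<omega>, v 0) of (\<omega>, x) \<Rightarrow> deriv (f \<omega>) x) - m) = V t - m * t"
proof -
  have tr: "trajectory l \<omega> UNIV v" and V0: "V 0 = 0"
    and V: "\<And>t. (V has_real_derivative deriv (f (\<sigma> t \<omega>)) (v t)) (at t)"
    using assms by (auto simp: orbit_in_def)
  have eq: "(case skew \<sigma> (shifted f l) s (\<omega>, v 0) of (\<omega>, x) \<Rightarrow> deriv (f \<omega>) x) - m = deriv (f (\<sigma> s \<omega>)) (v s) - m" for s
    by (simp add: skew_def complete_trajectory_sol[OF tr])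
  have "(LBINT s=ereal 0..ereal t. deriv (f (\<sigma> s \<omega>)) (v s) - m) = (V t - m * t) - (V 0 - m * 0)"
  proof (rule interval_integral_FTC_finite)
    show "continuous_on {min 0 t..max 0 t} (\<lambda>s. deriv (f (\<sigma> s \<omega>)) (v s) - m)"
      by (intro continuous_on_diff fx_continuous continuous_flow_comp continuous_on_id continuous_on_const
          continuous_on_subset[OF trajectory_continuous[OF tr]] subset_UNIV)
    fix s
    have "((\<lambda>s. V s - m * s) has_real_derivative deriv (f (\<sigma> s \<omega>)) (v s) - m) (at s)"
      by (intro DERIV_diff V DERIV_cmult_Id)
    then show "((\<lambda>s. V s - m * s) has_vector_derivative deriv (f (\<sigma> s \<omega>)) (v s) - m) (at s within {min 0 t..max 0 t})"
      unfolding has_real_derivative_iff_has_vector_derivative by (rule has_vector_derivative_at_within)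
  qed
  then show ?thesis unfolding eq V0 by simp
qed

section \<open>Zero spectrum on the attractor\<close>

definition forward_rate :: "real \<Rightarrow> ('w \<times> real) set \<Rightarrow> real \<Rightarrow> real \<Rightarrow> bool" where
  "forward_rate l A C c \<longleftrightarrow> (\<forall>\<omega> v V t. orbit_in l A \<omega> v V \<longrightarrow> 0 \<le> t \<longrightarrow> V t \<le> C + c * t)"

definition backward_rate :: "real \<Rightarrow> ('w \<times> real) set \<Rightarrow> real \<Rightarrow> real \<Rightarrow> bool" where
  "backward_rate l A C c \<longleftrightarrow> (\<forall>\<omega> v V t. orbit_in l A \<omega> v V \<longrightarrow> t \<le> 0 \<longrightarrow> V t \<le> C + c * t)"

text \<open>
  In terms of primitives the constant \<open>k\<close> of a dichotomy becomes the additive constant \<open>C\<close>, and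
  the shift of the coefficient by \<open>m\<close> becomes a shift of the rate.
\<close>

lemma dichotomy_iff:
  assumes A: "skew_invariant \<sigma> (shifted f l) A"
  shows "exponential_dichotomy A (skew \<sigma> (shifted f l)) (\<lambda>y. (case y of (\<omega>, x) \<Rightarrow> deriv (f \<omega>) x) - m) \<longleftrightarrow>
    (\<exists>C d. 0 < d \<and> (forward_rate l A C (m - d) \<or> backward_rate l A C (m + d)))"
proof
  let ?I = "\<lambda>y t. LBINT s=ereal 0..ereal t. (case skew \<sigma> (shifted f l) s y of (\<omega>, x) \<Rightarrow> deriv (f \<omega>) x) - m"
  have bound: "V t - m * t \<le> ln k + r" if "orbit_in l A \<omega> v V" "exp (?I (\<omega>, v 0) t) \<le> k * exp r" "1 \<le> k" for \<omega> v V t k r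
  proof -
    have "exp (V t - m * t) \<le> k * exp r" using that(1,2) by (simp only: dichotomy_integrand)
    also have "\<dots> = exp (ln k + r)" using that(3) by (simp add: exp_add)
    finally show ?thesis by simp
  qed
  have bound': "exp (?I y t) \<le> exp (max C 0) * exp r"
    if yA: "y \<in> A" and le: "\<And>\<omega> v V. orbit_in l A \<omega> v V \<Longrightarrow> V t - m * t \<le> C + r" for y t C r
  proof -
    obtain \<omega> x where y: "y = (\<omega>, x)" by (cases y)
    obtain v V where o: "orbit_in l A \<omega> v V" "v 0 = x" using orbit_in_exists[OF A] yA y by blast
    have "?I y t = V t - m * t" using dichotomy_integrand[OF o(1)] by (simp only: y o(2))
    also have "\<dots> \<le> max C 0 + r" using le[OF o(1)] by linarith
    finally show ?thesis by (simp add: exp_add[symmetric])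
  qed
  {
    assume "exponential_dichotomy A (skew \<sigma> (shifted f l)) (\<lambda>y. (case y of (\<omega>, x) \<Rightarrow> deriv (f \<omega>) x) - m)"
    then obtain k d where kd: "1 \<le> k" "0 < d" and
      alt: "(\<forall>y\<in>A. \<forall>t\<ge>0. exp (?I y t) \<le> k * exp (- d * t)) \<or> (\<forall>y\<in>A. \<forall>t\<le>0. exp (?I y t) \<le> k * exp (d * t))"
      unfolding exponential_dichotomy_def by blast
    have start: "(\<omega>, v 0) \<in> A" if "orbit_in l A \<omega> v V" for \<omega> v V
      using that unfolding orbit_in_def by (metis flow_0)
    have "forward_rate l A (ln k) (m - d)" if 1: "\<forall>y\<in>A. \<forall>t\<ge>0. exp (?I y t) \<le> k * exp (- d * t)"
      unfolding forward_rate_def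
    proof (intro allI impI)
      fix \<omega> v V t assume o: "orbit_in l A \<omega> v V" "(0::real) \<le> t"
      have "exp (?I (\<omega>, v 0) t) \<le> k * exp (- d * t)" using 1 start[OF o(1)] o(2) by blast
      from bound[OF o(1) this kd(1)] show "V t \<le> ln k + (m - d) * t" by (simp add: left_diff_distrib)
    qed
    moreover have "backward_rate l A (ln k) (m + d)" if 1: "\<forall>y\<in>A. \<forall>t\<le>0. exp (?I y t) \<le> k * exp (d * t)"
      unfolding backward_rate_def
    proof (intro allI impI)
      fix \<omega> v V t assume o: "orbit_in l A \<omega> v V" "t \<le> (0::real)"
      have "exp (?I (\<omega>, v 0) t) \<le> k * exp (d * t)" using 1 start[OF o(1)] o(2) by blast
      from bound[OF o(1) this kd(1)] show "V t \<le> ln k + (m + d) * t" by (simp add: distrib_right)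
    qed
    ultimately show "\<exists>C d. 0 < d \<and> (forward_rate l A C (m - d) \<or> backward_rate l A C (m + d))"
      using alt kd(2) by blast
  next
    assume "\<exists>C d. 0 < d \<and> (forward_rate l A C (m - d) \<or> backward_rate l A C (m + d))"
    then obtain C d where d: "0 < d" and alt: "forward_rate l A C (m - d) \<or> backward_rate l A C (m + d)" by blast
    have "exp (?I y t) \<le> exp (max C 0) * exp (- d * t)" if "forward_rate l A C (m - d)" "y \<in> A" "0 \<le> t" for y t
    proof (rule bound'[OF that(2)])
      fix \<omega> v V assume "orbit_in l A \<omega> v V"
      then have "V t \<le> C + (m - d) * t" using that unfolding forward_rate_def by blast
      then show "V t - m * t \<le> C + - d * t" by (simp add: left_diff_distrib)
    qed
    moreover have "exp (?I y t) \<le> exp (max C 0) * exp (d * t)" if "backward_rate l A C (m + d)" "y \<in> A" "t \<le> 0" for y t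
    proof (rule bound'[OF that(2)])
      fix \<omega> v V assume "orbit_in l A \<omega> v V"
      then have "V t \<le> C + (m + d) * t" using that unfolding backward_rate_def by blast
      then show "V t - m * t \<le> C + d * t" by (simp add: distrib_right)
    qed
    ultimately show "exponential_dichotomy A (skew \<sigma> (shifted f l)) (\<lambda>y. (case y of (\<omega>, x) \<Rightarrow> deriv (f \<omega>) x) - m)"
      unfolding exponential_dichotomy_def using alt d
      by - (rule exI[of _ "exp (max C 0)"], rule exI[of _ d], auto)
  }
qed

text \<open>
  Spectrum \<open>{0}\<close> gives a dichotomy at \<open>- d\<close> and at \<open>d\<close>, but none at \<open>0\<close>. At \<open>- d\<close> the forward
  alternative would imply a dichotomy at \<open>0\<close>, so the backward one holds, which read from the other
  end of the orbit segment is a lower bound. At \<open>d\<close> the roles are exchanged.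
\<close>

lemma zero_spectrum_rates:
  assumes A: "skew_invariant \<sigma> (shifted f l) A"
    and spec: "sacker_sell_spectrum A (skew \<sigma> (shifted f l)) (\<lambda>(\<omega>, x). deriv (f \<omega>) x) = {0}"
    and d: "0 < d"
  shows "\<exists>C. \<forall>\<omega> v V t. orbit_in l A \<omega> v V \<longrightarrow> 0 \<le> t \<longrightarrow> - C - d * t \<le> V t \<and> V t \<le> C + d * t"
proof -
  have ed: "(\<exists>C d. 0 < d \<and> (forward_rate l A C (m - d) \<or> backward_rate l A C (m + d))) \<longleftrightarrow> m \<noteq> 0" for m
  proof -
    have "m \<in> sacker_sell_spectrum A (skew \<sigma> (shifted f l)) (\<lambda>(\<omega>, x). deriv (f \<omega>) x) \<longleftrightarrow> m = 0" using spec by simp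
    then show ?thesis unfolding sacker_sell_spectrum_def mem_Collect_eq dichotomy_iff[OF A] by blast
  qed
  have no_decay: "\<not> forward_rate l A C (- e)" "\<not> backward_rate l A C e" if "0 < e" for C e
    using ed[of 0] that by auto
  obtain C1 d1 where 1: "0 < d1" "forward_rate l A C1 (- d - d1) \<or> backward_rate l A C1 (- d + d1)"
    using ed[of "- d"] d by auto
  have b: "backward_rate l A C1 (- d + d1)" using 1 no_decay(1)[of "d + d1" C1] d by auto
  obtain C2 d2 where 2: "0 < d2" "forward_rate l A C2 (d - d2) \<or> backward_rate l A C2 (d + d2)"
    using ed[of d] d by auto
  have u: "forward_rate l A C2 (d - d2)" using 2 no_decay(2)[of "d + d2" C2] d by auto
  show ?thesis
  proof (intro exI[of _ "max C1 C2"] allI impI conjI)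
    fix \<omega> v V t assume o: "orbit_in l A \<omega> v V" and t: "(0::real) \<le> t"
    have V0: "V 0 = 0" using o by (simp add: orbit_in_def)
    have "V (- t + t) - V t \<le> C1 + (- d + d1) * (- t)"
      using b orbit_in_shift[OF o, of t] t unfolding backward_rate_def by (metis neg_le_0_iff_le)
    then have "- V t \<le> C1 + d * t - d1 * t" by (simp add: V0 left_diff_distrib)
    moreover have "0 \<le> d1 * t" using 1 t by simp
    ultimately show "- max C1 C2 - d * t \<le> V t" by linarith
    have "V t \<le> C2 + (d - d2) * t" using u o t unfolding forward_rate_def by blast
    moreover have "0 \<le> d2 * t" using 2 t by simp
    ultimately show "V t \<le> max C1 C2 + d * t" by (simp add: left_diff_distrib)
  qed
qed

text \<open>
  Each point of \<open>K\<close> lies in the image of \<open>K\<close> at every time, and those images approach \<open>A\<close>.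
\<close>

lemma bounded_invariant_subset_attractor:
  assumes A: "global_attractor \<sigma> (shifted f l) A"
    and K: "skew_invariant \<sigma> (shifted f l) K" "bounded K"
  shows "K \<subseteq> A"
proof
  fix p assume p: "p \<in> K"
  obtain \<omega> x where px: "p = (\<omega>, x)" by (cases p)
  obtain v V where o: "orbit_in l K \<omega> v V" "v 0 = x" using orbit_in_exists[OF K(1)] p px by blast
  have tr: "trajectory l \<omega> UNIV v" and inK: "\<And>t. (\<sigma> t \<omega>, v t) \<in> K" using o(1) by (auto simp: orbit_in_def)
  have recur: "p \<in> skew \<sigma> (shifted f l) t ` K" for t
  proof -
    have "orbit_in l K (\<sigma> (- t) \<omega>) (\<lambda>s. v (s + - t)) (\<lambda>s. V (s + - t) - V (- t))" by (rule orbit_in_shift[OF o(1)])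
    then have "trajectory l (\<sigma> (- t) \<omega>) UNIV (\<lambda>s. v (s + - t))" by (simp only: orbit_in_def)
    from complete_trajectory_sol(2)[OF this, of t]
    have "sol \<sigma> (shifted f l) t (\<sigma> (- t) \<omega>) (v (- t)) = x" using o(2) by simp
    moreover have "\<sigma> t (\<sigma> (- t) \<omega>) = \<omega>" by (simp flip: flow_add)
    ultimately have "p = skew \<sigma> (shifted f l) t (\<sigma> (- t) \<omega>, v (- t))" by (simp add: skew_def px)
    then show ?thesis using inK[of "- t"] by blast
  qed
  show "p \<in> A"
  proof (rule ccontr)
    assume "p \<notin> A"
    moreover have "closed A" using A by (auto simp: global_attractor_def intro: compact_imp_closed)
    ultimately obtain e where e: "0 < e" "ball p e \<subseteq> - A" by (metis open_Compl Compl_iff open_contains_ball)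
    have "ennreal e \<le> (INF a\<in>A. ennreal (dist p a))"
    proof (rule INF_greatest)
      fix a assume "a \<in> A"
      then have "a \<notin> ball p e" using e(2) by blast
      then show "ennreal e \<le> ennreal (dist p a)" by (intro ennreal_leI) simp
    qed
    moreover have "(INF a\<in>A. ennreal (dist p a)) \<le> hausdorff_semidist (skew \<sigma> (shifted f l) t ` K) A" for t
      unfolding hausdorff_semidist_def by (rule SUP_upper[OF recur])
    ultimately have ge: "ennreal e \<le> hausdorff_semidist (skew \<sigma> (shifted f l) t ` K) A" for t
      by (rule order_trans)
    have "((\<lambda>t. hausdorff_semidist (skew \<sigma> (shifted f l) t ` K) A) \<longlongrightarrow> 0) at_top"
      using A K(2) by (simp add: global_attractor_def)
    then have "eventually (\<lambda>t. hausdorff_semidist (skew \<sigma> (shifted f l) t ` K) A < ennreal e) at_top"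
      using e(1) by (intro order_tendstoD(2)) auto
    then obtain t where "hausdorff_semidist (skew \<sigma> (shifted f l) t ` K) A < ennreal e"
      using eventually_happens trivial_limit_at_top_linorder by blast
    then show False using ge[of t] by simp
  qed
qed

lemma bounded_strip_subset: "K \<subseteq> UNIV \<times> {- B..B} \<Longrightarrow> bounded (K :: ('w \<times> real) set)"
  using compact_imp_bounded[OF compact_strip] bounded_subset by blast

lemma bounded_trajectory_in_attractor:
  assumes A: "global_attractor \<sigma> (shifted f l) A"
    and v: "trajectory l \<omega> UNIV v" "\<And>t. \<bar>v t\<bar> \<le> B"
  shows "(\<sigma> t \<omega>, v t) \<in> A"
proof -
  define K where "K = range (\<lambda>t. (\<sigma> t \<omega>, v t))"
  have "skew_invariant \<sigma> (shifted f l) K"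
  proof (rule skew_invariantI)
    fix \<omega>' x assume "(\<omega>', x) \<in> K"
    then obtain s where s: "\<omega>' = \<sigma> s \<omega>" "x = v s" by (auto simp: K_def)
    have "trajectory l (\<sigma> s \<omega>) UNIV (\<lambda>t. v (t + s))"
      using trajectory_shift[OF v(1), of s] by (simp add: surj_diff_right)
    moreover have "(\<sigma> t \<omega>', v (t + s)) \<in> K" for t
      unfolding K_def s(1) flow_add[symmetric] by (rule rangeI)
    ultimately show "\<exists>w. w 0 = x \<and> trajectory l \<omega>' UNIV w \<and> (\<forall>t. (\<sigma> t \<omega>', w t) \<in> K)"
      by (intro exI[of _ "\<lambda>t. v (t + s)"]) (simp add: s)
  qed
  moreover have "K \<subseteq> UNIV \<times> {- B..B}" using v(2) by (auto simp: K_def abs_le_iff minus_le_iff)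
  ultimately have "K \<subseteq> A" using bounded_invariant_subset_attractor[OF A] bounded_strip_subset by blast
  then show ?thesis by (auto simp: K_def)
qed

text \<open>
  An orbit \<open>u\<close> in \<open>M\<close> has a complete bounded orbit \<open>v\<close> for \<open>l0\<close> below or above it, which belongs to
  the attractor. The sum of the two primitives decays at rate \<open>c1\<close>, and \<open>V\<close> alone decays at most
  at rate \<open>c1 / 2\<close>.
\<close>

lemma attractive_off_zero_spectrum:
  assumes A: "global_attractor \<sigma> (shifted f l0) A"
    and spec: "sacker_sell_spectrum A (skew \<sigma> (shifted f l0)) (\<lambda>(\<omega>, x). deriv (f \<omega>) x) = {0}"
    and M: "compact M" "skew_invariant \<sigma> (shifted f l) M" and l: "l \<noteq> l0"
  shows "hyperbolic_attractive \<sigma> (shifted f l) M"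
proof -
  have Ainv: "skew_invariant \<sigma> (shifted f l0) A" using A by (simp add: global_attractor_def)
  obtain B0 where B0: "M \<subseteq> UNIV \<times> {- B0..B0}" using compact_in_strip[OF M(1)] by blast
  obtain B where B: "traps l0 B" "B0 \<le> B" using exists_trap[of l0 B0] by blast
  have Bpos: "0 < B" using B(1) by (simp add: traps_def)
  define S where "S = (UNIV :: 'w set) \<times> {- B..B :: real}"
  have "min l l0 < max l l0" using l by simp
  then obtain C1 c1 where c1: "0 < c1" and pair:
    "\<And>\<omega> p q P Q t. orbit_in (min l l0) S \<omega> p P \<Longrightarrow> orbit_in (max l l0) S \<omega> q Q \<Longrightarrow>
      (\<And>t. p t \<le> q t) \<Longrightarrow> 0 \<le> t \<Longrightarrow> P t + Q t \<le> C1 - c1 * t"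
    using ordered_pair_decay[OF _ Bpos, of "min l l0" "max l l0"] unfolding S_def by blast
  have c1h: "0 < c1 / 2" using c1 by simp
  obtain C2 where C2: "\<And>\<omega> v V t. orbit_in l0 A \<omega> v V \<Longrightarrow> 0 \<le> t \<Longrightarrow> - C2 - c1 / 2 * t \<le> V t"
    using zero_spectrum_rates[OF Ainv spec c1h] by metis
  show ?thesis
  proof (rule attractive_if_decay[OF M(2) B0 c1h, of "C1 + C2"])
    fix \<omega> u U t assume o: "orbit_in l M \<omega> u U" and t: "(0::real) \<le> t"
    have u: "trajectory l \<omega> UNIV u" "\<And>t. (\<sigma> t \<omega>, u t) \<in> M" "U 0 = 0"
      "\<And>t. (U has_real_derivative deriv (f (\<sigma> t \<omega>)) (u t)) (at t)"
      using o by (auto simp: orbit_in_def)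
    have uB: "\<bar>u s\<bar> \<le> B" for s using subsetD[OF B0 u(2)[of s]] B(2) by (simp add: abs_le_iff)
    obtain v where v: "trajectory l0 \<omega> UNIV v" "\<And>t. \<bar>v t\<bar> \<le> B" "\<And>t. 0 \<le> (l - l0) * (u t - v t)"
      using exists_ordered_trajectory[OF u(1) uB B(1)] l by blast
    obtain V where V: "V 0 = 0" "\<And>t. (V has_real_derivative deriv (f (\<sigma> t \<omega>)) (v t)) (at t)"
      using trajectory_antiderivative[OF v(1)] by blast
    have oA: "orbit_in l0 A \<omega> v V"
      using v(1) V bounded_trajectory_in_attractor[OF A v(1,2)] by (simp add: orbit_in_def)
    have oS: "orbit_in l S \<omega> u U" "orbit_in l0 S \<omega> v V"
      using o oA uB v(2) by (simp_all add: orbit_in_def S_def abs_le_iff minus_le_iff)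
    have "- C2 - c1 / 2 * t \<le> V t" by (rule C2[OF oA t])
    moreover have "U t + V t \<le> C1 - c1 * t"
    proof (cases "l < l0")
      case True
      then have "u s \<le> v s" for s using v(3)[of s] by (simp add: zero_le_mult_iff)
      then show ?thesis using True oS by (intro pair[OF _ _ _ t, of \<omega> u U v V]) simp_all
    next
      case False
      then have gt: "l0 < l" using l by simp
      then have "v s \<le> u s" for s using v(3)[of s] by (simp add: zero_le_mult_iff)
      then have "V t + U t \<le> C1 - c1 * t" using gt oS by (intro pair[OF _ _ _ t, of \<omega> v V u U]) simp_all
      then show ?thesis by simp
    qed
    ultimately show "U t \<le> C1 + C2 - c1 / 2 * t" by (simp add: field_simps)
  qed
qed

lemma nonhyperbolic_at_zero_spectrum:
  assumes A: "global_attractor \<sigma> (shifted f l) A"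
    and spec: "sacker_sell_spectrum A (skew \<sigma> (shifted f l)) (\<lambda>(\<omega>, x). deriv (f \<omega>) x) = {0}"
    and M: "compact M" "skew_invariant \<sigma> (shifted f l) M" "M \<noteq> {}"
  shows "nonhyperbolic \<sigma> (shifted f l) M"
proof -
  have Ainv: "skew_invariant \<sigma> (shifted f l) A" using A by (simp add: global_attractor_def)
  obtain B where B: "M \<subseteq> UNIV \<times> {- B..B}" using compact_in_strip[OF M(1)] by blast
  have MA: "M \<subseteq> A" by (rule bounded_invariant_subset_attractor[OF A M(2) compact_imp_bounded[OF M(1)]])
  obtain \<omega> x where "(\<omega>, x) \<in> M" using M(3) by auto
  then obtain v V where o: "orbit_in l M \<omega> v V" using orbit_in_exists[OF M(2)] by blast
  have oA: "orbit_in l A \<omega> v V" using o MA by (auto simp: orbit_in_def)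
  have large: "\<exists>t\<ge>0. C < g * t" if "0 < g" for C g :: real
    using that by (intro exI[of _ "(\<bar>C\<bar> + 1) / g"]) auto
  have "\<not> hyperbolic_attractive \<sigma> (shifted f l) M"
  proof
    assume hyp: "hyperbolic_attractive \<sigma> (shifted f l) M"
    have seg: "closed_segment 0 t \<subseteq> {0..}" if "t \<in> {0..}" for t :: real
      using that by (auto simp: closed_segment_eq_real_ivl)
    obtain C g where g: "0 < g" "\<And>\<omega> v V t. orbit_in l M \<omega> v V \<Longrightarrow> t \<in> {0..} \<Longrightarrow> V t \<le> C - g * \<bar>t\<bar>"
      using hyperbolic_imp_rate[OF hyp B _ seg] by (metis atLeast_iff order_refl)
    obtain C2 where C2: "\<And>\<omega> v V t. orbit_in l A \<omega> v V \<Longrightarrow> 0 \<le> t \<Longrightarrow> - C2 - g / 2 * t \<le> V t"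
      using zero_spectrum_rates[OF Ainv spec half_gt_zero[OF g(1)]] by metis
    obtain t where t: "0 \<le> t" "C + C2 < g / 2 * t" using large[of "g / 2" "C + C2"] g(1) by auto
    have "V t \<le> C - g * t" using g(2)[OF o, of t] t(1) by simp
    moreover have "- C2 - g / 2 * t \<le> V t" by (rule C2[OF oA t(1)])
    moreover have "g * t = g / 2 * t + g / 2 * t" by simp
    ultimately show False using t(2) by linarith
  qed
  moreover have "\<not> hyperbolic_repulsive \<sigma> (shifted f l) M"
  proof
    assume hyp: "hyperbolic_repulsive \<sigma> (shifted f l) M"
    have seg: "closed_segment 0 t \<subseteq> {..0}" if "t \<in> {..0}" for t :: real
      using that by (auto simp: closed_segment_eq_real_ivl split: if_splits)
    obtain C g where g: "0 < g" "\<And>\<omega> v V t. orbit_in l M \<omega> v V \<Longrightarrow> t \<in> {..0} \<Longrightarrow> V t \<le> C - g * \<bar>t\<bar>"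
      using hyperbolic_imp_rate[OF hyp B _ seg] by (metis atMost_iff order_refl)
    obtain C2 where C2: "\<And>\<omega> v V t. orbit_in l A \<omega> v V \<Longrightarrow> 0 \<le> t \<Longrightarrow> V t \<le> C2 + g / 2 * t"
      using zero_spectrum_rates[OF Ainv spec half_gt_zero[OF g(1)]] by metis
    obtain t where t: "0 \<le> t" "C + C2 < g / 2 * t" using large[of "g / 2" "C + C2"] g(1) by auto
    have "V (- t + t) - V t \<le> C - g * \<bar>- t\<bar>" by (rule g(2)[OF orbit_in_shift[OF o, of t]]) (use t in simp)
    then have "- V t \<le> C - g * t" using t(1) o by (simp add: orbit_in_def)
    moreover have "V t \<le> C2 + g / 2 * t" by (rule C2[OF oA t(1)])
    moreover have "g * t = g / 2 * t + g / 2 * t" by simp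
    ultimately show False using t(2) by linarith
  qed
  ultimately show ?thesis by (simp add: nonhyperbolic_def)
qed

theorem only_nonhyperbolic_parameter:
  assumes A: "global_attractor \<sigma> (shifted f l0) A"
    and spec: "sacker_sell_spectrum A (skew \<sigma> (shifted f l0)) (\<lambda>(\<omega>, x). deriv (f \<omega>) x) = {0}"
    and ex: "minimal_set \<sigma> (shifted f l0) M0"
  shows "{l. \<exists>M. minimal_set \<sigma> (shifted f l) M \<and> nonhyperbolic \<sigma> (shifted f l) M} = {l0}"
proof (intro equalityI subsetI)
  fix l assume "l \<in> {l. \<exists>M. minimal_set \<sigma> (shifted f l) M \<and> nonhyperbolic \<sigma> (shifted f l) M}"
  then obtain M where "minimal_set \<sigma> (shifted f l) M" "nonhyperbolic \<sigma> (shifted f l) M" by blast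
  then show "l \<in> {l0}"
    using attractive_off_zero_spectrum[OF A spec, of M l] by (auto simp: minimal_set_def nonhyperbolic_def)
next
  fix l assume "l \<in> {l0}"
  moreover have "nonhyperbolic \<sigma> (shifted f l0) M0"
    using ex by (intro nonhyperbolic_at_zero_spectrum[OF A spec]) (simp_all add: minimal_set_def)
  ultimately show "l \<in> {l. \<exists>M. minimal_set \<sigma> (shifted f l) M \<and> nonhyperbolic \<sigma> (shifted f l) M}"
    using ex by auto
qed


section \<open>Copies of the base at different parameters\<close>

lemma equilibrium_orbit:
  assumes "continuous_equilibrium \<sigma> (shifted f l) \<beta>"
  shows "trajectory l \<omega> UNIV (\<lambda>t. \<beta> (\<sigma> t \<omega>))"
proof -
  have eq: "t \<in> sol_dom \<sigma> (shifted f l) \<omega> (\<beta> \<omega>)" "\<beta> (\<sigma> t \<omega>) = sol \<sigma> (shifted f l) t \<omega> (\<beta> \<omega>)" for t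
    using assms by (auto simp: continuous_equilibrium_def)
  show ?thesis unfolding eq(2) by (rule sol_trajectory(1)[OF eq(1)])
qed

text \<open>
  Every window of length \<open>n\<close> contributes at most \<open>- 1\<close>, and the incomplete last window is bounded.
\<close>

lemma decay_from_averages:
  fixes a :: "'w \<Rightarrow> real"
  assumes a: "continuous_on UNIV a" and neg: "\<And>\<omega>. integral {0..real n} (\<lambda>s. a (\<sigma> s \<omega>)) < - 1"
  shows "\<exists>C c. 0 < c \<and> (\<forall>\<omega> V t. V 0 = 0 \<longrightarrow> (\<forall>t. (V has_real_derivative a (\<sigma> t \<omega>)) (at t)) \<longrightarrow>
    0 \<le> t \<longrightarrow> V t \<le> C - c * t)"
proof -
  define N where "N = real n"
  have N: "0 < N" using neg by (cases n) (auto simp: N_def)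
  obtain B where B: "0 < B" "\<And>x. \<bar>a x\<bar> \<le> B" using compact_space_bounded[OF compact_space a] by blast
  have "V t \<le> B * N + 1 - 1 / N * t"
    if V0: "V 0 = 0" and V: "\<And>t. (V has_real_derivative a (\<sigma> t \<omega>)) (at t)" and t: "0 \<le> t" for \<omega> V t
  proof -
    have step: "V (r + N) \<le> V r - 1" for r
    proof -
      have "integral {0..N} (\<lambda>s. a (\<sigma> s (\<sigma> r \<omega>))) = V (N + r) - V (0 + r)"
      proof (rule integral_eq_antiderivative)
        show "((\<lambda>s. V (s + r)) has_real_derivative a (\<sigma> s (\<sigma> r \<omega>))) (at s)" for s
          using V[of "s + r"] by (simp add: DERIV_shift flow_add)
      qed (use N in simp)
      then show ?thesis using neg[of "\<sigma> r \<omega>"] by (simp add: N_def add.commute)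
    qed
    have steps: "V (r + real j * N) \<le> V r - real j" for r j
    proof (induction j)
      case (Suc j)
      have "V (r + real (Suc j) * N) = V ((r + real j * N) + N)" by (simp add: algebra_simps)
      also have "\<dots> \<le> V (r + real j * N) - 1" by (rule step)
      finally show ?case using Suc by simp
    qed simp
    define j where "j = nat \<lfloor>t / N\<rfloor>"
    define r where "r = t - real j * N"
    have j: "real j \<le> t / N" "t / N < real j + 1" using t N by (simp_all add: j_def)
    have r: "0 \<le> r" "r \<le> N" using j N by (simp_all add: r_def field_simps)
    have "V t \<le> V r - real j" using steps[of r j] by (simp add: r_def)
    moreover have "V r \<le> B * N"
    proof -
      have "\<bar>V r - V 0\<bar> \<le> B * \<bar>r - 0\<bar>" by (rule derivative_bound_imp_lipschitz[OF V B(2)])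
      also have "\<dots> \<le> B * N" using r B(1) by simp
      finally show ?thesis using V0 by linarith
    qed
    ultimately show ?thesis using j(2) by simp
  qed
  moreover have "0 < 1 / N" using N by simp
  ultimately show ?thesis by metis
qed

text \<open>
  If for some \<open>n\<close> all integrals of \<open>f\<^sub>x\<close> over orbit segments of length \<open>n\<close> were below \<open>- 1\<close>, the
  copy would be attractive; so for every \<open>n\<close> there is a segment with integral at least \<open>- 1\<close>,
  and averages along these segments lead to an ergodic measure.
\<close>

lemma nonattractive_copy_has_nonnegative_exponent:
  assumes \<beta>: "continuous_equilibrium \<sigma> (shifted f l) \<beta>"
    and non: "\<not> hyperbolic_attractive \<sigma> (shifted f l) (range (\<lambda>\<omega>. (\<omega>, \<beta> \<omega>)))"
  obtains \<mu> where "ergodic_prob \<sigma> \<mu>" "0 \<le> (LINT \<omega>|\<mu>. deriv (f \<omega>) (\<beta> \<omega>))"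
proof -
  let ?M = "range (\<lambda>\<omega>. (\<omega>, \<beta> \<omega>))"
  have c: "continuous_on UNIV \<beta>" using \<beta> by (simp add: continuous_equilibrium_def)
  define a where "a \<omega> = deriv (f \<omega>) (\<beta> \<omega>)" for \<omega>
  have a: "continuous_on UNIV a" unfolding a_def by (intro fx_continuous c continuous_on_id)
  obtain B where B: "\<And>x. \<bar>\<beta> x\<bar> \<le> B" using compact_space_bounded[OF compact_space c] by blast
  have MB: "?M \<subseteq> UNIV \<times> {- B..B}" using B by (auto simp: abs_le_iff minus_le_iff)
  have Minv: "skew_invariant \<sigma> (shifted f l) ?M"
    by (rule skew_invariantI) (use equilibrium_orbit[OF \<beta>] in \<open>auto intro!: exI[of _ "\<lambda>t. \<beta> (\<sigma> t _)"]\<close>)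
  have "\<exists>\<omega>. - 1 \<le> integral {0..real n} (\<lambda>s. a (\<sigma> s \<omega>))" for n
  proof (rule ccontr)
    assume "\<not> ?thesis"
    then have "integral {0..real n} (\<lambda>s. a (\<sigma> s \<omega>)) < - 1" for \<omega> by (simp add: not_le)
    from decay_from_averages[OF a this] obtain C d where d: "0 < d"
      "\<forall>\<omega> V t. V 0 = 0 \<longrightarrow> (\<forall>t. (V has_real_derivative a (\<sigma> t \<omega>)) (at t)) \<longrightarrow> 0 \<le> t \<longrightarrow> V t \<le> C - d * t"
      by blast
    have "hyperbolic_attractive \<sigma> (shifted f l) ?M"
    proof (rule attractive_if_decay[OF Minv MB d(1), of C])
      fix \<omega> v V t assume o: "orbit_in l ?M \<omega> v V" and t: "(0::real) \<le> t"
      have "v s = \<beta> (\<sigma> s \<omega>)" for s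
      proof -
        have "(\<sigma> s \<omega>, v s) \<in> ?M" using o by (simp only: orbit_in_def)
        then show ?thesis by auto
      qed
      then have "V 0 = 0" "\<forall>t. (V has_real_derivative a (\<sigma> t \<omega>)) (at t)" using o by (simp_all add: orbit_in_def a_def)
      then show "V t \<le> C - d * t" using d(2) t by blast
    qed
    then show False using non by simp
  qed
  from exists_ergodic_nonneg_integral[OF a this] that show ?thesis unfolding a_def by blast
qed

text \<open>
  The set \<open>K\<close> of all points on complete orbits for \<open>l1\<close> that are bounded by \<open>B\<close> and stay below \<open>\<beta>2\<close>
  is nonempty, compact and invariant, so it contains the unique minimal set, the graph of \<open>\<beta>1\<close>.
  Equality at one point is impossible, since there the gap has derivative \<open>l2 - l1 > 0\<close> and
  would be negative shortly before.
\<close>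

lemma copies_increase:
  assumes l: "l1 < l2"
    and \<beta>1: "continuous_equilibrium \<sigma> (shifted f l1) \<beta>1"
    and \<beta>2: "continuous_equilibrium \<sigma> (shifted f l2) \<beta>2"
    and unique: "\<And>M. minimal_set \<sigma> (shifted f l1) M \<Longrightarrow> M = range (\<lambda>\<omega>. (\<omega>, \<beta>1 \<omega>))"
  shows "\<beta>1 \<omega> < \<beta>2 \<omega>"
proof -
  have c: "continuous_on UNIV \<beta>2" using \<beta>2 by (simp add: continuous_equilibrium_def)
  obtain B0 where B0: "\<And>x. \<bar>\<beta>2 x\<bar> \<le> B0" using compact_space_bounded[OF compact_space c] by blast
  obtain B where B: "traps l1 B" "B0 \<le> B" using exists_trap[of l1 B0] by blast
  have b2: "\<bar>\<beta>2 x\<bar> \<le> B" for x using B0[of x] B(2) by linarith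
  have Bpos: "0 \<le> B" using B(1) by (simp add: traps_def)
  define below where "below \<omega> v \<longleftrightarrow> trajectory l1 \<omega> UNIV v \<and> (\<forall>t. \<bar>v t\<bar> \<le> B) \<and> (\<forall>t. v t \<le> \<beta>2 (\<sigma> t \<omega>))" for \<omega> v
  define K where "K = {(\<omega>, x). \<exists>v. below \<omega> v \<and> v 0 = x}"
  have ne: "K \<noteq> {}"
  proof -
    obtain v where v: "trajectory l1 \<omega> UNIV v" "\<And>t. \<bar>v t\<bar> \<le> B" "\<And>t. 0 \<le> (l2 - l1) * (\<beta>2 (\<sigma> t \<omega>) - v t)"
      using exists_ordered_trajectory[OF equilibrium_orbit[OF \<beta>2] b2 B(1)] l by (metis less_irrefl)
    have "v t \<le> \<beta>2 (\<sigma> t \<omega>)" for t using v(3)[of t] l by (simp add: zero_le_mult_iff)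
    then have "(\<omega>, v 0) \<in> K" using v by (auto simp: K_def below_def)
    then show ?thesis by blast
  qed
  have sub: "K \<subseteq> UNIV \<times> {- B..B}" by (auto simp: K_def below_def abs_le_iff minus_le_iff)
  have inv: "skew_invariant \<sigma> (shifted f l1) K"
  proof (rule skew_invariantI)
    fix \<omega> x assume "(\<omega>, x) \<in> K"
    then obtain v where v: "below \<omega> v" "v 0 = x" by (auto simp: K_def)
    have "(\<sigma> s \<omega>, v s) \<in> K" for s
    proof -
      have "trajectory l1 (\<sigma> s \<omega>) UNIV (\<lambda>t. v (t + s))"
        using v trajectory_shift[of l1 \<omega> UNIV v s] by (simp add: below_def surj_diff_right)
      moreover have "v (t + s) \<le> \<beta>2 (\<sigma> t (\<sigma> s \<omega>))" for t
        using v by (simp add: below_def flow_add[symmetric])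
      ultimately have "below (\<sigma> s \<omega>) (\<lambda>t. v (t + s))" using v by (simp add: below_def)
      then show ?thesis unfolding K_def by force
    qed
    then show "\<exists>v. v 0 = x \<and> trajectory l1 \<omega> UNIV v \<and> (\<forall>t. (\<sigma> t \<omega>, v t) \<in> K)"
      using v by (auto simp: below_def)
  qed
  have "closed K"
    unfolding closed_sequential_limits
  proof (intro allI impI, elim conjE)
    fix q p assume q: "\<forall>n. q n \<in> K" "q \<longlonglongrightarrow> p"
    have "\<forall>n. \<exists>v. below (fst (q n)) v \<and> v 0 = snd (q n)" using q(1) by (auto simp: K_def case_prod_unfold)
    then obtain v where v: "\<And>n. below (fst (q n)) (v n)" "\<And>n. v n 0 = snd (q n)" by metis
    have lim: "(\<lambda>n. fst (q n)) \<longlonglongrightarrow> fst p" "(\<lambda>n. v n 0) \<longlonglongrightarrow> snd p"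
      using q(2) by (auto simp: v(2) intro: tendsto_fst tendsto_snd)
    have 1: "trajectory l1 (fst (q n)) {- real n..real n} (v n)" for n
      using v(1)[of n] by (simp add: below_def trajectory_def)
    have 2: "\<bar>v n t\<bar> \<le> B" for n t using v(1)[of n] by (simp add: below_def)
    obtain u where u: "u 0 = snd p" "trajectory l1 (fst p) UNIV u" "\<And>t. (\<lambda>n. v n t) \<longlonglongrightarrow> u t" "\<And>t. \<bar>u t\<bar> \<le> B"
      using trajectory_limit[OF filterlim_real_sequentially lim(1) 1 2 lim(2) Bpos] by blast
    have "u t \<le> \<beta>2 (\<sigma> t (fst p))" for t
    proof (rule LIMSEQ_le)
      show "(\<lambda>n. v n t) \<longlonglongrightarrow> u t" by (rule u(3))
      have "isCont (\<lambda>x. \<beta>2 (\<sigma> t x)) (fst p)"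
        using continuous_shift[OF c, of t] by (simp add: continuous_on_eq_continuous_at)
      then show "(\<lambda>n. \<beta>2 (\<sigma> t (fst (q n)))) \<longlonglongrightarrow> \<beta>2 (\<sigma> t (fst p))"
        by (rule isCont_tendsto_compose[OF _ lim(1)])
      show "\<exists>N. \<forall>n\<ge>N. v n t \<le> \<beta>2 (\<sigma> t (fst (q n)))" using v(1) by (simp add: below_def)
    qed
    then have "below (fst p) u" using u by (simp add: below_def)
    then show "p \<in> K" using u(1) unfolding K_def by (cases p) auto
  qed
  have "compact (UNIV \<times> {- B..B} \<inter> K)" by (rule compact_Int_closed[OF compact_strip \<open>closed K\<close>])
  then have "compact K" using sub by (simp add: Int_absorb1)
  then obtain M where M: "M \<subseteq> K" "minimal_set \<sigma> (shifted f l1) M" by (rule minimal_set_exists[OF _ ne inv])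
  have le: "\<beta>1 \<omega> \<le> \<beta>2 \<omega>" for \<omega>
  proof -
    have "(\<omega>, \<beta>1 \<omega>) \<in> K" using M(1) unfolding unique[OF M(2)] by blast
    then obtain v where "below \<omega> v" "v 0 = \<beta>1 \<omega>" by (auto simp: K_def)
    then have "v 0 \<le> \<beta>2 (\<sigma> 0 \<omega>)" unfolding below_def by blast
    then show ?thesis using \<open>v 0 = \<beta>1 \<omega>\<close> by simp
  qed
  show ?thesis
  proof (rule ccontr)
    assume "\<not> ?thesis"
    then have eq: "\<beta>2 \<omega> = \<beta>1 \<omega>" using le[of \<omega>] by simp
    define d where "d t = \<beta>2 (\<sigma> t \<omega>) - \<beta>1 (\<sigma> t \<omega>)" for t
    have "(d has_real_derivative (f (\<sigma> 0 \<omega>) (\<beta>2 (\<sigma> 0 \<omega>)) + l2) - (f (\<sigma> 0 \<omega>) (\<beta>1 (\<sigma> 0 \<omega>)) + l1)) (at 0)"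
      unfolding d_def by (intro DERIV_diff trajectoryD[OF equilibrium_orbit] \<beta>1 \<beta>2 UNIV_I)
    then have "(d has_real_derivative l2 - l1) (at 0)" by (simp add: eq)
    then obtain e where e: "0 < e" "\<And>h. 0 < h \<Longrightarrow> h < e \<Longrightarrow> d (0 - h) < d 0"
      using DERIV_pos_inc_left[of d "l2 - l1" 0] l by auto
    have "d (0 - e / 2) < d 0" using e by simp
    moreover have "d 0 = 0" by (simp add: d_def eq)
    moreover have "0 \<le> d (0 - e / 2)" using le by (simp add: d_def)
    ultimately show False by simp
  qed
qed

text \<open>
  The function \<open>D\<close> is the derivative of \<open>h = ln (\<beta>2 - \<beta>1)\<close> along the flow. The difference quotients
  \<open>q n\<close> of \<open>h\<close> have integral zero by invariance and converge boundedly to \<open>D\<close>, so \<open>D\<close> has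
  integral zero as well.
\<close>

lemma exponents_of_ordered_copies:
  assumes \<mu>: "invariant_prob \<sigma> \<mu>" and l: "l1 < l2"
    and \<beta>1: "continuous_equilibrium \<sigma> (shifted f l1) \<beta>1"
    and \<beta>2: "continuous_equilibrium \<sigma> (shifted f l2) \<beta>2"
    and less: "\<And>\<omega>. \<beta>1 \<omega> < \<beta>2 \<omega>"
  shows "(LINT \<omega>|\<mu>. deriv (f \<omega>) (\<beta>1 \<omega>)) + (LINT \<omega>|\<mu>. deriv (f \<omega>) (\<beta>2 \<omega>)) < 0"
proof -
  interpret prob_space \<mu> using \<mu> by (simp add: invariant_prob_def)
  have sets: "sets \<mu> = sets borel" using \<mu> by (simp add: invariant_prob_def)
  have c: "continuous_on UNIV \<beta>1" "continuous_on UNIV \<beta>2"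
    using \<beta>1 \<beta>2 by (simp_all add: continuous_equilibrium_def)
  define e where "e = l2 - l1"
  define d where "d \<omega> = \<beta>2 \<omega> - \<beta>1 \<omega>" for \<omega>
  define D where "D \<omega> = (f \<omega> (\<beta>2 \<omega>) - f \<omega> (\<beta>1 \<omega>) + e) / d \<omega>" for \<omega>
  define h where "h \<omega> = ln (d \<omega>)" for \<omega>
  define a where "a \<omega> = (deriv (f \<omega>) (\<beta>1 \<omega>) + deriv (f \<omega>) (\<beta>2 \<omega>)) / 2" for \<omega>
  have e: "0 < e" using l by (simp add: e_def)
  have dpos: "0 < d \<omega>" for \<omega> using less by (simp add: d_def)
  have dc: "continuous_on UNIV d" unfolding d_def by (intro continuous_on_diff c)
  have Dc: "continuous_on UNIV D"
    unfolding D_def using dpos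
    by (intro continuous_on_divide continuous_on_add continuous_on_diff f_continuous c dc continuous_on_id continuous_on_const)
      (simp add: less_imp_neq[symmetric])
  have hc: "continuous_on UNIV h"
    unfolding h_def using dpos by (intro continuous_on_ln dc) (simp add: less_imp_neq[symmetric])
  have fc: "continuous_on UNIV (\<lambda>\<omega>. deriv (f \<omega>) (\<beta>1 \<omega>))" "continuous_on UNIV (\<lambda>\<omega>. deriv (f \<omega>) (\<beta>2 \<omega>))"
    by (intro fx_continuous c continuous_on_id)+
  have hd: "((\<lambda>t. h (\<sigma> t \<omega>)) has_real_derivative D (\<sigma> t \<omega>)) (at t)" for \<omega> t
  proof -
    have "((\<lambda>t. \<beta>2 (\<sigma> t \<omega>) - \<beta>1 (\<sigma> t \<omega>)) has_real_derivative
        (f (\<sigma> t \<omega>) (\<beta>2 (\<sigma> t \<omega>)) + l2) - (f (\<sigma> t \<omega>) (\<beta>1 (\<sigma> t \<omega>)) + l1)) (at t)"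
      by (intro DERIV_diff trajectoryD[OF equilibrium_orbit] \<beta>1 \<beta>2 UNIV_I)
    moreover have "D (\<sigma> t \<omega>) * d (\<sigma> t \<omega>) = (f (\<sigma> t \<omega>) (\<beta>2 (\<sigma> t \<omega>)) + l2) - (f (\<sigma> t \<omega>) (\<beta>1 (\<sigma> t \<omega>)) + l1)"
      using dpos[of "\<sigma> t \<omega>"] by (simp add: D_def e_def)
    ultimately have "((\<lambda>t. d (\<sigma> t \<omega>)) has_real_derivative D (\<sigma> t \<omega>) * d (\<sigma> t \<omega>)) (at t)"
      by (simp add: d_def)
    from DERIV_chain2[OF DERIV_ln_divide[OF dpos] this]
    show ?thesis using dpos[of "\<sigma> t \<omega>"] by (simp add: h_def)
  qed
  obtain G where G: "\<And>x. \<bar>D x\<bar> \<le> G" using compact_space_bounded[OF compact_space Dc] by blast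
  define q where "q n \<omega> = (h (\<sigma> (1 / real (Suc n)) \<omega>) - h \<omega>) / (1 / real (Suc n))" for n \<omega>
  have qb: "\<bar>q n \<omega>\<bar> \<le> G" for n \<omega>
  proof -
    define x where "x = 1 / real (Suc n)"
    have x: "0 < x" by (simp add: x_def)
    have "\<bar>h (\<sigma> x \<omega>) - h (\<sigma> 0 \<omega>)\<bar> \<le> G * \<bar>x - 0\<bar>"
      by (rule derivative_bound_imp_lipschitz[OF hd G])
    then show ?thesis unfolding q_def x_def[symmetric] using x by (simp add: abs_divide divide_le_eq)
  qed
  have hs: "continuous_on UNIV (\<lambda>\<omega>. h (\<sigma> t \<omega>))" for t by (rule continuous_shift[OF hc])
  have qc: "continuous_on UNIV (q n)" for n
    unfolding q_def by (intro continuous_on_divide continuous_on_diff hs hc continuous_on_const) simp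
  have q0: "integral\<^sup>L \<mu> (q n) = 0" for n
  proof -
    have "integral\<^sup>L \<mu> (\<lambda>\<omega>. h (\<sigma> (1 / real (Suc n)) \<omega>) - h \<omega>) = 0"
      using integrable_continuous_mean[OF \<mu> hs[of "1 / real (Suc n)"]] integrable_continuous_mean[OF \<mu> hc]
        integral_invariant[OF \<mu> borel_measurable_continuous_onI[OF hc], of "1 / real (Suc n)"] by simp
    then show ?thesis unfolding q_def by (simp only: integral_divide_zero)
  qed
  have "(\<lambda>n. integral\<^sup>L \<mu> (q n)) \<longlonglongrightarrow> integral\<^sup>L \<mu> D"
  proof (rule integral_dominated_convergence[where w="\<lambda>_. G"])
    have meas: "g \<in> borel_measurable \<mu>" if "continuous_on UNIV g" for g :: "'w \<Rightarrow> real"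
      using borel_measurable_continuous_onI[OF that] measurable_cong_sets[OF sets refl] by blast
    show "D \<in> borel_measurable \<mu>" "\<And>n. q n \<in> borel_measurable \<mu>" by (rule meas[OF Dc], rule meas[OF qc])
    show "AE x in \<mu>. norm (q n x) \<le> G" for n using qb by simp
    have "(\<lambda>n. q n \<omega>) \<longlonglongrightarrow> D \<omega>" for \<omega>
    proof -
      have diffq: "((\<lambda>k. (h (\<sigma> (0 + k) \<omega>) - h (\<sigma> 0 \<omega>)) / k) \<longlongrightarrow> D (\<sigma> 0 \<omega>)) (at 0)"
        using hd[of \<omega> 0] by (simp only: DERIV_def)
      have "filterlim (\<lambda>n. 1 / real (Suc n)) (at 0) sequentially"
        using LIMSEQ_inverse_real_of_nat by (auto simp: filterlim_at inverse_eq_divide)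
      from filterlim_compose[OF diffq this] show ?thesis by (simp add: q_def)
    qed
    then show "AE x in \<mu>. (\<lambda>n. q n x) \<longlonglongrightarrow> D x" by simp
  qed simp
  then have "(\<lambda>n. 0) \<longlonglongrightarrow> integral\<^sup>L \<mu> D" by (simp only: q0)
  from LIMSEQ_unique[OF this tendsto_const] have D0: "integral\<^sup>L \<mu> D = 0" .
  obtain U where U: "0 < U" "\<And>x. \<bar>d x\<bar> \<le> U" using compact_space_bounded[OF compact_space dc] by blast
  have pointwise: "a \<omega> + e / U \<le> D \<omega>" for \<omega>
  proof -
    have "d \<omega> * a \<omega> \<le> f \<omega> (\<beta>2 \<omega>) - f \<omega> (\<beta>1 \<omega>)"
      using hermite_hadamard[OF less, of \<omega>] by (simp only: d_def a_def)
    moreover have "d \<omega> * (e / U) \<le> e"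
      using mult_right_mono[of "d \<omega>" U "e / U"] U(2)[of \<omega>] U(1) e by (simp add: abs_le_iff)
    ultimately have "d \<omega> * (a \<omega> + e / U) \<le> f \<omega> (\<beta>2 \<omega>) - f \<omega> (\<beta>1 \<omega>) + e"
      unfolding distrib_left by linarith
    then show ?thesis using dpos[of \<omega>] by (simp add: D_def le_divide_eq mult.commute)
  qed
  have ia: "integrable \<mu> (\<lambda>\<omega>. deriv (f \<omega>) (\<beta>1 \<omega>))" "integrable \<mu> (\<lambda>\<omega>. deriv (f \<omega>) (\<beta>2 \<omega>))"
    by (rule integrable_continuous_mean[OF \<mu> fc(1)], rule integrable_continuous_mean[OF \<mu> fc(2)])
  then have ia': "integrable \<mu> a" unfolding a_def by simp
  have "integral\<^sup>L \<mu> (\<lambda>\<omega>. a \<omega> + e / U) \<le> integral\<^sup>L \<mu> D"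
    by (intro integral_mono integrable_continuous_mean[OF \<mu> Dc] pointwise) (use ia' in simp)
  then have "integral\<^sup>L \<mu> a + e / U \<le> 0" using ia' by (simp add: D0 prob_space)
  moreover have "0 < e / U" using e U by simp
  ultimately have "integral\<^sup>L \<mu> a < 0" by linarith
  then show ?thesis unfolding a_def using ia by simp
qed

text \<open>
  What a nonhyperbolic copy of the base leaves behind for the counting argument: an ergodic measure
  with respect to which its exponent is nonnegative.
\<close>

definition copy_at :: "real \<Rightarrow> 'w measure \<Rightarrow> bool" where
  "copy_at l \<mu> \<longleftrightarrow> (\<exists>\<beta>. continuous_equilibrium \<sigma> (shifted f l) \<beta> \<and>
     (\<forall>M. minimal_set \<sigma> (shifted f l) M \<longrightarrow> M = range (\<lambda>\<omega>. (\<omega>, \<beta> \<omega>))) \<and>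
     ergodic_prob \<sigma> \<mu> \<and> 0 \<le> (LINT \<omega>|\<mu>. deriv (f \<omega>) (\<beta> \<omega>)))"

lemma copy_at_exists:
  assumes "\<exists>!M. minimal_set \<sigma> (shifted f l) M" "minimal_set \<sigma> (shifted f l) M"
    "nonhyperbolic \<sigma> (shifted f l) M" "copy_of_base \<sigma> (shifted f l) M"
  shows "\<exists>\<mu>. copy_at l \<mu>"
proof -
  obtain \<beta> where \<beta>: "continuous_equilibrium \<sigma> (shifted f l) \<beta>" "M = range (\<lambda>\<omega>. (\<omega>, \<beta> \<omega>))"
    using assms(4) by (auto simp: copy_of_base_def)
  have "\<not> hyperbolic_attractive \<sigma> (shifted f l) (range (\<lambda>\<omega>. (\<omega>, \<beta> \<omega>)))"
    using assms(3) \<beta>(2) by (simp add: nonhyperbolic_def)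
  then obtain \<mu> where "ergodic_prob \<sigma> \<mu>" "0 \<le> (LINT \<omega>|\<mu>. deriv (f \<omega>) (\<beta> \<omega>))"
    by (rule nonattractive_copy_has_nonnegative_exponent[OF \<beta>(1)])
  moreover have "\<forall>N. minimal_set \<sigma> (shifted f l) N \<longrightarrow> N = range (\<lambda>\<omega>. (\<omega>, \<beta> \<omega>))"
    using assms(1,2) \<beta>(2) by blast
  ultimately show ?thesis using \<beta>(1) unfolding copy_at_def by blast
qed

text \<open>
  For \<open>l1 < l2\<close> both exponents with respect to \<open>\<mu>\<close> would be nonnegative, although their sum is
  negative.
\<close>

lemma copy_at_unique:
  assumes "copy_at l1 \<mu>" "copy_at l2 \<mu>"
  shows "l1 = l2"
proof -
  have no: False if l: "l < l'" and copies: "copy_at l \<mu>" "copy_at l' \<mu>" for l l'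
  proof -
    obtain \<beta>1 where 1: "continuous_equilibrium \<sigma> (shifted f l) \<beta>1"
      "\<And>M. minimal_set \<sigma> (shifted f l) M \<Longrightarrow> M = range (\<lambda>\<omega>. (\<omega>, \<beta>1 \<omega>))"
      "ergodic_prob \<sigma> \<mu>" "0 \<le> (LINT \<omega>|\<mu>. deriv (f \<omega>) (\<beta>1 \<omega>))"
      using copies(1) unfolding copy_at_def by blast
    obtain \<beta>2 where 2: "continuous_equilibrium \<sigma> (shifted f l') \<beta>2" "0 \<le> (LINT \<omega>|\<mu>. deriv (f \<omega>) (\<beta>2 \<omega>))"
      using copies(2) unfolding copy_at_def by blast
    have "\<beta>1 \<omega> < \<beta>2 \<omega>" for \<omega> by (rule copies_increase[OF l 1(1) 2(1) 1(2)])
    moreover have "invariant_prob \<sigma> \<mu>" using 1(3) by (simp add: ergodic_prob_def)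
    ultimately have "(LINT \<omega>|\<mu>. deriv (f \<omega>) (\<beta>1 \<omega>)) + (LINT \<omega>|\<mu>. deriv (f \<omega>) (\<beta>2 \<omega>)) < 0"
      using exponents_of_ordered_copies[OF _ l 1(1) 2(1)] by blast
    then show False using 1(4) 2(2) by simp
  qed
  show ?thesis using no[of l1 l2] no[of l2 l1] assms by (cases l1 l2 rule: linorder_cases) auto
qed

end

theorem theorem5p15:
  fixes \<sigma> :: "real \<Rightarrow> 'w::metric_space \<Rightarrow> 'w"
    and f :: "'w \<Rightarrow> real \<Rightarrow> real"
  assumes "compact (UNIV :: 'w set)"
    and "continuous_flow \<sigma>"
    and "minimal_flow \<sigma>"
    and "C02 f" and "DC f" and "Co f"
    and "\<forall>l. \<exists>!M. minimal_set \<sigma> (shifted f l) M"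
  shows
    "(uniquely_ergodic \<sigma> \<longrightarrow>
        (\<forall>l1 l2 M1 M2.
           minimal_set \<sigma> (shifted f l1) M1 \<and> nonhyperbolic \<sigma> (shifted f l1) M1 \<and> copy_of_base \<sigma> (shifted f l1) M1 \<and>
           minimal_set \<sigma> (shifted f l2) M2 \<and> nonhyperbolic \<sigma> (shifted f l2) M2 \<and> copy_of_base \<sigma> (shifted f l2) M2
           \<longrightarrow> l1 = l2)) \<and>
     (finitely_ergodic \<sigma> \<longrightarrow>
        finite {l. \<exists>M. minimal_set \<sigma> (shifted f l) M \<and> nonhyperbolic \<sigma> (shifted f l) M \<and>
                       copy_of_base \<sigma> (shifted f l) M}) \<and>
     (\<forall>l0 A. global_attractor \<sigma> (shifted f l0) A \<and>
             sacker_sell_spectrum A (skew \<sigma> (shifted f l0)) (\<lambda>(\<omega>, x). deriv (f \<omega>) x) = {0} \<longrightarrow>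
        {l. \<exists>M. minimal_set \<sigma> (shifted f l) M \<and> nonhyperbolic \<sigma> (shifted f l) M} = {l0})"
proof -
  interpret dconcave_family \<sigma> f by unfold_locales fact+
  have copy: "\<exists>\<mu>. copy_at l \<mu>"
    if "minimal_set \<sigma> (shifted f l) M" "nonhyperbolic \<sigma> (shifted f l) M" "copy_of_base \<sigma> (shifted f l) M" for l M
    using copy_at_exists[OF _ that] assms(7) by blast
  show ?thesis
  proof (intro conjI impI allI)
    fix l1 l2 M1 M2
    assume unique: "uniquely_ergodic \<sigma>"
      and "minimal_set \<sigma> (shifted f l1) M1 \<and> nonhyperbolic \<sigma> (shifted f l1) M1 \<and> copy_of_base \<sigma> (shifted f l1) M1 \<and>
           minimal_set \<sigma> (shifted f l2) M2 \<and> nonhyperbolic \<sigma> (shifted f l2) M2 \<and> copy_of_base \<sigma> (shifted f l2) M2"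
    then obtain \<mu>1 \<mu>2 where \<mu>: "copy_at l1 \<mu>1" "copy_at l2 \<mu>2" using copy by blast
    then have "invariant_prob \<sigma> \<mu>1" "invariant_prob \<sigma> \<mu>2" by (auto simp: copy_at_def ergodic_prob_def)
    then have "\<mu>1 = \<mu>2" using unique by (auto simp: uniquely_ergodic_def)
    then show "l1 = l2" using \<mu> copy_at_unique by blast
  next
    assume fin: "finitely_ergodic \<sigma>"
    let ?S = "{l. \<exists>M. minimal_set \<sigma> (shifted f l) M \<and> nonhyperbolic \<sigma> (shifted f l) M \<and> copy_of_base \<sigma> (shifted f l) M}"
    have "\<forall>l\<in>?S. \<exists>\<mu>. copy_at l \<mu>" using copy by blast
    from bchoice[OF this] obtain m where m: "\<forall>l\<in>?S. copy_at l (m l)" by blast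
    have "inj_on m ?S"
    proof (rule inj_onI)
      fix l l' assume "l \<in> ?S" "l' \<in> ?S" and eq: "m l = m l'"
      then have "copy_at l (m l)" "copy_at l' (m l')" using bspec[OF m] by blast+
      then have "copy_at l (m l)" "copy_at l' (m l)" by (simp_all only: eq)
      then show "l = l'" by (rule copy_at_unique)
    qed
    moreover have "m ` ?S \<subseteq> {\<mu>. ergodic_prob \<sigma> \<mu>}"
    proof (rule image_subsetI)
      fix l assume "l \<in> ?S"
      then have "copy_at l (m l)" using bspec[OF m] by blast
      then show "m l \<in> {\<mu>. ergodic_prob \<sigma> \<mu>}" by (auto simp: copy_at_def)
    qed
    then have "finite (m ` ?S)" using fin by (auto simp: finitely_ergodic_def intro: finite_subset)
    ultimately show "finite ?S" by (rule finite_imageD[rotated])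
  next
    fix l0 A
    assume *: "global_attractor \<sigma> (shifted f l0) A \<and>
             sacker_sell_spectrum A (skew \<sigma> (shifted f l0)) (\<lambda>(\<omega>, x). deriv (f \<omega>) x) = {0}"
    obtain M0 where "minimal_set \<sigma> (shifted f l0) M0" using assms(7) by blast
    with * show "{l. \<exists>M. minimal_set \<sigma> (shifted f l) M \<and> nonhyperbolic \<sigma> (shifted f l) M} = {l0}"
      using only_nonhyperbolic_parameter by blast
  qed
qed

end
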